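(* Let $H$ and $H_0$ be two (possibly unbounded) self-adjoint operators in a separable infinite dimensional Hilbert space $\mathcal{H}$ with $\mathrm{Dom}(H)=\mathrm{Dom}(H_0)$ and $H-H_0\in\mathcal{B}_2(\mathcal{H})$. Let $$W_s=(H+i)(H_s+i)^{-1}(H_0+i)-i,\qquad H_s=sH_0+(1-s)H,\quad s\in[0,1].$$ Then there exists a measurable function $\xi:\mathbb{R}\to\mathbb{C}$ with $(1+\lambda^2)^{-1}\xi\in L^1(\mathbb{R})$ such that $$\operatorname{Tr}\Big\{\psi(H)-\psi(H_0)-\frac{d}{ds}\Big|_{s=0}\psi(W_s)\Big\}=\int_{-\infty}^{\infty}\frac{d}{d\lambda}\Big\{(1+\lambda^2)\psi'(\lambda)\Big\}\,\xi(\lambda)\,d\lambda$$ for each $\psi\in\mathcal{F}_{\mathbb{R}}$. In particular, for all $z\in\mathbb{C}$ with $\operatorname{Im}(z)<0$, $$\operatorname{Tr}\Big\{(H-z)^{-1}-(H_0-z)^{-1}-\frac{i+H_0}{H_0-z}\,M\,\frac{i+H_0}{H_0-z}\Big\}=\int_{-\infty}^{\infty}\frac{2(1+\lambda z)}{(\lambda-z)^3}\,\xi(\lambda)\,d\lambda,$$ where $M=(H+i)^{-1}-(H_0+i)^{-1}$.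
   Context: $\mathcal{B}_2(\mathcal{H})$ denotes the Hilbert-Schmidt operators. $\frac{i+H_0}{H_0-z}$ denotes the bounded operator $(i+H_0)(H_0-z)^{-1}$. $$\mathcal{F}_2^+(\mathbb{T})=\Big\{f(z)=\sum_{k=0}^\infty\hat f(k)z^k\in C^2(\mathbb{T}):\ \sum_{k=0}^\infty k^2|\hat f(k)|<\infty\Big\}$$ (with $\hat f(k)$ the Fourier coefficients), and $$\mathcal{F}_{\mathbb{R}}=\Big\{\psi:\mathbb{R}\to\mathbb{C}:\ \psi(\lambda)=\phi\Big(\frac{i-\lambda}{i+\lambda}\Big)\text{ for some }\phi\in\mathcal{F}_2^+(\mathbb{T})\Big\}.$$ For a contraction $T$ and $\phi\in\mathcal{F}_2^+(\mathbb{T})$, $\phi(T)=\sum_{k\ge0}\hat\phi(k)T^k$. With $U=(i-H)(i+H)^{-1}$, $U_0=(i-H_0)(i+H_0)^{-1}$ the Cayley transforms and $U_s=(1-s)U_0+sU$ (which equals $(i-W_s)(i+W_s)^{-1}$), for $\psi\in\mathcal{F}_{\mathbb{R}}$ corresponding to $\phi$ one has $\psi(H)=\phi(U)$, $\psi(H_0)=\phi(U_0)$, and $\psi(W_s)$ is understood as $\phi(U_s)$. The derivative in $s$ is taken in operator norm (one-sided at $s=0$ on $[0,1]$). *)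

theory Defs
  imports "HOL-Analysis.Analysis"
begin

section \<open>Complex Hilbert spaces\<close>

text \<open>The inner product is conjugate-linear in its first argument.\<close>

class complex_hilbert = banach +
  fixes scaleC :: "complex \<Rightarrow> 'a \<Rightarrow> 'a"  (infixr \<open>*\<^sub>C\<close> 75)
    and cinner :: "'a \<Rightarrow> 'a \<Rightarrow> complex"
  assumes scaleC_add_right: "c *\<^sub>C (x + y) = c *\<^sub>C x + c *\<^sub>C y"
    and scaleC_add_left: "(c + d) *\<^sub>C x = c *\<^sub>C x + d *\<^sub>C x"
    and scaleC_scaleC: "c *\<^sub>C d *\<^sub>C x = (c * d) *\<^sub>C x"
    and scaleR_scaleC: "r *\<^sub>R x = complex_of_real r *\<^sub>C x"
    and cinner_commute: "cinner x y = cnj (cinner y x)"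
    and cinner_add_right: "cinner x (y + z) = cinner x y + cinner x z"
    and cinner_scaleC_right: "cinner x (c *\<^sub>C y) = c * cinner x y"
    and cinner_norm: "cinner x x = complex_of_real ((norm x)\<^sup>2)"
begin

lemma scaleC_one: "1 *\<^sub>C x = x"
  using scaleR_scaleC[of 1 x, symmetric] local.scaleR_one[of x] by (simp only: of_real_1)

lemma cinner_scaleC_left: "cinner (c *\<^sub>C x) y = cnj c * cinner x y"
  using cinner_commute[of "c *\<^sub>C x" y] cinner_commute[of x y]
  by (simp add: cinner_scaleC_right)

lemma norm_scaleC: "norm (c *\<^sub>C x) = cmod c * norm x"
proof -
  have "cinner (c *\<^sub>C x) (c *\<^sub>C x) = (c * cnj c) * cinner x x"
    by (simp add: cinner_scaleC_left cinner_scaleC_right mult.assoc mult.left_commute)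
  then have "complex_of_real ((norm (c *\<^sub>C x))\<^sup>2) = complex_of_real ((cmod c * norm x)\<^sup>2)"
    by (simp only: cinner_norm complex_norm_square[symmetric] of_real_mult[symmetric]
        power_mult_distrib)
  then have "(norm (c *\<^sub>C x))\<^sup>2 = (cmod c * norm x)\<^sup>2"
    by (simp only: of_real_eq_iff)
  then show ?thesis by simp
qed

end

interpretation complex_vector:
  vector_space "scaleC :: complex \<Rightarrow> 'a \<Rightarrow> 'a::complex_hilbert"
  by unfold_locales
    (simp_all add: scaleC_add_right scaleC_add_left scaleC_scaleC scaleC_one)

lemma bounded_linear_scaleC:
  "bounded_linear ((*\<^sub>C) c :: 'a::complex_hilbert \<Rightarrow> 'a)"
  by (rule bounded_linear_intro[where K = "cmod c"])
    (simp_all add: scaleC_add_right scaleR_scaleC scaleC_scaleC norm_scaleC mult.commute)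

definition infinite_dimensional :: "'a::complex_hilbert itself \<Rightarrow> bool" where
  "infinite_dimensional _ \<longleftrightarrow>
     \<not> (\<exists>B :: 'a set. finite B \<and> complex_vector.span B = UNIV)"

definition separable :: "'a::topological_space itself \<Rightarrow> bool" where
  "separable _ \<longleftrightarrow> (\<exists>S :: 'a set. countable S \<and> closure S = UNIV)"

definition orthonormal_basis :: "'a::complex_hilbert set \<Rightarrow> bool" where
  "orthonormal_basis E \<longleftrightarrow>
     (\<forall>e\<in>E. \<forall>f\<in>E. cinner e f = (if e = f then 1 else 0)) \<and>
     (\<forall>x. (\<forall>e\<in>E. cinner e x = 0) \<longrightarrow> x = 0)"


section \<open>Bounded operators\<close>

text \<open>Bounded operators live in the library type of bounded real-linear maps, which supplies
  the operator norm; complex linearity is a separate predicate.\<close>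

definition complex_linear :: "('a::complex_hilbert \<Rightarrow>\<^sub>L 'a) \<Rightarrow> bool" where
  "complex_linear A \<longleftrightarrow> Vector_Spaces.linear (*\<^sub>C) (*\<^sub>C) (blinfun_apply A)"

definition scaleC_blinfun ::
    "complex \<Rightarrow> ('a::complex_hilbert \<Rightarrow>\<^sub>L 'a) \<Rightarrow> ('a \<Rightarrow>\<^sub>L 'a)" where
  "scaleC_blinfun c A = Blinfun ((*\<^sub>C) c) o\<^sub>L A"

lemma scaleC_blinfun_apply:
  "blinfun_apply (scaleC_blinfun c A) x = c *\<^sub>C blinfun_apply A x"
  by (simp add: scaleC_blinfun_def bounded_linear_Blinfun_apply bounded_linear_scaleC)

definition blinfun_power :: "('a::real_normed_vector \<Rightarrow>\<^sub>L 'a) \<Rightarrow> nat \<Rightarrow> ('a \<Rightarrow>\<^sub>L 'a)" where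
  "blinfun_power A k = ((o\<^sub>L) A ^^ k) id_blinfun"

definition adjoint_blinfun :: "('a::complex_hilbert \<Rightarrow>\<^sub>L 'a) \<Rightarrow> ('a \<Rightarrow>\<^sub>L 'a)" where
  "adjoint_blinfun A =
     (THE B. \<forall>x y. cinner (blinfun_apply B x) y = cinner x (blinfun_apply A y))"

definition positive_blinfun :: "('a::complex_hilbert \<Rightarrow>\<^sub>L 'a) \<Rightarrow> bool" where
  "positive_blinfun P \<longleftrightarrow>
     complex_linear P \<and> (\<forall>x. cinner x (blinfun_apply P x) \<in> \<real>\<^sub>\<ge>\<^sub>0)"

definition abs_blinfun :: "('a::complex_hilbert \<Rightarrow>\<^sub>L 'a) \<Rightarrow> ('a \<Rightarrow>\<^sub>L 'a)" where
  "abs_blinfun A = (THE P. positive_blinfun P \<and> P o\<^sub>L P = adjoint_blinfun A o\<^sub>L A)"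

text \<open>The two summability conditions and the value of the trace do not depend on the
  orthonormal basis.\<close>

definition hilbert_schmidt :: "('a::complex_hilbert \<Rightarrow>\<^sub>L 'a) \<Rightarrow> bool" where
  "hilbert_schmidt A \<longleftrightarrow> complex_linear A \<and>
     (\<exists>E. orthonormal_basis E \<and> (\<lambda>e. (norm (blinfun_apply A e))\<^sup>2) summable_on E)"

definition trace_class :: "('a::complex_hilbert \<Rightarrow>\<^sub>L 'a) \<Rightarrow> bool" where
  "trace_class A \<longleftrightarrow> complex_linear A \<and>
     (\<exists>E. orthonormal_basis E \<and>
        (\<lambda>e. cinner e (blinfun_apply (abs_blinfun A) e)) summable_on E)"

definition op_trace :: "('a::complex_hilbert \<Rightarrow>\<^sub>L 'a) \<Rightarrow> complex" where
  "op_trace A = (\<Sum>\<^sub>\<infinity>e\<in>(SOME E. orthonormal_basis E). cinner e (blinfun_apply A e))"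


section \<open>Unbounded operators\<close>

text \<open>A possibly unbounded operator is a partial map; \<open>dom\<close> is its domain. Sums and products
  (the library's \<open>\<circ>\<^sub>m\<close>) carry their natural domains.\<close>

type_synonym 'a unbounded_op = "'a \<rightharpoonup> 'a"

definition op_add ::
    "'a::complex_hilbert unbounded_op \<Rightarrow> 'a unbounded_op \<Rightarrow> 'a unbounded_op"  (infixl \<open>+\<^sub>o\<close> 65) where
  "S +\<^sub>o T = (\<lambda>x. if x \<in> dom S \<inter> dom T then Some (the (S x) + the (T x)) else None)"

definition op_diff ::
    "'a::complex_hilbert unbounded_op \<Rightarrow> 'a unbounded_op \<Rightarrow> 'a unbounded_op"  (infixl \<open>-\<^sub>o\<close> 65) where
  "S -\<^sub>o T = (\<lambda>x. if x \<in> dom S \<inter> dom T then Some (the (S x) - the (T x)) else None)"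

definition op_scale ::
    "complex \<Rightarrow> 'a::complex_hilbert unbounded_op \<Rightarrow> 'a unbounded_op"  (infixr \<open>*\<^sub>o\<close> 75) where
  "c *\<^sub>o T = (\<lambda>x. map_option ((*\<^sub>C) c) (T x))"

definition scalar_op :: "complex \<Rightarrow> 'a::complex_hilbert unbounded_op" where
  "scalar_op c = (\<lambda>x. Some (c *\<^sub>C x))"

definition op_inverse :: "'a::complex_hilbert unbounded_op \<Rightarrow> 'a unbounded_op" where
  "op_inverse T = (\<lambda>y. if \<exists>!x. T x = Some y then Some (THE x. T x = Some y) else None)"

definition op_of_blinfun :: "('a::complex_hilbert \<Rightarrow>\<^sub>L 'a) \<Rightarrow> 'a unbounded_op" where
  "op_of_blinfun A = (\<lambda>x. Some (blinfun_apply A x))"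

text \<open>Only meaningful for operators that are everywhere defined and bounded.\<close>

definition blinfun_of_op :: "'a::complex_hilbert unbounded_op \<Rightarrow> ('a \<Rightarrow>\<^sub>L 'a)" where
  "blinfun_of_op T = Blinfun (\<lambda>x. the (T x))"

definition linear_op :: "'a::complex_hilbert unbounded_op \<Rightarrow> bool" where
  "linear_op T \<longleftrightarrow> complex_vector.subspace (dom T) \<and>
     (\<forall>x\<in>dom T. \<forall>y\<in>dom T. the (T (x + y)) = the (T x) + the (T y)) \<and>
     (\<forall>c. \<forall>x\<in>dom T. the (T (c *\<^sub>C x)) = c *\<^sub>C the (T x))"

definition op_adjoint :: "'a::complex_hilbert unbounded_op \<Rightarrow> 'a unbounded_op" where
  "op_adjoint T = (\<lambda>y.
     if \<exists>w. \<forall>x\<in>dom T. cinner y (the (T x)) = cinner w x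
     then Some (THE w. \<forall>x\<in>dom T. cinner y (the (T x)) = cinner w x)
     else None)"

definition selfadjoint :: "'a::complex_hilbert unbounded_op \<Rightarrow> bool" where
  "selfadjoint T \<longleftrightarrow> linear_op T \<and> closure (dom T) = UNIV \<and> op_adjoint T = T"

definition cayley :: "'a::complex_hilbert unbounded_op \<Rightarrow> ('a \<Rightarrow>\<^sub>L 'a)" where
  "cayley T = blinfun_of_op ((scalar_op \<i> -\<^sub>o T) \<circ>\<^sub>m op_inverse (scalar_op \<i> +\<^sub>o T))"

definition resolvent :: "'a::complex_hilbert unbounded_op \<Rightarrow> complex \<Rightarrow> ('a \<Rightarrow>\<^sub>L 'a)" where
  "resolvent T z = blinfun_of_op (op_inverse (T -\<^sub>o scalar_op z))"

definition H_path ::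
    "'a::complex_hilbert unbounded_op \<Rightarrow> 'a unbounded_op \<Rightarrow> real \<Rightarrow> 'a unbounded_op" where
  "H_path H H0 s = complex_of_real s *\<^sub>o H0 +\<^sub>o complex_of_real (1 - s) *\<^sub>o H"

definition W_path ::
    "'a::complex_hilbert unbounded_op \<Rightarrow> 'a unbounded_op \<Rightarrow> real \<Rightarrow> 'a unbounded_op" where
  "W_path H H0 s =
     ((H +\<^sub>o scalar_op \<i>) \<circ>\<^sub>m op_inverse (H_path H H0 s +\<^sub>o scalar_op \<i>) \<circ>\<^sub>m (H0 +\<^sub>o scalar_op \<i>))
       -\<^sub>o scalar_op \<i>"


section \<open>Function classes and functional calculus\<close>

text \<open>A function on the unit circle is a function on all of the complex plane of which only the
  values on the circle matter.\<close>

definition fourier_coeff :: "(complex \<Rightarrow> complex) \<Rightarrow> int \<Rightarrow> complex" where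
  "fourier_coeff f k =
     integral {0..2 * pi} (\<lambda>t. f (cis t) * cis (- (of_int k * t))) / complex_of_real (2 * pi)"

definition C2_circle :: "(complex \<Rightarrow> complex) \<Rightarrow> bool" where
  "C2_circle f \<longleftrightarrow> (\<exists>f' f''.
     (\<forall>t. ((\<lambda>t. f (cis t)) has_vector_derivative f' t) (at t)) \<and>
     (\<forall>t. (f' has_vector_derivative f'' t) (at t)) \<and>
     continuous_on (UNIV :: real set) f'')"

definition F2_plus :: "(complex \<Rightarrow> complex) set" where
  "F2_plus = {f. C2_circle f \<and>
     (\<forall>z\<in>sphere 0 1. (\<lambda>k. fourier_coeff f (int k) * z ^ k) sums f z) \<and>
     summable (\<lambda>k. (real k)\<^sup>2 * cmod (fourier_coeff f (int k)))}"

definition corresponds :: "(real \<Rightarrow> complex) \<Rightarrow> (complex \<Rightarrow> complex) \<Rightarrow> bool" where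
  "corresponds \<psi> \<phi> \<longleftrightarrow>
     \<phi> \<in> F2_plus \<and> (\<forall>t. \<psi> t = \<phi> ((\<i> - complex_of_real t) / (\<i> + complex_of_real t)))"

definition F_real :: "(real \<Rightarrow> complex) set" where
  "F_real = {\<psi>. \<exists>\<phi>. corresponds \<psi> \<phi>}"

text \<open>The series converges in operator norm for contractions.\<close>

definition circle_calculus ::
    "(complex \<Rightarrow> complex) \<Rightarrow> ('a::complex_hilbert \<Rightarrow>\<^sub>L 'a) \<Rightarrow> ('a \<Rightarrow>\<^sub>L 'a)" where
  "circle_calculus \<phi> T =
     (\<Sum>k. scaleC_blinfun (fourier_coeff \<phi> (int k)) (blinfun_power T k))"

text \<open>\<open>\<psi>\<close> determines \<open>\<phi>\<close> on the circle minus the point \<open>-1\<close>, hence by continuity on the circle,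
  so the choice of \<open>\<phi>\<close> is immaterial.\<close>

definition real_calculus ::
    "(real \<Rightarrow> complex) \<Rightarrow> 'a::complex_hilbert unbounded_op \<Rightarrow> ('a \<Rightarrow>\<^sub>L 'a)" where
  "real_calculus \<psi> T = circle_calculus (SOME \<phi>. corresponds \<psi> \<phi>) (cayley T)"

end

theory Submission imports Defs
begin

text \<open>
  With the Cayley transforms \<open>U\<close> and \<open>U\<^sub>0\<close> the path \<open>W\<^sub>s\<close> becomes the segment from \<open>U\<^sub>0\<close> to \<open>U\<close>, and
  \<open>V = U - U\<^sub>0\<close> is Hilbert-Schmidt. The second-order remainder of the \<open>n\<close>-th power has trace \<open>n (n - 1)\<close>
  times the \<open>(n - 2)\<close>-nd moment of \<open>\<integral>\<^sub>0\<^sup>1 u \<langle>V\<^sup>*, (u L + (1 - u) R)\<^sup>k V\<rangle> du\<close>, where \<open>L\<close> is left multiplication by \<open>U\<^sub>0\<close>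
  and \<open>R\<close> right multiplication by \<open>U\<close> on the Hilbert-Schmidt operators. Powers of a contraction
  give positive definite sequences, so after Abel summation they are, as in Herglotz' theorem,
  moments of integrable functions on the circle of bounded \<open>L\<^sup>1\<close> norm. The mean ergodic theorem
  approximates \<open>V\<close> by commutators \<open>U\<^sub>0 Z - Z U\<close>, for which the averaged moments telescope to size
  \<open>O(1/n)\<close> and thus belong to square integrable functions. Hence the moments of \<open>V\<close> are a limit, in the norm of \<open>L\<^sup>1\<close>, of moments of
  integrable functions. The Cayley parametrization transports the resulting density to the line.
\<close>

section \<open>Geometry of complex Hilbert spaces\<close>

text \<open>The obstacle is to obtain a function and not only a measure: positivity gives integrable
  functions of bounded norm, and weak limits of these may be singular. All limits are therefore
  taken in norm. Coefficients of size O(1/n) are moments of a square integrable function, so their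
  Abel means converge in norm, and for them a bound valid for all r < 1 survives r -> 1
  (\<open>moments_Abel\<close>). The ergodic theorem supplies such coefficients up to an error that
  positivity keeps small. The weight u comes from counting: after a cyclic rotation the word
  \<open>A ^ k * V * B ^ (n - 2 - k)\<close>, with A, B for U_0, U, occurs k + 1 times in the trace
  of the n-th remainder, and (k + 1) / ((m + 1) (m + 2)) with m = n - 2 is the integral of u times
  the binomial probability of k in m trials. The factor n (n - 1) must still become n^2, because (1
  + x^2) d/dx turns into 2 i w d/dw on the circle, so that the differential operator on the line
  multiplies the k-th coefficient by k^2, up to a common factor. The quotient (n - 1) / n costs one
  more correction of size O(1/n).\<close>

lemma cinner_add_left: "cinner (x + y) z = cinner x z + cinner y z"
  by (metis cinner_commute cinner_add_right complex_cnj_add)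

lemma scaleC_zero_left: "0 *\<^sub>C x = (0 :: 'a::complex_hilbert)"
  using scaleR_scaleC[of 0 x] by simp

lemma scaleC_minus_one: "(-1) *\<^sub>C x = - (x :: 'a::complex_hilbert)"
  using scaleR_scaleC[of "-1" x] by simp

lemma cinner_minus_right: "cinner x (- (y :: 'a::complex_hilbert)) = - cinner x y"
  using cinner_scaleC_right[of x "-1" y] by (simp add: scaleC_minus_one)

lemma cinner_minus_left: "cinner (- (x :: 'a::complex_hilbert)) y = - cinner x y"
  using cinner_scaleC_left[of "-1" x y] by (simp add: scaleC_minus_one)

lemma cinner_zero_right [simp]: "cinner x 0 = 0"
  using cinner_add_right[of x 0 0] by simp

lemma cinner_zero_left [simp]: "cinner 0 x = 0"
  using cinner_add_left[of 0 0 x] by simp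

lemma cinner_diff_right: "cinner x (y - z) = cinner x y - cinner x z"
  using cinner_add_right[of x y "- z"] by (simp add: cinner_minus_right)

lemma cinner_diff_left: "cinner (x - y) z = cinner x z - cinner y z"
  using cinner_add_left[of x "- y" z] by (simp add: cinner_minus_left)

lemma cinner_sum_right: "cinner x (sum f A) = (\<Sum>i\<in>A. cinner x (f i))"
  by (induction A rule: infinite_finite_induct) (simp_all add: cinner_add_right)

lemma cinner_sum_left: "cinner (sum f A) x = (\<Sum>i\<in>A. cinner (f i) x)"
  by (induction A rule: infinite_finite_induct) (simp_all add: cinner_add_left)

lemma norm_sq_eq_cinner: "(norm x)\<^sup>2 = Re (cinner x x)"
  by (simp add: cinner_norm)

lemma cinner_eq_zero_self [simp]: "cinner x x = 0 \<longleftrightarrow> x = (0 :: 'a::complex_hilbert)"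
  by (simp add: cinner_norm)

lemma norm_add_sq: "(norm (x + (y :: 'a::complex_hilbert)))\<^sup>2 = (norm x)\<^sup>2 + 2 * Re (cinner x y) + (norm y)\<^sup>2"
proof -
  have "Re (cinner y x) = Re (cinner x y)"
    by (metis cinner_commute complex_cnj(1) complex_eq_iff cnj.sel(1))
  then show ?thesis
    by (simp add: norm_sq_eq_cinner cinner_add_left cinner_add_right)
qed

lemma norm_diff_sq: "(norm (x - (y :: 'a::complex_hilbert)))\<^sup>2 = (norm x)\<^sup>2 - 2 * Re (cinner x y) + (norm y)\<^sup>2"
  using norm_add_sq[of x "- y"] by (simp add: cinner_minus_right)

lemma cinner_cauchy_schwarz: "cmod (cinner x y) \<le> norm x * norm y"
proof (cases "y = 0")
  case False
  \<comment> \<open>c is the coefficient of the projection of x onto the line of y; the square norm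
    of the residual is nonnegative, which is the inequality.\<close>
  define c where "c = cinner y x / cinner y y"
  have ny: "(norm y)\<^sup>2 > 0" using False by simp
  have e: "Re (cinner x (c *\<^sub>C y)) = (cmod (cinner x y))\<^sup>2 / (norm y)\<^sup>2"
  proof -
    have "cinner x (c *\<^sub>C y) = cinner x y * cnj (cinner x y) / of_real ((norm y)\<^sup>2)"
      by (simp add: cinner_scaleC_right c_def cinner_norm cinner_commute[of y x])
    also have "\<dots> = of_real ((cmod (cinner x y))\<^sup>2 / (norm y)\<^sup>2)"
      by (simp add: complex_norm_square del: of_real_power)
    finally show ?thesis by simp
  qed
  have n: "(norm (c *\<^sub>C y))\<^sup>2 = (cmod (cinner x y))\<^sup>2 / (norm y)\<^sup>2"
  proof -
    have "cmod c = cmod (cinner x y) / (norm y)\<^sup>2"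
      by (simp add: c_def cinner_norm norm_divide norm_power cinner_commute[of y x])
    then show ?thesis using ny
      by (simp add: norm_scaleC power_mult_distrib power_divide field_simps power2_eq_square)
  qed
  have "0 \<le> (norm (x - c *\<^sub>C y))\<^sup>2" by simp
  also have "\<dots> = (norm x)\<^sup>2 - (cmod (cinner x y))\<^sup>2 / (norm y)\<^sup>2"
    by (simp add: norm_diff_sq e n)
  finally have "(cmod (cinner x y))\<^sup>2 \<le> (norm x * norm y)\<^sup>2"
    using ny by (simp add: field_simps power_mult_distrib)
  then show ?thesis by (simp add: power2_le_iff_abs_le)
qed simp

lemma parallelogram: "(norm (x - (y :: 'a::complex_hilbert)))\<^sup>2 + (norm (x + y))\<^sup>2 = 2 * (norm x)\<^sup>2 + 2 * (norm y)\<^sup>2"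
  by (simp add: norm_add_sq norm_diff_sq)

lemma cinner_real_scale_left: "cinner (r *\<^sub>R x) y = r *\<^sub>R cinner x (y :: 'a::complex_hilbert)"
  by (simp add: scaleR_scaleC cinner_scaleC_left scaleR_conv_of_real)

lemma cinner_real_scale_right: "cinner x (r *\<^sub>R y) = r *\<^sub>R cinner x (y :: 'a::complex_hilbert)"
  by (simp add: scaleR_scaleC cinner_scaleC_right scaleR_conv_of_real)

lemma bounded_bilinear_cinner: "bounded_bilinear (cinner :: 'a::complex_hilbert \<Rightarrow> 'a \<Rightarrow> complex)"
  by unfold_locales
    (auto simp: cinner_add_left cinner_add_right cinner_real_scale_left cinner_real_scale_right
       intro!: exI[of _ 1] cinner_cauchy_schwarz)

lemmas tendsto_cinner [tendsto_intros] = bounded_bilinear.tendsto[OF bounded_bilinear_cinner]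

lemma cinner_ext_right: "(\<And>y. cinner y x = cinner y x') \<Longrightarrow> x = (x' :: 'a::complex_hilbert)"
  by (metis cinner_diff_right cinner_eq_zero_self right_minus_eq)

lemma cinner_ext_left: "(\<And>y. cinner x y = cinner x' y) \<Longrightarrow> x = (x' :: 'a::complex_hilbert)"
  by (metis cinner_diff_left cinner_eq_zero_self right_minus_eq)

lemma subspace_mean_mem:
  assumes "complex_vector.subspace S" "u \<in> S" "v \<in> S"
  shows "(1/2) *\<^sub>R (u + v) \<in> (S :: 'a::complex_hilbert set)"
  unfolding scaleR_scaleC using assms
  by (intro complex_vector.subspace_scale complex_vector.subspace_add)

theorem closed_subspace_projection:
  fixes S :: "'a::complex_hilbert set"
  assumes S: "complex_vector.subspace S" and cl: "closed S"
  shows "\<exists>y\<in>S. \<forall>s\<in>S. cinner s (x - y) = 0"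
proof -
  define d where "d = (INF s\<in>S. (norm (x - s))\<^sup>2)"
  have ne: "S \<noteq> {}" using complex_vector.subspace_0[OF S] by auto
  have bdd: "bdd_below ((\<lambda>s. (norm (x - s))\<^sup>2) ` S)" by (rule bdd_belowI2[of _ 0]) simp
  have d_le: "d \<le> (norm (x - s))\<^sup>2" if "s \<in> S" for s
    unfolding d_def by (rule cINF_lower[OF bdd that])
  have "\<exists>s\<in>S. (norm (x - s))\<^sup>2 < d + 1 / real (Suc n)" for n
    using cInf_lessD[of "(\<lambda>s. (norm (x - s))\<^sup>2) ` S" "d + 1 / real (Suc n)"] ne
    by (auto simp: d_def)
  then obtain s where s: "\<And>n. s n \<in> S" "\<And>n. (norm (x - s n))\<^sup>2 < d + 1 / real (Suc n)" by metis
  \<comment> \<open>The midpoint of two members of S is again in S, hence at squared distance at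
    least d from x; the parallelogram law turns this into closeness.\<close>
  have close: "(norm (s m - s n))\<^sup>2 \<le> 2 / real (Suc m) + 2 / real (Suc n)" for m n
  proof -
    have "(norm (x - s m - (x - s n)))\<^sup>2 + (norm (x - s m + (x - s n)))\<^sup>2
        = 2 * (norm (x - s m))\<^sup>2 + 2 * (norm (x - s n))\<^sup>2" by (rule parallelogram)
    moreover have "x - s m + (x - s n) = 2 *\<^sub>R (x - (1/2) *\<^sub>R (s m + s n))"
      by (simp add: scaleR_diff_right scaleR_2)
    then have "(norm (x - s m + (x - s n)))\<^sup>2 = 4 * (norm (x - (1/2) *\<^sub>R (s m + s n)))\<^sup>2"
      by (simp add: power_mult_distrib)
    moreover have "d \<le> (norm (x - (1/2) *\<^sub>R (s m + s n)))\<^sup>2"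
      by (intro d_le subspace_mean_mem S s)
    moreover have "norm (x - s m - (x - s n)) = norm (s m - s n)"
      by (simp add: norm_minus_commute)
    ultimately show ?thesis using s(2)[of m] s(2)[of n] by simp
  qed
  have "Cauchy s"
  proof (rule CauchyI)
    fix e :: real assume e: "0 < e"
    obtain N where N: "4 / e\<^sup>2 < real N" using reals_Archimedean2 by blast
    show "\<exists>M. \<forall>m\<ge>M. \<forall>n\<ge>M. norm (s m - s n) < e"
    proof (intro exI allI impI)
      fix m n assume mn: "N \<le> m" "N \<le> n"
      have pos: "0 < real (Suc N)" by simp
      have "2 / real (Suc m) \<le> 2 / real (Suc N)" "2 / real (Suc n) \<le> 2 / real (Suc N)"
        using mn by (auto intro!: divide_left_mono)
      then have "(norm (s m - s n))\<^sup>2 \<le> 4 / real (Suc N)" using close[of m n] by linarith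
      also have "\<dots> < e\<^sup>2"
        using N e pos by (simp add: field_simps add_strict_increasing)
      finally show "norm (s m - s n) < e" using e by (simp add: power2_less_imp_less)
    qed
  qed
  then obtain y where y: "s \<longlonglongrightarrow> y" using Cauchy_convergent_iff convergent_def by blast
  have yS: "y \<in> S" using closed_sequentially[OF cl] s(1) y by blast
  have "(\<lambda>n. (norm (x - s n))\<^sup>2) \<longlonglongrightarrow> (norm (x - y))\<^sup>2" by (intro tendsto_intros y)
  moreover have "(\<lambda>n. d + 1 / real (Suc n)) \<longlonglongrightarrow> d + 0"
    by (intro tendsto_intros LIMSEQ_Suc[OF lim_1_over_n])
  ultimately have ymin: "(norm (x - y))\<^sup>2 \<le> d + 0"
    by (rule LIMSEQ_le) (use s(2) in \<open>auto intro: less_imp_le\<close>)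
  have "cinner t (x - y) = 0" if t: "t \<in> S" for t
  proof (cases "t = 0")
    case False
    \<comment> \<open>Moving y along t by the projection of x - y onto t would lower the squared
      distance by |<t, x - y>|^2 / |t|^2, against minimality.\<close>
    define c where "c = cinner t (x - y) / of_real ((norm t)\<^sup>2)"
    have nt: "(norm t)\<^sup>2 > 0" using False by simp
    have "y + c *\<^sub>C t \<in> S"
      by (intro complex_vector.subspace_add complex_vector.subspace_scale S yS t)
    from d_le[OF this] ymin have "(norm (x - y))\<^sup>2 \<le> (norm (x - y - c *\<^sub>C t))\<^sup>2"
      unfolding diff_diff_eq by linarith
    then have "2 * Re (cinner (x - y) (c *\<^sub>C t)) \<le> (norm (c *\<^sub>C t))\<^sup>2"
      by (simp add: norm_diff_sq)
    moreover have "cinner (x - y) (c *\<^sub>C t) = of_real ((cmod (cinner t (x - y)))\<^sup>2 / (norm t)\<^sup>2)"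
      using cinner_commute[of "x - y" t]
      by (simp add: cinner_scaleC_right c_def complex_norm_square del: of_real_power)
    moreover have "(norm (c *\<^sub>C t))\<^sup>2 = (cmod (cinner t (x - y)))\<^sup>2 / (norm t)\<^sup>2"
    proof -
      have "cmod c = cmod (cinner t (x - y)) / (norm t)\<^sup>2" by (simp add: c_def norm_divide norm_power)
      then show ?thesis using nt
        by (simp add: norm_scaleC power_mult_distrib power_divide field_simps power2_eq_square)
    qed
    ultimately have "(cmod (cinner t (x - y)))\<^sup>2 / (norm t)\<^sup>2 \<le> 0" by simp
    then show ?thesis using nt
      by (simp add: divide_le_0_iff)
  qed simp
  with yS show ?thesis by blast
qed

text \<open>The form in which completeness of a basis and surjectivity of \<open>T - z\<close> are
  established below.\<close>

corollary dense_subspaceI: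
  fixes S :: "'a::complex_hilbert set"
  assumes S: "complex_vector.subspace S" and cl: "closed S"
    and triv: "\<And>y. (\<And>s. s \<in> S \<Longrightarrow> cinner y s = 0) \<Longrightarrow> y = 0"
  shows "S = UNIV"
proof -
  have "x \<in> S" for x
  proof -
    obtain y where y: "y \<in> S" "\<forall>s\<in>S. cinner s (x - y) = 0"
      using closed_subspace_projection[OF S cl] by blast
    then have "x - y = 0" by (intro triv) (metis cinner_commute complex_cnj_zero)
    with y show ?thesis by simp
  qed
  then show ?thesis by blast
qed

lemma closure_complex_subspace:
  fixes S :: "'a::complex_hilbert set"
  assumes S: "complex_vector.subspace S"
  shows "complex_vector.subspace (closure S)"
proof (rule complex_vector.subspaceI)
  show "0 \<in> closure S" using complex_vector.subspace_0[OF S] closure_subset by blast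
next
  fix x y assume "x \<in> closure S" "y \<in> closure S"
  then obtain u v where u: "\<And>n. u n \<in> S" "u \<longlonglongrightarrow> x" and v: "\<And>n. v n \<in> S" "v \<longlonglongrightarrow> y"
    by (meson closure_sequential)
  have "(\<lambda>n. u n + v n) \<longlonglongrightarrow> x + y" by (intro tendsto_intros u v)
  moreover have "\<And>n. u n + v n \<in> S" using u v S by (auto intro: complex_vector.subspace_add)
  ultimately show "x + y \<in> closure S" by (meson closure_sequential)
next
  fix c x assume "x \<in> closure S"
  then obtain u where u: "\<And>n. u n \<in> S" "u \<longlonglongrightarrow> x" by (meson closure_sequential)
  have "(\<lambda>n. c *\<^sub>C u n) \<longlonglongrightarrow> c *\<^sub>C x"
    by (rule bounded_linear.tendsto[OF bounded_linear_scaleC u(2)])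
  moreover have "\<And>n. c *\<^sub>C u n \<in> S" using u S by (auto intro: complex_vector.subspace_scale)
  ultimately show "c *\<^sub>C x \<in> closure S" by (meson closure_sequential)
qed

text \<open>The kernel is a closed subspace, and the residual z of a vector outside it spans its
  orthogonal complement; only the scale of z remains to be fixed.\<close>

theorem riesz_representation:
  fixes f :: "'a::complex_hilbert \<Rightarrow> complex"
  assumes f: "bounded_linear f" and fc: "\<And>c x. f (c *\<^sub>C x) = c * f x"
  shows "\<exists>y. \<forall>x. f x = cinner y x"
proof (cases "\<forall>x. f x = 0")
  case True
  then show ?thesis by (intro exI[of _ 0]) simp
next
  case False
  interpret f: bounded_linear f by (rule f)
  define S where "S = {x. f x = 0}"
  have sub: "complex_vector.subspace S"
    by (rule complex_vector.subspaceI) (auto simp: S_def f.add fc f.zero)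
  have "closed S" unfolding S_def
    by (intro closed_Collect_eq continuous_intros linear_continuous_on f)
  from False obtain x where x: "f x \<noteq> 0" by blast
  obtain p where p: "p \<in> S" "\<forall>s\<in>S. cinner s (x - p) = 0"
    using closed_subspace_projection[OF sub \<open>closed S\<close>] by blast
  define z where "z = x - p"
  have fz: "f z = f x" using p by (simp add: z_def f.diff S_def)
  have z0: "cinner z z \<noteq> 0" using fz x f.zero by auto
  have "f v = cinner (cnj (f z / cinner z z) *\<^sub>C z) v" for v
  proof -
    have "f z *\<^sub>C v - f v *\<^sub>C z \<in> S" by (simp add: S_def f.diff fc)
    then have "cinner (f z *\<^sub>C v - f v *\<^sub>C z) z = 0" using p unfolding z_def by blast
    then have "cinner z (f z *\<^sub>C v - f v *\<^sub>C z) = 0" by (metis cinner_commute complex_cnj_zero)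
    then have "f z * cinner z v = f v * cinner z z" by (simp add: cinner_diff_right cinner_scaleC_right)
    then show ?thesis using z0 by (simp add: cinner_scaleC_left field_simps)
  qed
  then show ?thesis by blast
qed

section \<open>Parseval's identity\<close>

text \<open>Completing the square in the coefficients. With c e = <e, x> this gives Bessel's
  inequality; with arbitrary c it shows that no combination over F comes closer to x.\<close>

lemma orthonormal_finite_norm:
  fixes E :: "'a::complex_hilbert set"
  assumes on: "\<forall>e\<in>E. \<forall>f\<in>E. cinner e f = (if e = f then 1 else 0)"
    and F: "finite F" "F \<subseteq> E"
  shows "(norm (x - (\<Sum>e\<in>F. c e *\<^sub>C e)))\<^sup>2
    = (norm x)\<^sup>2 - (\<Sum>e\<in>F. (cmod (cinner e x))\<^sup>2) + (\<Sum>e\<in>F. (cmod (c e - cinner e x))\<^sup>2)"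
proof -
  have s1: "cinner (\<Sum>e\<in>F. c e *\<^sub>C e) (\<Sum>e\<in>F. c e *\<^sub>C e) = (\<Sum>e\<in>F. of_real ((cmod (c e))\<^sup>2))"
  proof -
    have "cinner (\<Sum>e\<in>F. c e *\<^sub>C e) (\<Sum>e\<in>F. c e *\<^sub>C e)
       = (\<Sum>e\<in>F. \<Sum>g\<in>F. cnj (c e) * (c g * (if e = g then 1 else 0)))"
      unfolding cinner_sum_left cinner_sum_right
      by (intro sum.cong refl) (use F in \<open>auto simp: cinner_scaleC_left cinner_scaleC_right on subset_iff\<close>)
    also have "\<dots> = (\<Sum>e\<in>F. of_real ((cmod (c e))\<^sup>2))"
    proof (intro sum.cong refl)
      fix e assume e: "e \<in> F"
      have "(\<Sum>g\<in>F. cnj (c e) * (c g * (if e = g then 1 else 0)))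
        = (\<Sum>g\<in>F. if e = g then cnj (c e) * c e else 0)" by (intro sum.cong) auto
      also have "\<dots> = cnj (c e) * c e" using F(1) e by simp
      finally show "(\<Sum>g\<in>F. cnj (c e) * (c g * (if e = g then 1 else 0))) = of_real ((cmod (c e))\<^sup>2)"
        by (simp add: complex_norm_square mult.commute del: of_real_power)
    qed
    finally show ?thesis .
  qed
  have s2: "cinner x (\<Sum>e\<in>F. c e *\<^sub>C e) = (\<Sum>e\<in>F. c e * cnj (cinner e x))"
    unfolding cinner_sum_right
    by (intro sum.cong refl) (simp add: cinner_scaleC_right flip: cinner_commute)
  have s3: "(cmod (c - a))\<^sup>2 = (cmod c)\<^sup>2 - 2 * Re (c * cnj a) + (cmod a)\<^sup>2" for c a :: complex
    by (simp only: cmod_power2) (simp add: power2_eq_square algebra_simps)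
  have "(norm (\<Sum>e\<in>F. c e *\<^sub>C e))\<^sup>2 = (\<Sum>e\<in>F. (cmod (c e))\<^sup>2)"
    using s1 by (simp only: norm_sq_eq_cinner Re_sum Re_complex_of_real)
  then show ?thesis
    unfolding norm_diff_sq s2 s3
    by (simp only: sum.distrib sum_subtractf sum_distrib_left[symmetric] Re_sum)
qed

text \<open>Bessel's inequality bounds the finite sums from above; density of the span brings them
  within any epsilon of the limit, and they only grow with the index set.\<close>

theorem parseval:
  fixes E :: "'a::complex_hilbert set"
  assumes E: "orthonormal_basis E"
  shows "((\<lambda>e. (cmod (cinner e x))\<^sup>2) has_sum (norm x)\<^sup>2) E"
proof -
  have on: "\<forall>e\<in>E. \<forall>f\<in>E. cinner e f = (if e = f then 1 else 0)"
    and mx: "\<And>x. (\<And>e. e \<in> E \<Longrightarrow> cinner e x = 0) \<Longrightarrow> x = 0"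
    using E unfolding orthonormal_basis_def by blast+
  have bessel: "(\<Sum>e\<in>F. (cmod (cinner e x))\<^sup>2) \<le> (norm x)\<^sup>2" if "finite F" "F \<subseteq> E" for F
  proof -
    have "0 \<le> (norm (x - (\<Sum>e\<in>F. cinner e x *\<^sub>C e)))\<^sup>2" by simp
    then show ?thesis unfolding orthonormal_finite_norm[OF on that] by simp
  qed
  define S where "S = closure (complex_vector.span E)"
  have "S = UNIV"
  proof (rule dense_subspaceI)
    show "complex_vector.subspace S" unfolding S_def by (intro closure_complex_subspace complex_vector.subspace_span)
    show "closed S" by (simp add: S_def)
    fix y assume y: "\<And>s. s \<in> S \<Longrightarrow> cinner y s = 0"
    have "cinner e y = 0" if "e \<in> E" for e
    proof -
      have "e \<in> S" using that unfolding S_def by (meson closure_subset complex_vector.span_base subsetD)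
      then show ?thesis by (metis y cinner_commute complex_cnj_zero)
    qed
    then show "y = 0" by (rule mx)
  qed
  then have dense: "x \<in> closure (complex_vector.span E)" by (simp add: S_def)
  have approx: "\<exists>F. finite F \<and> F \<subseteq> E \<and> (norm x)\<^sup>2 - \<epsilon> < (\<Sum>e\<in>F. (cmod (cinner e x))\<^sup>2)" if eps: "\<epsilon> > 0" for \<epsilon>
  proof -
    obtain y where y: "y \<in> complex_vector.span E" "dist y x < sqrt \<epsilon>"
      using closure_approachable[THEN iffD1, OF dense, rule_format, of "sqrt \<epsilon>"] eps by auto
    then obtain F c where F: "finite F" "F \<subseteq> E" "y = (\<Sum>e\<in>F. c e *\<^sub>C e)"
      by (auto simp: complex_vector.span_explicit)
    have "(norm (x - y))\<^sup>2 < \<epsilon>"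
      using y(2) eps power_strict_mono[of "norm (x - y)" "sqrt \<epsilon>" 2]
      by (simp add: dist_norm norm_minus_commute)
    moreover have "(norm x)\<^sup>2 - (\<Sum>e\<in>F. (cmod (cinner e x))\<^sup>2) \<le> (norm (x - y))\<^sup>2"
      unfolding F(3) orthonormal_finite_norm[OF on F(1,2)] by (simp add: sum_nonneg)
    ultimately show ?thesis using F by (intro exI[of _ F]) auto
  qed
  show ?thesis
    unfolding has_sum_def
  proof (rule tendstoI)
    fix \<epsilon> :: real assume "\<epsilon> > 0"
    from approx[OF this] obtain F where F: "finite F" "F \<subseteq> E"
      "(norm x)\<^sup>2 - \<epsilon> < (\<Sum>e\<in>F. (cmod (cinner e x))\<^sup>2)" by blast
    show "\<forall>\<^sub>F G in finite_subsets_at_top E. dist (\<Sum>e\<in>G. (cmod (cinner e x))\<^sup>2) ((norm x)\<^sup>2) < \<epsilon>"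
      unfolding eventually_finite_subsets_at_top
    proof (intro exI[of _ F] conjI allI impI F)
      fix G assume G: "finite G \<and> F \<subseteq> G \<and> G \<subseteq> E"
      then have "(\<Sum>e\<in>F. (cmod (cinner e x))\<^sup>2) \<le> (\<Sum>e\<in>G. (cmod (cinner e x))\<^sup>2)"
        by (intro sum_mono2) auto
      with bessel[of G] F(3) G show "dist (\<Sum>e\<in>G. (cmod (cinner e x))\<^sup>2) ((norm x)\<^sup>2) < \<epsilon>"
        by (auto simp: dist_real_def)
    qed
  qed
qed

section \<open>The algebra of bounded complex-linear operators\<close>

lemma complex_linear_iff:
  "complex_linear A \<longleftrightarrow> (\<forall>c x. blinfun_apply A (c *\<^sub>C x) = c *\<^sub>C blinfun_apply A x)"
  by (auto simp: complex_linear_def Vector_Spaces.linear_def module_hom_def module_hom_axioms_def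
      module_def vector_space_def scaleC_add_right scaleC_add_left scaleC_scaleC scaleC_one
      blinfun.add_right)

text \<open>A type of their own makes these operators a Banach algebra with unit, so that powers,
  sums, limits and series are those of the type classes.\<close>

typedef (overloaded) 'a cop = "{A :: 'a::complex_hilbert \<Rightarrow>\<^sub>L 'a. complex_linear A}"
  morphisms blin Cop
  by (rule exI[of _ 0]) (simp add: complex_linear_iff)

setup_lifting type_definition_cop

text \<open>On the zero space \<open>norm 1 = 0\<close>; hence a unit without the law
  \<open>norm 1 = 1\<close>, and \<open>norm_one_cop\<close> is only an inequality.\<close>

instantiation cop :: (complex_hilbert) "{real_normed_algebra, monoid_mult}"
begin

lift_definition zero_cop :: "'a cop" is 0 by (simp add: complex_linear_iff)
lift_definition one_cop :: "'a cop" is id_blinfun by (simp add: complex_linear_iff)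
lift_definition plus_cop :: "'a cop \<Rightarrow> 'a cop \<Rightarrow> 'a cop" is "(+)"
  by (simp add: complex_linear_iff blinfun.add_left scaleC_add_right)
lift_definition uminus_cop :: "'a cop \<Rightarrow> 'a cop" is uminus
  by (simp add: complex_linear_iff blinfun.minus_left complex_vector.scale_minus_right)
lift_definition minus_cop :: "'a cop \<Rightarrow> 'a cop \<Rightarrow> 'a cop" is "(-)"
  by (simp add: complex_linear_iff blinfun.diff_left complex_vector.scale_right_diff_distrib)
lift_definition times_cop :: "'a cop \<Rightarrow> 'a cop \<Rightarrow> 'a cop" is "(o\<^sub>L)"
  by (simp add: complex_linear_iff)
lift_definition scaleR_cop :: "real \<Rightarrow> 'a cop \<Rightarrow> 'a cop" is scaleR
  by (simp add: complex_linear_iff blinfun.scaleR_left scaleR_scaleC scaleC_scaleC mult.commute)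
lift_definition norm_cop :: "'a cop \<Rightarrow> real" is norm .

definition sgn_cop :: "'a cop \<Rightarrow> 'a cop" where "sgn_cop A = scaleR (inverse (norm A)) A"
definition dist_cop :: "'a cop \<Rightarrow> 'a cop \<Rightarrow> real" where "dist_cop A B = norm (A - B)"
definition uniformity_cop :: "('a cop \<times> 'a cop) filter" where
  "uniformity_cop = (INF e\<in>{0 <..}. principal {(x, y). dist x y < e})"
definition open_cop :: "'a cop set \<Rightarrow> bool" where
  "open_cop S = (\<forall>x\<in>S. \<forall>\<^sub>F (x', y) in uniformity. x' = x \<longrightarrow> y \<in> S)"

instance
proof
  fix A B C :: "'a cop" and a b :: real
  show "A + B + C = A + (B + C)" "A + B = B + A" "0 + A = A" "- A + A = 0" "A - B = A + - B"
    by (transfer; simp)+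
  show "a *\<^sub>R (A + B) = a *\<^sub>R A + a *\<^sub>R B" "(a + b) *\<^sub>R A = a *\<^sub>R A + b *\<^sub>R A"
    "a *\<^sub>R b *\<^sub>R A = (a * b) *\<^sub>R A" "1 *\<^sub>R A = A"
    by (transfer; simp add: scaleR_add_right scaleR_add_left)+
  show "norm A = 0 \<longleftrightarrow> A = 0" "norm (A + B) \<le> norm A + norm B" "norm (a *\<^sub>R A) = \<bar>a\<bar> * norm A"
    by (transfer; simp add: norm_triangle_ineq)+
  show "A * B * C = A * (B * C)" "1 * A = A" "A * 1 = A"
    by (transfer; auto intro!: blinfun_eqI)+
  show "(A + B) * C = A * C + B * C" "A * (B + C) = A * B + A * C"
    by (transfer; auto intro!: blinfun_eqI simp: blinfun.add_left blinfun.add_right)+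
  show "dist A B = norm (A - B)" by (rule dist_cop_def)
  show "sgn A = scaleR (inverse (norm A)) A" by (rule sgn_cop_def)
  show "(uniformity :: ('a cop \<times> 'a cop) filter) = (INF e\<in>{0 <..}. principal {(x, y). dist x y < e})"
    by (rule uniformity_cop_def)
  show "open S = (\<forall>x\<in>S. \<forall>\<^sub>F (x', y) in uniformity. x' = x \<longrightarrow> y \<in> S)" for S :: "'a cop set"
    by (rule open_cop_def)
  show "a *\<^sub>R A * B = a *\<^sub>R (A * B)" "A * a *\<^sub>R B = a *\<^sub>R (A * B)"
    by (transfer; auto intro!: blinfun_eqI simp: blinfun.scaleR_left blinfun.scaleR_right)+
  show "norm (A * B) \<le> norm A * norm B"
    by transfer (rule norm_blinfun_compose)
qed

end

lift_definition app :: "'a::complex_hilbert cop \<Rightarrow> 'a \<Rightarrow> 'a"  (infixr \<open>\<cdot>\<close> 72) is blinfun_apply .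

lift_definition csc :: "complex \<Rightarrow> 'a::complex_hilbert cop \<Rightarrow> 'a cop"  (infixr \<open>\<odot>\<close> 73) is scaleC_blinfun
  by (simp add: complex_linear_iff scaleC_blinfun_apply scaleC_scaleC mult.commute)

lemma app_scaleC: "A \<cdot> (c *\<^sub>C x) = c *\<^sub>C (A \<cdot> x)"
  by transfer (simp add: complex_linear_iff)

lemma app_add_right: "A \<cdot> (x + y) = A \<cdot> x + A \<cdot> y"
  and app_diff_right: "A \<cdot> (x - y) = A \<cdot> x - A \<cdot> y"
  and app_zero_right [simp]: "A \<cdot> 0 = 0"
  by (transfer; simp add: blinfun.add_right blinfun.diff_right)+

lemma app_add_left: "(A + B) \<cdot> x = A \<cdot> x + B \<cdot> x"
  and app_diff_left: "(A - B) \<cdot> x = A \<cdot> x - B \<cdot> x"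
  and app_minus_left: "(- A) \<cdot> x = - (A \<cdot> x)"
  and app_zero_left [simp]: "0 \<cdot> x = 0"
  and app_one [simp]: "1 \<cdot> x = x"
  and app_times: "(A * B) \<cdot> x = A \<cdot> (B \<cdot> x)"
  by (transfer; simp add: blinfun.add_left blinfun.diff_left blinfun.minus_left)+

lemma app_csc: "(c \<odot> A) \<cdot> x = c *\<^sub>C (A \<cdot> x)"
  by transfer (rule scaleC_blinfun_apply)

lemma cop_eqI: "(\<And>x. A \<cdot> x = B \<cdot> x) \<Longrightarrow> A = B"
  by transfer (rule blinfun_eqI)

lemma norm_app: "norm (A \<cdot> x) \<le> norm A * norm x"
  by transfer (rule norm_blinfun)

lemma norm_copI: "(\<And>x. norm (A \<cdot> x) \<le> b * norm x) \<Longrightarrow> 0 \<le> b \<Longrightarrow> norm A \<le> b"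
  by transfer (rule norm_blinfun_bound)

lemma norm_one_cop: "norm (1 :: 'a::complex_hilbert cop) \<le> 1"
  by (rule norm_copI) simp_all

lemma norm_app_contraction: "norm A \<le> 1 \<Longrightarrow> norm (A \<cdot> x) \<le> norm x"
  using norm_app[of A x] mult_right_mono[of "norm A" 1 "norm x"] by simp

lemma norm_power_cop: "norm (A ^ n) \<le> norm (A :: 'a::complex_hilbert cop) ^ n"
proof (induction n)
  case 0
  show ?case by (simp add: norm_one_cop)
next
  case (Suc n)
  show ?case
    using norm_mult_ineq[of A "A ^ n"] mult_left_mono[OF Suc, of "norm A"] by simp
qed

lemma norm_power_contraction: "norm A \<le> 1 \<Longrightarrow> norm (A ^ n) \<le> (1::real)" for A :: "'a::complex_hilbert cop"
  using norm_power_cop[of A n] power_le_one[of "norm A" n] by simp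

lemma norm_csc: "norm (c \<odot> A) = cmod c * norm A"
proof (cases "c = 0")
  case True
  then have "c \<odot> A = 0" by (intro cop_eqI) (simp add: app_csc scaleC_zero_left)
  with True show ?thesis by simp
next
  case False
  have le: "norm (c \<odot> A) \<le> cmod c * norm A" for c and A :: "'a cop"
    by (rule norm_copI)
      (simp_all add: app_csc norm_scaleC mult.assoc mult_left_mono norm_app)
  have "A = inverse c \<odot> c \<odot> A"
    using False by (intro cop_eqI) (simp add: app_csc scaleC_scaleC scaleC_one)
  then have "norm A \<le> inverse (cmod c) * norm (c \<odot> A)"
    using le[of "inverse c" "c \<odot> A"] by (simp add: norm_inverse)
  with le[of c A] False show ?thesis by (simp add: field_simps)
qed

lemma csc_add_right: "c \<odot> (A + B) = c \<odot> A + c \<odot> B"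
  and csc_diff_right: "c \<odot> (A - B) = c \<odot> A - c \<odot> B"
  and csc_add_left: "(c + d) \<odot> A = c \<odot> A + d \<odot> A"
  and csc_csc: "c \<odot> d \<odot> A = (c * d) \<odot> A"
  and csc_one [simp]: "1 \<odot> A = A"
  and csc_zero_left [simp]: "0 \<odot> A = 0"
  and csc_mult_left: "(c \<odot> A) * B = c \<odot> (A * B)"
  and csc_mult_right: "A * (c \<odot> B) = c \<odot> (A * B)"
  and csc_of_real: "complex_of_real r \<odot> A = r *\<^sub>R A"
  and csc_minus_one: "(-1) \<odot> A = - A"
proof -
  have r: "r *\<^sub>R A \<cdot> x = r *\<^sub>R (A \<cdot> x)" for x
    by transfer (simp add: blinfun.scaleR_left)
  show "c \<odot> (A + B) = c \<odot> A + c \<odot> B" "c \<odot> (A - B) = c \<odot> A - c \<odot> B"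
    "(c + d) \<odot> A = c \<odot> A + d \<odot> A" "c \<odot> d \<odot> A = (c * d) \<odot> A" "1 \<odot> A = A" "0 \<odot> A = 0"
    "(c \<odot> A) * B = c \<odot> (A * B)" "A * (c \<odot> B) = c \<odot> (A * B)"
    "complex_of_real r \<odot> A = r *\<^sub>R A" "(-1) \<odot> A = - A"
    by (intro cop_eqI; simp add: app_csc app_add_left app_diff_left app_times app_scaleC r
         scaleC_add_right scaleC_add_left scaleC_scaleC scaleC_one scaleC_zero_left scaleR_scaleC
         complex_vector.scale_right_diff_distrib scaleC_minus_one app_minus_left)+
qed

lemma csc_zero_right [simp]: "c \<odot> 0 = 0"
  by (rule cop_eqI) (simp add: app_csc complex_vector.scale_zero_right)

lemma csc_sum_right: "c \<odot> sum f S = (\<Sum>i\<in>S. c \<odot> f i)"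
  by (induction S rule: infinite_finite_induct) (simp_all add: csc_add_right)

lemma bounded_linear_csc: "bounded_linear ((\<odot>) c)"
  by (rule bounded_linear_intro[where K = "cmod c"])
    (simp_all add: csc_add_right norm_csc mult.commute flip: csc_of_real add: csc_csc)

lemma bounded_linear_app_left: "bounded_linear (\<lambda>A. A \<cdot> x)"
proof (rule bounded_linear_intro[where K = "norm x"])
  show "(r *\<^sub>R A) \<cdot> x = r *\<^sub>R (A \<cdot> x)" for r and A :: "'a cop"
    by transfer (simp add: blinfun.scaleR_left)
qed (simp_all add: app_add_left norm_app)

lemma bounded_linear_app: "bounded_linear (app A)"
  by (rule bounded_linear_intro[where K = "norm A"])
    (simp_all add: app_add_right norm_app scaleR_scaleC app_scaleC mult.commute[of "norm _" "norm A"])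

lemma bounded_linear_blin: "bounded_linear blin"
  by (rule bounded_linear_intro[where K = 1]) (transfer; simp)+

instance cop :: (complex_hilbert) banach
proof
  fix X :: "nat \<Rightarrow> 'a cop" assume X: "Cauchy X"
  have "Cauchy (\<lambda>n. blin (X n))" by (rule bounded_linear.Cauchy[OF bounded_linear_blin X])
  then obtain L where L: "(\<lambda>n. blin (X n)) \<longlonglongrightarrow> L" using Cauchy_convergent_iff convergent_def by blast
  have *: "(\<lambda>n. blinfun_apply (blin (X n)) x) \<longlonglongrightarrow> blinfun_apply L x" for x
    by (intro tendsto_intros L)
  have "complex_linear L"
    unfolding complex_linear_iff
  proof (intro allI)
    fix c x
    have "(\<lambda>n. c *\<^sub>C blinfun_apply (blin (X n)) x) \<longlonglongrightarrow> c *\<^sub>C blinfun_apply L x"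
      by (rule bounded_linear.tendsto[OF bounded_linear_scaleC *])
    then have "(\<lambda>n. blinfun_apply (blin (X n)) (c *\<^sub>C x)) \<longlonglongrightarrow> c *\<^sub>C blinfun_apply L x"
      by (simp add: app_scaleC flip: app.rep_eq)
    with * show "blinfun_apply L (c *\<^sub>C x) = c *\<^sub>C blinfun_apply L x"
      by (rule LIMSEQ_unique)
  qed
  then have "blin (Cop L) = L" by (simp add: Cop_inverse)
  have "X \<longlonglongrightarrow> Cop L"
  proof (rule LIM_zero_cancel, rule tendsto_norm_zero_cancel)
    have "(\<lambda>n. norm (blin (X n) - L)) \<longlonglongrightarrow> 0" using L by (simp add: LIM_zero tendsto_norm_zero)
    then show "(\<lambda>n. norm (X n - Cop L)) \<longlonglongrightarrow> 0"
      by (simp add: norm_cop.rep_eq minus_cop.rep_eq \<open>blin (Cop L) = L\<close>)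
  qed
  then show "convergent X" by (auto simp: convergent_def)
qed

definition mk :: "('a::complex_hilbert \<Rightarrow> 'a) \<Rightarrow> 'a cop" where
  "mk f = Cop (Blinfun f)"

lemma mk:
  assumes add: "\<And>x y. f (x + y) = f x + f y" and sc: "\<And>c x. f (c *\<^sub>C x) = c *\<^sub>C f x"
    and bd: "\<And>x. norm (f x) \<le> norm x * K"
  shows app_mk: "mk f \<cdot> x = f x" and blin_mk: "blin (mk f) = Blinfun f"
proof -
  have bl: "bounded_linear f"
    by (rule bounded_linear_intro[of _ K]) (simp_all add: add sc scaleR_scaleC bd)
  then have "complex_linear (Blinfun f)"
    by (simp add: complex_linear_iff bounded_linear_Blinfun_apply sc)
  then show "blin (mk f) = Blinfun f" by (simp add: mk_def Cop_inverse)
  then show "mk f \<cdot> x = f x" by (simp add: app.rep_eq bounded_linear_Blinfun_apply bl)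
qed

section \<open>Adjoints and unitary operators\<close>

definition adj :: "'a::complex_hilbert cop \<Rightarrow> 'a cop" where
  "adj A = mk (\<lambda>x. SOME y. \<forall>z. cinner x (A \<cdot> z) = cinner y z)"

text \<open>Riesz representation of z -> <x, A z>; linearity in x follows from the uniqueness of the
  representing vector.\<close>

lemma cinner_adj_left: "cinner (adj A \<cdot> x) y = cinner x (A \<cdot> y)"
proof -
  define f where "f = (\<lambda>x. SOME y. \<forall>z. cinner x (A \<cdot> z) = cinner y z)"
  have f: "cinner (f x) z = cinner x (A \<cdot> z)" for x z
  proof -
    have "\<exists>y. \<forall>z. cinner x (A \<cdot> z) = cinner y z"
    proof (rule riesz_representation)
      show "bounded_linear (\<lambda>z. cinner x (A \<cdot> z))"
        using bounded_linear_compose[OF bounded_bilinear.bounded_linear_right[OF bounded_bilinear_cinner, of x]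
            bounded_linear_app[of A]] .
    qed (simp add: app_scaleC cinner_scaleC_right)
    then have "\<forall>z. cinner x (A \<cdot> z) = cinner (f x) z" unfolding f_def by (rule someI_ex)
    then show ?thesis by simp
  qed
  have "mk f \<cdot> x = f x" for x
  proof (rule app_mk)
    show "f (x + y) = f x + f y" for x y
      by (rule cinner_ext_left) (simp add: f cinner_add_left)
    show "f (c *\<^sub>C x) = c *\<^sub>C f x" for c x
      by (rule cinner_ext_left) (simp add: f cinner_scaleC_left)
    show "norm (f x) \<le> norm x * norm A" for x
    proof (cases "f x = 0")
      case False
      have "(norm (f x))\<^sup>2 = cmod (cinner (f x) (f x))" by (simp add: cinner_norm norm_power)
      also have "\<dots> = cmod (cinner x (A \<cdot> f x))" by (simp only: f)
      also have "\<dots> \<le> norm x * norm (A \<cdot> f x)" by (rule cinner_cauchy_schwarz)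
      also have "\<dots> \<le> norm x * (norm A * norm (f x))" by (intro mult_left_mono norm_app) simp
      finally show ?thesis using False by (simp add: power2_eq_square mult.assoc[symmetric])
    qed simp
  qed
  then show ?thesis unfolding adj_def f_def[symmetric] by (simp add: f)
qed

lemma cinner_adj_right: "cinner x (adj A \<cdot> y) = cinner (A \<cdot> x) y"
  by (metis cinner_adj_left cinner_commute)

lemma adj_eqI: "(\<And>x y. cinner (B \<cdot> x) y = cinner x (A \<cdot> y)) \<Longrightarrow> adj A = B"
  by (intro cop_eqI cinner_ext_left) (simp add: cinner_adj_left)

lemma adj_adj [simp]: "adj (adj A) = A"
  and adj_add: "adj (A + B) = adj A + adj B"
  and adj_diff: "adj (A - B) = adj A - adj B"
  and adj_mult: "adj (A * B) = adj B * adj A"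
  and adj_one [simp]: "adj 1 = 1"
  and adj_zero [simp]: "adj 0 = 0"
  and adj_csc: "adj (c \<odot> A) = cnj c \<odot> adj A"
  by (intro adj_eqI; simp add: app_add_left app_diff_left app_times cinner_add_left cinner_diff_left
      cinner_add_right cinner_diff_right cinner_adj_left cinner_adj_right app_csc cinner_scaleC_left
      cinner_scaleC_right)+

lemma norm_adj [simp]: "norm (adj A) = norm A"
proof -
  have le: "norm (adj A) \<le> norm A" for A :: "'a cop"
  proof (rule norm_copI)
    fix x
    show "norm (adj A \<cdot> x) \<le> norm A * norm x"
    proof (cases "adj A \<cdot> x = 0")
      case False
      have "(norm (adj A \<cdot> x))\<^sup>2 = cmod (cinner (adj A \<cdot> x) (adj A \<cdot> x))"
        by (simp add: cinner_norm norm_power)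
      also have "\<dots> = cmod (cinner x (A \<cdot> (adj A \<cdot> x)))" by (simp only: cinner_adj_left)
      also have "\<dots> \<le> norm x * norm (A \<cdot> (adj A \<cdot> x))" by (rule cinner_cauchy_schwarz)
      also have "\<dots> \<le> norm x * (norm A * norm (adj A \<cdot> x))" by (intro mult_left_mono norm_app) simp
      finally show ?thesis using False by (simp add: power2_eq_square mult.commute mult.assoc[symmetric])
    qed simp
  qed simp
  show ?thesis using le[of A] le[of "adj A"] by simp
qed

definition unitary :: "'a::complex_hilbert cop \<Rightarrow> bool" where
  "unitary U \<longleftrightarrow> adj U * U = 1 \<and> U * adj U = 1"

lemma unitary_cancel:
  assumes "unitary U"
  shows "adj U * U = 1" "U * adj U = 1" "adj U * (U * A) = A" "U * (adj U * A) = A"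
  using assms unfolding unitary_def by (simp_all flip: mult.assoc)

lemma unitary_one: "unitary 1"
  by (simp add: unitary_def)

lemma unitary_adj: "unitary U \<Longrightarrow> unitary (adj U)"
  by (simp add: unitary_def)

lemma unitary_mult: "unitary U \<Longrightarrow> unitary V \<Longrightarrow> unitary (U * V)"
  unfolding unitary_def[of "U * V"] by (simp add: adj_mult mult.assoc unitary_cancel)

lemma unitary_power: "unitary U \<Longrightarrow> unitary (U ^ n)"
  by (induction n) (simp_all add: unitary_one unitary_mult)

lemma norm_app_unitary: "unitary U \<Longrightarrow> norm (U \<cdot> x) = norm x"
proof -
  assume "unitary U"
  then have "cinner (U \<cdot> x) (U \<cdot> x) = cinner x x"
    using cinner_adj_left[of U "U \<cdot> x" x] by (simp add: unitary_cancel flip: app_times)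
  then have "(norm (U \<cdot> x))\<^sup>2 = (norm x)\<^sup>2" by (simp only: norm_sq_eq_cinner)
  then show ?thesis by simp
qed

lemma norm_unitary: "unitary U \<Longrightarrow> norm U \<le> 1"
  by (rule norm_copI) (simp_all add: norm_app_unitary)

no_notation Infinite_Set_Sum.abs_summable_on (infix \<open>abs'_summable'_on\<close> 50)

section \<open>Hilbert-Schmidt operators\<close>

text \<open>E need not be a basis: the ergodic estimate below splits a basis into a finite part and
  a tail and uses these notions on the tail.\<close>

definition hs :: "'a::complex_hilbert set \<Rightarrow> 'a cop \<Rightarrow> bool" where
  "hs E A \<longleftrightarrow> (\<lambda>e. (norm (A \<cdot> e))\<^sup>2) summable_on E"

text \<open>The square of the Hilbert-Schmidt norm. With squares throughout, the inequality of
  arithmetic and geometric means replaces Cauchy-Schwarz, with a scaling factor where the balance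
  matters (\<open>ip_bound_scaled\<close>).\<close>

definition hsq :: "'a::complex_hilbert set \<Rightarrow> 'a cop \<Rightarrow> real" where
  "hsq E A = (\<Sum>\<^sub>\<infinity>e\<in>E. (norm (A \<cdot> e))\<^sup>2)"

definition ip :: "'a::complex_hilbert set \<Rightarrow> 'a cop \<Rightarrow> 'a cop \<Rightarrow> complex" where
  "ip E A B = (\<Sum>\<^sub>\<infinity>e\<in>E. cinner (A \<cdot> e) (B \<cdot> e))"

lemma cinner_amgm: "cmod (cinner x y) \<le> (norm x)\<^sup>2 / 2 + (norm y)\<^sup>2 / 2"
proof -
  have "0 \<le> (norm x - norm y)\<^sup>2" by simp
  then have "norm x * norm y \<le> (norm x)\<^sup>2 / 2 + (norm y)\<^sup>2 / 2" by (simp add: power2_diff)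
  with cinner_cauchy_schwarz[of x y] show ?thesis by simp
qed

lemma norm_add_sq_le: "(norm (x + y))\<^sup>2 \<le> 2 * (norm x)\<^sup>2 + 2 * (norm (y :: 'a::complex_hilbert))\<^sup>2"
  using parallelogram[of x y] zero_le_power2[of "norm (x - y)"] by linarith

lemma hsq_nonneg: "0 \<le> hsq E A"
  unfolding hsq_def by (intro infsum_nonneg) simp

lemma hs_zero [simp]: "hs E 0" by (simp add: hs_def)

lemma hs_add: "hs E A \<Longrightarrow> hs E B \<Longrightarrow> hs E (A + B)"
  unfolding hs_def
  by (rule summable_on_comparison_test[where f = "\<lambda>e. 2 * (norm (A \<cdot> e))\<^sup>2 + 2 * (norm (B \<cdot> e))\<^sup>2"])
    (auto intro!: summable_on_add summable_on_cmult_right simp: app_add_left norm_add_sq_le)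

lemma hs_csc: "hs E A \<Longrightarrow> hs E (c \<odot> A)"
  unfolding hs_def
  by (auto intro!: summable_on_cmult_right simp: app_csc norm_scaleC power_mult_distrib)

lemma hs_uminus: "hs E A \<Longrightarrow> hs E (- A)"
  using hs_csc[of E A "-1"] by (simp add: csc_minus_one)

lemma hs_diff: "hs E A \<Longrightarrow> hs E B \<Longrightarrow> hs E (A - B)"
  using hs_add[OF _ hs_uminus, of E A B] by simp

lemma hs_sum: "(\<And>i. i \<in> S \<Longrightarrow> hs E (f i)) \<Longrightarrow> hs E (sum f S)"
  by (induction S rule: infinite_finite_induct) (simp_all add: hs_add)

lemma norm_app_sq_le: "(norm (C \<cdot> x))\<^sup>2 \<le> (norm C)\<^sup>2 * (norm x)\<^sup>2"
  using power_mono[OF norm_app[of C x], of 2] by (simp add: power_mult_distrib)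

lemma
  assumes A: "hs E A"
  shows hs_mult_left: "hs E (C * A)" and hsq_mult_left: "hsq E (C * A) \<le> (norm C)\<^sup>2 * hsq E A"
proof -
  have s: "(\<lambda>e. (norm C)\<^sup>2 * (norm (A \<cdot> e))\<^sup>2) summable_on E"
    using A by (auto simp: hs_def intro!: summable_on_cmult_right)
  show h: "hs E (C * A)"
    unfolding hs_def by (rule summable_on_comparison_test[OF s]) (auto simp: app_times norm_app_sq_le)
  have "hsq E (C * A) \<le> (\<Sum>\<^sub>\<infinity>e\<in>E. (norm C)\<^sup>2 * (norm (A \<cdot> e))\<^sup>2)"
    unfolding hsq_def
    by (intro infsum_mono s) (use h in \<open>auto simp: hs_def app_times norm_app_sq_le\<close>)
  also have "\<dots> = (norm C)\<^sup>2 * hsq E A"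
    unfolding hsq_def by (rule infsum_cmult_right')
  finally show "hsq E (C * A) \<le> (norm C)\<^sup>2 * hsq E A" .
qed

lemma summable_on_half: "f summable_on S \<Longrightarrow> (\<lambda>x. f x / 2) summable_on S" for f :: "'b \<Rightarrow> real"
  using summable_on_cmult_left[of f S "1/2"] by simp

lemma infsum_half: "(\<Sum>\<^sub>\<infinity>x\<in>S. f x / 2) = infsum f S / 2" for f :: "'b \<Rightarrow> real"
  using infsum_cmult_left'[of f "1/2" S] by simp

lemma ip_abs_summable:
  assumes "hs E A" "hs E B"
  shows "(\<lambda>e. cinner (A \<cdot> e) (B \<cdot> e)) abs_summable_on E"
  by (rule Infinite_Sum.abs_summable_on_comparison_test'[OF
        summable_on_add[OF summable_on_half summable_on_half] cinner_amgm])
    (use assms in \<open>simp_all add: hs_def\<close>)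

lemmas ip_summable = Infinite_Sum.abs_summable_summable[OF ip_abs_summable]

lemma ip_add_left: "hs E A \<Longrightarrow> hs E A' \<Longrightarrow> hs E B \<Longrightarrow> ip E (A + A') B = ip E A B + ip E A' B"
  unfolding ip_def app_add_left cinner_add_left by (intro infsum_add ip_summable)

lemma ip_add_right: "hs E A \<Longrightarrow> hs E B \<Longrightarrow> hs E B' \<Longrightarrow> ip E A (B + B') = ip E A B + ip E A B'"
  unfolding ip_def app_add_left cinner_add_right by (intro infsum_add ip_summable)

lemma ip_csc_right: "ip E A (c \<odot> B) = c * ip E A B"
  unfolding ip_def app_csc cinner_scaleC_right by (rule infsum_cmult_right')

lemma ip_csc_left: "ip E (c \<odot> A) B = cnj c * ip E A B"
  unfolding ip_def app_csc cinner_scaleC_left by (rule infsum_cmult_right')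

lemma ip_uminus_right: "ip E A (- B) = - ip E A B"
  using ip_csc_right[of E A "-1" B] by (simp add: csc_minus_one)

lemma ip_uminus_left: "ip E (- A) B = - ip E A B"
  using ip_csc_left[of E "-1" A B] by (simp add: csc_minus_one)

lemma ip_diff_right: "hs E A \<Longrightarrow> hs E B \<Longrightarrow> hs E B' \<Longrightarrow> ip E A (B - B') = ip E A B - ip E A B'"
  using ip_add_right[OF _ _ hs_uminus, of E A B B'] by (simp add: ip_uminus_right)

lemma ip_diff_left: "hs E A \<Longrightarrow> hs E A' \<Longrightarrow> hs E B \<Longrightarrow> ip E (A - A') B = ip E A B - ip E A' B"
  using ip_add_left[OF _ hs_uminus, of E A A' B] by (simp add: ip_uminus_left)

lemma ip_zero_right [simp]: "ip E A 0 = 0" by (simp add: ip_def)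

lemma ip_sum_right:
  "hs E A \<Longrightarrow> (\<And>i. i \<in> S \<Longrightarrow> hs E (f i)) \<Longrightarrow> ip E A (sum f S) = (\<Sum>i\<in>S. ip E A (f i))"
  by (induction S rule: infinite_finite_induct) (simp_all add: ip_add_right hs_sum)

lemma ip_self: "hs E A \<Longrightarrow> ip E A A = of_real (hsq E A)"
  unfolding ip_def hsq_def hs_def cinner_norm by (intro infsumI has_sum_of_real has_sum_infsum)

lemma ip_commute: "ip E A B = cnj (ip E B A)"
  unfolding ip_def infsum_cnj[symmetric] by (intro infsum_cong) (rule cinner_commute)

lemma ip_bound:
  assumes "hs E A" "hs E B"
  shows "cmod (ip E A B) \<le> (hsq E A + hsq E B) / 2"
proof -
  have "cmod (ip E A B) \<le> (\<Sum>\<^sub>\<infinity>e\<in>E. (norm (A \<cdot> e))\<^sup>2 / 2 + (norm (B \<cdot> e))\<^sup>2 / 2)"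
    unfolding ip_def
    using assms
    by (intro norm_infsum_le[OF has_sum_infsum has_sum_infsum] ip_summable summable_on_add
          summable_on_half cinner_amgm) (simp_all add: hs_def)
  also have "\<dots> = (hsq E A + hsq E B) / 2"
    unfolding hsq_def using assms
    by (subst infsum_add) (simp_all add: hs_def summable_on_half infsum_half add_divide_distrib)
  finally show ?thesis .
qed

lemma hsq_add:
  assumes "hs E A" "hs E B"
  shows "hsq E (A + B) = hsq E A + 2 * Re (ip E A B) + hsq E B"
proof -
  have "complex_of_real (hsq E (A + B)) = ip E A A + (ip E A B + ip E B A) + ip E B B"
    using assms by (simp add: ip_add_left ip_add_right hs_add ip_self[symmetric] del: of_real_add)
  then have "hsq E (A + B) = Re (ip E A A) + (Re (ip E A B) + Re (ip E B A)) + Re (ip E B B)"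
    by (metis Re_complex_of_real plus_complex.simps(1))
  moreover have "Re (ip E B A) = Re (ip E A B)" by (subst ip_commute) simp
  ultimately show ?thesis using assms by (simp add: ip_self)
qed

lemma hsq_csc: "hsq E (c \<odot> A) = (cmod c)\<^sup>2 * hsq E A"
  unfolding hsq_def app_csc norm_scaleC power_mult_distrib by (rule infsum_cmult_right')

lemma hsq_uminus: "hsq E (- A) = hsq E A"
  using hsq_csc[of E "-1" A] by (simp add: csc_minus_one)

lemma hsq_diff:
  assumes "hs E A" "hs E B"
  shows "hsq E (A - B) = hsq E A - 2 * Re (ip E A B) + hsq E B"
  using hsq_add[OF assms(1) hs_uminus[OF assms(2)]] by (simp add: hsq_uminus ip_uminus_right)

lemma parseval_cinner:
  assumes E: "orthonormal_basis E"
  shows "((\<lambda>e. cinner x e * cinner e y) has_sum cinner x y) E"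
proof -
  have s: "(\<lambda>e. cinner x e * cinner e y) abs_summable_on E"
  proof (rule Infinite_Sum.abs_summable_on_comparison_test')
    show "(\<lambda>e. (cmod (cinner e x))\<^sup>2 / 2 + (cmod (cinner e y))\<^sup>2 / 2) summable_on E"
      by (intro summable_on_add summable_on_half has_sum_imp_summable[OF parseval[OF E]])
    fix e
    have "0 \<le> (cmod (cinner e x) - cmod (cinner e y))\<^sup>2" by simp
    then show "cmod (cinner x e * cinner e y) \<le> (cmod (cinner e x))\<^sup>2 / 2 + (cmod (cinner e y))\<^sup>2 / 2"
      using cinner_commute[of x e] by (simp add: norm_mult power2_diff)
  qed
  have nrm: "((\<lambda>e. cinner z e * cinner e z) has_sum of_real ((norm z)\<^sup>2)) E" for z
  proof -
    have "((\<lambda>e. complex_of_real ((cmod (cinner e z))\<^sup>2)) has_sum of_real ((norm z)\<^sup>2)) E"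
      by (intro has_sum_of_real parseval[OF E])
    moreover have "complex_of_real ((cmod (cinner e z))\<^sup>2) = cinner z e * cinner e z" for e
      using cinner_commute[of z e] by (simp add: complex_norm_square mult.commute del: of_real_power)
    ultimately show ?thesis by simp
  qed
  obtain L where L: "((\<lambda>e. cinner x e * cinner e y) has_sum L) E"
    using Infinite_Sum.abs_summable_summable[OF s] by (auto simp: summable_on_def)
  have L': "((\<lambda>e. cinner y e * cinner e x) has_sum cnj L) E"
  proof -
    have "cnj (cinner x e * cinner e y) = cinner y e * cinner e x" for e
      using cinner_commute[of x e] cinner_commute[of e y] by (simp add: mult.commute)
    then show ?thesis using has_sum_cnj_iff[of "\<lambda>e. cinner x e * cinner e y" E L] L by simp
  qed
  \<comment> \<open>Parseval for c x + y: the square terms match, and the cross terms determine the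
    real part of \<open>cnj c * L\<close>. The values c = 1 and c = i then determine L.\<close>
  have pol: "2 * Re (cnj c * L) = 2 * Re (cnj c * cinner x y)" for c
  proof -
    let ?z = "c *\<^sub>C x"
    have "((\<lambda>e. cinner ?z e * cinner e ?z + (cnj c * (cinner x e * cinner e y) + c * (cinner y e * cinner e x))
        + cinner y e * cinner e y) has_sum of_real ((norm ?z)\<^sup>2) + (cnj c * L + c * cnj L) + of_real ((norm y)\<^sup>2)) E"
      by (intro has_sum_add nrm has_sum_cmult_right L L')
    moreover have "cinner ?z e * cinner e ?z + (cnj c * (cinner x e * cinner e y) + c * (cinner y e * cinner e x))
        + cinner y e * cinner e y = cinner (?z + y) e * cinner e (?z + y)" for e
      by (simp add: cinner_add_left cinner_add_right cinner_scaleC_left cinner_scaleC_right algebra_simps)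
    ultimately have "((\<lambda>e. cinner (?z + y) e * cinner e (?z + y)) has_sum
        of_real ((norm ?z)\<^sup>2) + (cnj c * L + c * cnj L) + of_real ((norm y)\<^sup>2)) E" by simp
    from has_sum_unique[OF this nrm]
    have "of_real ((norm ?z)\<^sup>2) + (cnj c * L + c * cnj L) + of_real ((norm y)\<^sup>2) = complex_of_real ((norm (?z + y))\<^sup>2)" .
    then have "Re (of_real ((norm ?z)\<^sup>2) + (cnj c * L + c * cnj L) + of_real ((norm y)\<^sup>2)) = (norm (?z + y))\<^sup>2"
      by (simp only: Re_complex_of_real)
    moreover have "Re (cnj c * L + c * cnj L) = 2 * Re (cnj c * L)" by simp
    ultimately show ?thesis unfolding norm_add_sq
      by (simp del: of_real_power add: cinner_scaleC_left)
  qed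
  have "L = cinner x y"
    using pol[of 1] pol[of \<i>] by (simp add: complex_eq_iff)
  with L show ?thesis by simp
qed

lemma hs_double_summable:
  assumes E': "orthonormal_basis E'" and A: "hs E A"
  shows "(\<lambda>(e, f). (cmod (cinner f (A \<cdot> e)))\<^sup>2) summable_on E \<times> E'"
  by (rule summable_on_SigmaI[where g = "\<lambda>e. (norm (A \<cdot> e))\<^sup>2"])
    (use A parseval[OF E'] in \<open>auto simp: hs_def\<close>)

text \<open>Both facts exchange the order of summation in a double sum over the matrix entries <f, A
  e>, once with squares and once for a product of two operators.\<close>

lemma
  assumes E: "orthonormal_basis E" and E': "orthonormal_basis E'" and A: "hs E A"
  shows hs_adj: "hs E' (adj A)"
    and ip_adj: "hs E B \<Longrightarrow> ip E' (adj A) (adj B) = ip E B A"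
proof -
  have *: "hs E' (adj A)" if A: "hs E A" for A
  proof -
    have "(\<lambda>(f, e). (cmod (cinner f (A \<cdot> e)))\<^sup>2) summable_on E' \<times> E"
      using hs_double_summable[OF E' A] by (subst (asm) summable_on_swap) simp
    then have "(\<lambda>f. \<Sum>\<^sub>\<infinity>e\<in>E. (cmod (cinner f (A \<cdot> e)))\<^sup>2) summable_on E'"
      by (rule summable_on_Sigma_banach)
    moreover have "(\<Sum>\<^sub>\<infinity>e\<in>E. (cmod (cinner f (A \<cdot> e)))\<^sup>2) = (norm (adj A \<cdot> f))\<^sup>2" for f
    proof -
      have "cmod (cinner f (A \<cdot> e)) = cmod (cinner e (adj A \<cdot> f))" for e
        by (metis cinner_adj_left cinner_commute complex_mod_cnj)
      then show ?thesis using infsumI[OF parseval[OF E, of "adj A \<cdot> f"]] by simp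
    qed
    ultimately show ?thesis by (simp add: hs_def)
  qed
  show "hs E' (adj A)" by (rule *[OF A])
  show "ip E' (adj A) (adj B) = ip E B A" if B: "hs E B"
  proof -
    let ?F = "\<lambda>e f. cinner (B \<cdot> e) f * cinner f (A \<cdot> e)"
    have "(\<lambda>(e, f). ?F e f) abs_summable_on E \<times> E'"
    proof (rule Infinite_Sum.abs_summable_on_comparison_test')
      show "(\<lambda>p. (case p of (e, f) \<Rightarrow> (cmod (cinner f (A \<cdot> e)))\<^sup>2) / 2
          + (case p of (e, f) \<Rightarrow> (cmod (cinner f (B \<cdot> e)))\<^sup>2) / 2) summable_on E \<times> E'"
        by (intro summable_on_add summable_on_half hs_double_summable E' A B)
      fix p
      show "cmod (case p of (e, f) \<Rightarrow> ?F e f) \<le> (case p of (e, f) \<Rightarrow> (cmod (cinner f (A \<cdot> e)))\<^sup>2) / 2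
          + (case p of (e, f) \<Rightarrow> (cmod (cinner f (B \<cdot> e)))\<^sup>2) / 2"
      proof (cases p)
        case (Pair e f)
        have "0 \<le> (cmod (cinner f (A \<cdot> e)) - cmod (cinner f (B \<cdot> e)))\<^sup>2" by simp
        moreover have "cmod (cinner (B \<cdot> e) f) = cmod (cinner f (B \<cdot> e))"
          by (metis cinner_commute complex_mod_cnj)
        ultimately show ?thesis
          by (simp add: Pair norm_mult power2_diff algebra_simps)
      qed
    qed
    then have "(\<Sum>\<^sub>\<infinity>e\<in>E. \<Sum>\<^sub>\<infinity>f\<in>E'. ?F e f) = (\<Sum>\<^sub>\<infinity>f\<in>E'. \<Sum>\<^sub>\<infinity>e\<in>E. ?F e f)"
      by (rule infsum_swap_banach[OF Infinite_Sum.abs_summable_summable])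
    moreover have "(\<Sum>\<^sub>\<infinity>f\<in>E'. ?F e f) = cinner (B \<cdot> e) (A \<cdot> e)" for e
      by (rule infsumI[OF parseval_cinner[OF E']])
    moreover have "(\<Sum>\<^sub>\<infinity>e\<in>E. ?F e f) = cinner (adj A \<cdot> f) (adj B \<cdot> f)" for f
    proof -
      have "?F e f = cinner (adj A \<cdot> f) e * cinner e (adj B \<cdot> f)" for e
        by (simp add: cinner_adj_left cinner_adj_right)
      then show ?thesis using infsumI[OF parseval_cinner[OF E]] by simp
    qed
    ultimately show ?thesis by (simp add: ip_def)
  qed
qed

text \<open>Passing to the adjoint allows the basis to change; a second adjoint returns to
  A.\<close>

lemma hs_basis_independent:
  assumes "orthonormal_basis E" "orthonormal_basis E'" "hs E A"
  shows "hs E' A"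
  using hs_adj[OF assms(2,2) hs_adj[OF assms]] by simp

section \<open>The ideal of Hilbert-Schmidt operators over a fixed orthonormal basis\<close>

locale onb =
  fixes E :: "'a::complex_hilbert set"
  assumes E: "orthonormal_basis E"
begin

abbreviation "HS \<equiv> hs E"
abbreviation "IP \<equiv> ip E"
abbreviation "HSQ \<equiv> hsq E"

lemmas HS_adj = hs_adj[OF E E]
lemmas IP_adj = ip_adj[OF E E]

lemma HSQ_adj: "HS A \<Longrightarrow> HSQ (adj A) = HSQ A"
  using IP_adj[of A A] by (simp add: ip_self HS_adj)

lemma HS_mult_right: "HS A \<Longrightarrow> HS (A * C)"
  using HS_adj[OF hs_mult_left[OF HS_adj, of A "adj C"]] by (simp add: adj_mult)

lemma HSQ_mult_right:
  assumes "HS A"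
  shows "HSQ (A * C) \<le> (norm C)\<^sup>2 * HSQ A"
proof -
  have "HSQ (A * C) = HSQ (adj C * adj A)"
    using HSQ_adj[OF HS_mult_right[OF assms]] by (simp add: adj_mult)
  also have "\<dots> \<le> (norm C)\<^sup>2 * HSQ A"
    using hsq_mult_left[OF HS_adj[OF assms], of "adj C"] assms by (simp add: HSQ_adj)
  finally show ?thesis .
qed

lemma IP_adj_left: "IP (C * A) B = IP A (adj C * B)"
  by (simp add: ip_def app_times cinner_adj_right)

lemma IP_adj_right:
  assumes "HS A" "HS B"
  shows "IP (A * C) B = IP A (B * adj C)"
proof -
  have "IP (A * C) B = IP (adj B) (adj (A * C))"
    using IP_adj[OF assms(2) HS_mult_right[OF assms(1)]] by simp
  also have "\<dots> = IP (C * adj B) (adj A)"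
    by (simp add: adj_mult IP_adj_left)
  also have "\<dots> = IP (adj (B * adj C)) (adj A)" by (simp add: adj_mult)
  also have "\<dots> = IP A (B * adj C)"
    using IP_adj[OF HS_mult_right[OF assms(2)] assms(1)] .
  finally show ?thesis .
qed

lemma HSQ_contract_left: "HS A \<Longrightarrow> norm C \<le> 1 \<Longrightarrow> HSQ (C * A) \<le> HSQ A"
  using hsq_mult_left[of E A C] mult_right_mono[OF power_le_one[of "norm C" 2] hsq_nonneg[of E A]] by simp

lemma HSQ_contract_right: "HS A \<Longrightarrow> norm C \<le> 1 \<Longrightarrow> HSQ (A * C) \<le> HSQ A"
  using HSQ_mult_right[of A C] mult_right_mono[OF power_le_one[of "norm C" 2] hsq_nonneg[of E A]] by simp

section \<open>The trace\<close>

definition tr :: "'a cop \<Rightarrow> complex" where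
  "tr A = (\<Sum>\<^sub>\<infinity>e\<in>E. cinner e (A \<cdot> e))"

text \<open>\<open>tc A t\<close> bounds the trace norm of \<open>A\<close> by \<open>t\<close> through duality with the contractions.\<close>

definition tc :: "'a cop \<Rightarrow> real \<Rightarrow> bool" where
  "tc A t \<longleftrightarrow> (\<forall>W F. norm W \<le> 1 \<longrightarrow> finite F \<longrightarrow> F \<subseteq> E \<longrightarrow>
     (\<Sum>e\<in>F. cmod (cinner (W \<cdot> e) (A \<cdot> e))) \<le> t)"

lemma tcD: "tc A t \<Longrightarrow> norm W \<le> 1 \<Longrightarrow> finite F \<Longrightarrow> F \<subseteq> E \<Longrightarrow>
     (\<Sum>e\<in>F. cmod (cinner (W \<cdot> e) (A \<cdot> e))) \<le> t"
  by (simp add: tc_def)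

lemma tc_nonneg: "tc A t \<Longrightarrow> 0 \<le> t"
  using tcD[of A t 1 "{}"] norm_one_cop by simp

lemma tc_mono: "tc A t \<Longrightarrow> t \<le> u \<Longrightarrow> tc A u"
  unfolding tc_def by (meson order_trans)

lemma tc_zero: "tc 0 0"
  by (simp add: tc_def)

lemma tc_add: "tc A t \<Longrightarrow> tc B u \<Longrightarrow> tc (A + B) (t + u)"
  unfolding tc_def
proof (intro allI impI)
  fix W :: "'a cop" and F :: "'a set"
  assume *: "\<forall>W F. norm W \<le> 1 \<longrightarrow> finite F \<longrightarrow> F \<subseteq> E \<longrightarrow> (\<Sum>e\<in>F. cmod (cinner (W \<cdot> e) (A \<cdot> e))) \<le> t"
    "\<forall>W F. norm W \<le> 1 \<longrightarrow> finite F \<longrightarrow> F \<subseteq> E \<longrightarrow> (\<Sum>e\<in>F. cmod (cinner (W \<cdot> e) (B \<cdot> e))) \<le> u"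
    "norm W \<le> 1" "finite F" "F \<subseteq> E"
  have "(\<Sum>e\<in>F. cmod (cinner (W \<cdot> e) ((A + B) \<cdot> e)))
      \<le> (\<Sum>e\<in>F. cmod (cinner (W \<cdot> e) (A \<cdot> e)) + cmod (cinner (W \<cdot> e) (B \<cdot> e)))"
    by (intro sum_mono) (simp add: app_add_left cinner_add_right norm_triangle_ineq)
  also have "\<dots> \<le> t + u"
    unfolding sum.distrib using * by (intro add_mono) auto
  finally show "(\<Sum>e\<in>F. cmod (cinner (W \<cdot> e) ((A + B) \<cdot> e))) \<le> t + u" .
qed

lemma tc_csc: "tc A t \<Longrightarrow> tc (c \<odot> A) (cmod c * t)"
  unfolding tc_def
  by (auto simp: app_csc cinner_scaleC_right norm_mult sum_distrib_left[symmetric] mult_left_mono)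

lemma tc_sum: "(\<And>i. i \<in> S \<Longrightarrow> tc (f i) (t i)) \<Longrightarrow> tc (sum f S) (sum t S)"
  by (induction S rule: infinite_finite_induct) (simp_all add: tc_add tc_zero)

text \<open>The contraction W is absorbed into the first factor: <W e, A B e> =
  <\<open>adj A * W\<close> e, B e>, an inner product of two Hilbert-Schmidt operators.\<close>

lemma tc_mult:
  assumes A: "HS A" and B: "HS B"
  shows "tc (A * B) ((HSQ A + HSQ B) / 2)"
  unfolding tc_def
proof (intro allI impI)
  fix W :: "'a cop" and F assume W: "norm W \<le> 1" and F: "finite F" "F \<subseteq> E"
  let ?C = "adj A * W"
  have C: "HS ?C" by (intro HS_mult_right HS_adj A)
  have "(\<Sum>e\<in>F. cmod (cinner (W \<cdot> e) ((A * B) \<cdot> e)))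
      \<le> (\<Sum>e\<in>F. (norm (?C \<cdot> e))\<^sup>2) / 2 + (\<Sum>e\<in>F. (norm (B \<cdot> e))\<^sup>2) / 2"
    unfolding sum_divide_distrib sum.distrib[symmetric]
    by (intro sum_mono) (metis app_times cinner_adj_left cinner_amgm)
  also have "\<dots> \<le> HSQ ?C / 2 + HSQ B / 2"
    unfolding hsq_def using C B F
    by (intro add_mono divide_right_mono finite_sum_le_infsum) (auto simp: hs_def)
  also have "\<dots> \<le> (HSQ A + HSQ B) / 2"
    using HSQ_contract_right[OF HS_adj[OF A] W] HSQ_adj[OF A] by simp
  finally show "(\<Sum>e\<in>F. cmod (cinner (W \<cdot> e) ((A * B) \<cdot> e))) \<le> (HSQ A + HSQ B) / 2" .
qed

text \<open>Lower semicontinuity of the trace norm: \<open>tc\<close> speaks of finite sums only,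
  and these pass to the limit under convergence in operator norm.\<close>

lemma tc_limit:
  assumes lim: "X \<longlonglongrightarrow> A" and tc: "\<And>n. tc (X n) t"
  shows "tc A t"
  unfolding tc_def
proof (intro allI impI)
  fix W :: "'a cop" and F assume W: "norm W \<le> 1" and F: "finite F" "F \<subseteq> E"
  have "(\<lambda>n. \<Sum>e\<in>F. cmod (cinner (W \<cdot> e) (X n \<cdot> e))) \<longlonglongrightarrow> (\<Sum>e\<in>F. cmod (cinner (W \<cdot> e) (A \<cdot> e)))"
    by (intro tendsto_intros bounded_linear.tendsto[OF bounded_linear_app_left lim])
  then show "(\<Sum>e\<in>F. cmod (cinner (W \<cdot> e) (A \<cdot> e))) \<le> t"
    by (rule LIMSEQ_le_const2) (use tcD[OF tc W F] in auto)
qed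

lemma tr_abs_summable: "tc A t \<Longrightarrow> (\<lambda>e. cinner e (A \<cdot> e)) abs_summable_on E"
  by (rule nonneg_bdd_above_summable_on)
    (use tcD[of A t 1] norm_one_cop in \<open>auto intro!: bdd_aboveI2[of _ _ t]\<close>)

lemmas tr_summable = Infinite_Sum.abs_summable_summable[OF tr_abs_summable]

lemma tr_bound: "tc A t \<Longrightarrow> cmod (tr A) \<le> t"
proof -
  assume A: "tc A t"
  have "cmod (tr A) \<le> (\<Sum>\<^sub>\<infinity>e\<in>E. cmod (cinner e (A \<cdot> e)))"
    unfolding tr_def by (rule norm_infsum_bound[OF tr_abs_summable[OF A]])
  also have "\<dots> \<le> t"
    using tcD[OF A norm_one_cop] by (intro infsum_le_finite_sums tr_abs_summable[OF A]) auto
  finally show ?thesis .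
qed

lemma tr_add: "tc A t \<Longrightarrow> tc B u \<Longrightarrow> tr (A + B) = tr A + tr B"
  unfolding tr_def app_add_left cinner_add_right by (intro infsum_add tr_summable)

lemma tr_csc: "tr (c \<odot> A) = c * tr A"
  unfolding tr_def app_csc cinner_scaleC_right by (rule infsum_cmult_right')

lemma tr_sum: "(\<And>i. i \<in> S \<Longrightarrow> tc (f i) (t i)) \<Longrightarrow> tr (sum f S) = (\<Sum>i\<in>S. tr (f i))"
proof (induction S rule: infinite_finite_induct)
  case (insert x F)
  then show ?case using tr_add[of "f x" "t x" "sum f F" "sum t F"] by (simp add: tc_sum)
qed (simp_all add: tr_def)

lemma tr_mult: "tr (A * B) = IP (adj A) B"
  by (simp add: tr_def ip_def app_times cinner_adj_left)

lemma tr_mult_commute: "HS A \<Longrightarrow> HS B \<Longrightarrow> tr (A * B) = tr (B * A)"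
  unfolding tr_mult using IP_adj[of A "adj B"] by (simp add: HS_adj)

lemma
  assumes tc: "\<And>n. tc (f n) (t n)" and t: "summable t" and f: "summable f"
  shows tc_suminf: "tc (suminf f) (suminf t)"
    and tr_suminf: "(\<lambda>n. tr (f n)) sums tr (suminf f)"
proof -
  \<comment> \<open>The tail of the series inherits the tail of the bounds, by
    \<open>tc_limit\<close> along the partial sums up to M + N. Both claims follow, for N = 0 and
    for N -> infinity.\<close>
  have part: "tc (suminf f - sum f {..<N}) (suminf t - sum t {..<N})" for N
  proof (rule tc_limit)
    show "(\<lambda>M. sum f {..<M + N} - sum f {..<N}) \<longlonglongrightarrow> suminf f - sum f {..<N}"
      by (intro tendsto_intros LIMSEQ_ignore_initial_segment summable_LIMSEQ f)
    fix M
    have eq: "{..<M + N} = {..<N} \<union> {N..<M + N}" by auto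
    have "sum f {..<M + N} - sum f {..<N} = sum f {N..<M + N}"
      unfolding eq by (subst sum.union_disjoint) auto
    moreover have "sum t {..<M + N} - sum t {..<N} = sum t {N..<M + N}"
      unfolding eq by (subst sum.union_disjoint) auto
    moreover have "sum t {..<M + N} \<le> suminf t"
      by (rule sum_le_suminf[OF t]) (auto intro: tc_nonneg tc)
    ultimately show "tc (sum f {..<M + N} - sum f {..<N}) (suminf t - sum t {..<N})"
      using tc_mono[OF tc_sum[of "{N..<M+N}" f t, OF tc]] by simp
  qed
  show "tc (suminf f) (suminf t)" using part[of 0] by simp
  have "(\<lambda>N. tr (suminf f) - (\<Sum>n<N. tr (f n))) \<longlonglongrightarrow> 0"
  proof (rule Lim_null_comparison)
    show "\<forall>\<^sub>F N in sequentially. norm (tr (suminf f) - (\<Sum>n<N. tr (f n))) \<le> suminf t - sum t {..<N}"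
    proof (rule always_eventually, rule allI)
      fix N
      have "tr (suminf f) = tr (suminf f - sum f {..<N}) + tr (sum f {..<N})"
        using tr_add[OF part[of N] tc_sum[of "{..<N}" f t, OF tc]] by simp
      then have "tr (suminf f) - (\<Sum>n<N. tr (f n)) = tr (suminf f - sum f {..<N})"
        using tr_sum[of "{..<N}" f t, OF tc] by simp
      then show "norm (tr (suminf f) - (\<Sum>n<N. tr (f n))) \<le> suminf t - sum t {..<N}"
        using tr_bound[OF part[of N]] by simp
    qed
    have "(\<lambda>N. suminf t - sum t {..<N}) \<longlonglongrightarrow> suminf t - suminf t"
      by (intro tendsto_intros summable_LIMSEQ t)
    then show "(\<lambda>N. suminf t - sum t {..<N}) \<longlonglongrightarrow> 0" by simp
  qed
  then have "(\<lambda>N. tr (suminf f) - (tr (suminf f) - (\<Sum>n<N. tr (f n)))) \<longlonglongrightarrow> tr (suminf f) - 0"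
    by (intro tendsto_intros)
  then show "(\<lambda>n. tr (f n)) sums tr (suminf f)" by (simp add: sums_def)
qed

end

section \<open>Moment sequences of integrable functions\<close>

text \<open>An abstraction of the circle with normalized arc length. It is instantiated by the line
  with the Cauchy distribution, so that densities are obtained on the line directly.\<close>

locale circle_space = finite_measure M for M :: "'b measure" +
  fixes w :: "'b \<Rightarrow> complex"
  assumes total: "measure M (space M) = 1"
    and w_measurable [measurable]: "w \<in> borel_measurable M"
    and norm_w [simp]: "\<And>x. cmod (w x) = 1"
    and integral_w_power: "\<And>n. 0 < n \<Longrightarrow> (\<integral>x. w x ^ n \<partial>M) = 0"
begin

lemma w_cnj: "w x * cnj (w x) = 1"
  using complex_norm_square[of "w x"] by simp

lemma cnj_w_measurable [measurable]: "(\<lambda>x. cnj (w x)) \<in> borel_measurable M"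
  by (rule borel_measurable_continuous_on[OF _ w_measurable]) (intro continuous_intros)

lemma integrable_bounded:
  fixes f :: "'b \<Rightarrow> 'c::{banach, second_countable_topology}"
  shows "f \<in> borel_measurable M \<Longrightarrow> (\<And>x. norm (f x) \<le> B) \<Longrightarrow> integrable M f"
  by (rule integrable_const_bound[of f B]) auto

lemma integrable_monomial [simp]: "integrable M (\<lambda>x. w x ^ m * cnj (w x) ^ n)"
  by (rule integrable_bounded[of _ 1]) (auto simp: norm_mult norm_power)

lemma orthonormal_monomials:
  "(\<integral>x. w x ^ m * cnj (w x) ^ n \<partial>M) = (if m = n then 1 else 0)"
proof -
  have big: "(\<integral>x. w x ^ (n + Suc k) * cnj (w x) ^ n \<partial>M) = 0" for n k
  proof -
    have "w x ^ (n + Suc k) * cnj (w x) ^ n = w x ^ Suc k * (w x * cnj (w x)) ^ n" for x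
      by (simp only: power_add power_mult_distrib mult_ac)
    then show ?thesis using integral_w_power[of "Suc k"] by (simp add: w_cnj del: power_Suc)
  qed
  consider "m = n" | k where "m = n + Suc k" | k where "n = m + Suc k"
    using less_imp_Suc_add by (metis add_Suc_right linorder_neqE_nat)
  then show ?thesis
  proof cases
    case 1
    have "w x ^ n * cnj (w x) ^ n = 1" for x
      using w_cnj[of x] by (simp flip: power_mult_distrib)
    with 1 show ?thesis by (simp add: total)
  next
    case 2
    then show ?thesis by (simp add: big del: power_Suc add_Suc_right)
  next
    case 3
    have "(\<integral>x. w x ^ m * cnj (w x) ^ n \<partial>M) = (\<integral>x. cnj (w x ^ n * cnj (w x) ^ m) \<partial>M)"
      by (simp add: mult.commute)
    also have "\<dots> = cnj (\<integral>x. w x ^ n * cnj (w x) ^ m \<partial>M)"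
      by (rule integral_bounded_linear[OF bounded_linear_cnj]) simp
    finally show ?thesis using 3 by (simp add: big del: power_Suc add_Suc_right)
  qed
qed

lemma integrable_w_mult:
  assumes f: "integrable M \<eta>"
  shows "integrable M (\<lambda>x. w x ^ n * \<eta> x)" "integrable M (\<lambda>x. cnj (w x) ^ n * \<eta> x)"
  using borel_measurable_integrable[OF f]
  by (auto intro!: Bochner_Integration.integrable_bound[OF f] simp: norm_mult norm_power)

text \<open>Nothing is asked of the negative moments, so the density is not unique and the infimum
  of the possible B is a quotient norm.\<close>

definition moments :: "(nat \<Rightarrow> complex) \<Rightarrow> real \<Rightarrow> bool" where
  "moments c B \<longleftrightarrow> (\<exists>\<eta>. integrable M \<eta> \<and> (\<integral>x. norm (\<eta> x) \<partial>M) \<le> B \<and>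
     (\<forall>n. (\<integral>x. w x ^ n * \<eta> x \<partial>M) = c n))"

lemma momentsI:
  "integrable M \<eta> \<Longrightarrow> (\<integral>x. norm (\<eta> x) \<partial>M) \<le> B \<Longrightarrow> (\<And>n. (\<integral>x. w x ^ n * \<eta> x \<partial>M) = c n) \<Longrightarrow> moments c B"
  by (auto simp: moments_def)

lemma moments_mono: "moments c B \<Longrightarrow> B \<le> B' \<Longrightarrow> moments c B'"
  unfolding moments_def by (meson order_trans)

lemma moments_add:
  assumes "moments c B" "moments d B'"
  shows "moments (\<lambda>n. c n + d n) (B + B')"
proof -
  obtain \<eta> where \<eta>: "integrable M \<eta>" "(\<integral>x. norm (\<eta> x) \<partial>M) \<le> B" "\<And>n. (\<integral>x. w x ^ n * \<eta> x \<partial>M) = c n"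
    using assms(1) by (auto simp: moments_def)
  obtain \<theta> where \<theta>: "integrable M \<theta>" "(\<integral>x. norm (\<theta> x) \<partial>M) \<le> B'" "\<And>n. (\<integral>x. w x ^ n * \<theta> x \<partial>M) = d n"
    using assms(2) by (auto simp: moments_def)
  show ?thesis
  proof (rule momentsI)
    show "integrable M (\<lambda>x. \<eta> x + \<theta> x)" using \<eta> \<theta> by simp
    have "(\<integral>x. norm (\<eta> x + \<theta> x) \<partial>M) \<le> (\<integral>x. norm (\<eta> x) + norm (\<theta> x) \<partial>M)"
      using \<eta>(1) \<theta>(1) by (intro integral_mono norm_triangle_ineq) auto
    then show "(\<integral>x. norm (\<eta> x + \<theta> x) \<partial>M) \<le> B + B'" using \<eta> \<theta> by simp
    show "(\<integral>x. w x ^ n * (\<eta> x + \<theta> x) \<partial>M) = c n + d n" for n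
      using \<eta> \<theta> by (simp add: distrib_left integrable_w_mult)
  qed
qed

lemma moments_cmult:
  assumes "moments c B"
  shows "moments (\<lambda>n. a * c n) (cmod a * B)"
proof -
  obtain \<eta> where \<eta>: "integrable M \<eta>" "(\<integral>x. norm (\<eta> x) \<partial>M) \<le> B" "\<And>n. (\<integral>x. w x ^ n * \<eta> x \<partial>M) = c n"
    using assms(1) by (auto simp: moments_def)
  show ?thesis
    by (rule momentsI[of "\<lambda>x. a * \<eta> x"])
      (use \<eta> in \<open>auto simp: norm_mult mult.left_commute[of _ a] intro!: mult_left_mono\<close>)
qed

lemma moments_coeff_bound:
  assumes "moments c B"
  shows "cmod (c n) \<le> B"
proof -
  obtain \<eta> where \<eta>: "integrable M \<eta>" "(\<integral>x. norm (\<eta> x) \<partial>M) \<le> B" "\<And>n. (\<integral>x. w x ^ n * \<eta> x \<partial>M) = c n"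
    using assms(1) by (auto simp: moments_def)
  have "cmod (c n) \<le> (\<integral>x. norm (w x ^ n * \<eta> x) \<partial>M)"
    unfolding \<eta>(3)[symmetric] by (rule integral_norm_bound)
  with \<eta>(2) show ?thesis by (simp add: norm_mult norm_power)
qed

lemma
  fixes c :: "nat \<Rightarrow> complex"
  assumes S: "finite S"
  defines "p \<equiv> \<lambda>x. \<Sum>n\<in>S. c n * cnj (w x) ^ n"
  shows integrable_trig_poly: "integrable M p"
    and moments_trig_poly: "(\<integral>x. w x ^ m * p x \<partial>M) = (if m \<in> S then c m else 0)"
    and integral_norm_sq_trig_poly: "(\<integral>x. (cmod (p x))\<^sup>2 \<partial>M) = (\<Sum>n\<in>S. (cmod (c n))\<^sup>2)"
    and norm_trig_poly: "cmod (p x) \<le> (\<Sum>n\<in>S. cmod (c n))"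
proof -
  have int: "integrable M (\<lambda>x. c n * cnj (w x) ^ n)" for n
    using integrable_monomial[of 0 n] by simp
  show "integrable M p" unfolding p_def using int by simp
  show nb: "cmod (p x) \<le> (\<Sum>n\<in>S. cmod (c n))" for x
    unfolding p_def by (rule order_trans[OF norm_sum]) (simp add: norm_mult norm_power)
  show mom: "(\<integral>x. w x ^ m * p x \<partial>M) = (if m \<in> S then c m else 0)" for m
  proof -
    have "(\<integral>x. w x ^ m * p x \<partial>M) = (\<integral>x. (\<Sum>n\<in>S. c n * (w x ^ m * cnj (w x) ^ n)) \<partial>M)"
      unfolding p_def by (simp add: sum_distrib_left mult.left_commute)
    also have "\<dots> = (\<Sum>n\<in>S. c n * (if m = n then 1 else 0))"
      by (subst Bochner_Integration.integral_sum) (simp_all add: orthonormal_monomials)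
    also have "\<dots> = (\<Sum>n\<in>S. if m = n then c n else 0)"
      by (intro sum.cong) auto
    also have "\<dots> = (if m \<in> S then c m else 0)" using S by simp
    finally show ?thesis .
  qed
  have "complex_of_real (\<integral>x. (cmod (p x))\<^sup>2 \<partial>M) = (\<integral>x. complex_of_real ((cmod (p x))\<^sup>2) \<partial>M)"
    by (simp del: of_real_power)
  also have "\<dots> = (\<integral>x. (\<Sum>m\<in>S. cnj (c m) * (w x ^ m * p x)) \<partial>M)"
    unfolding complex_norm_square by (simp add: p_def sum_distrib_left sum_distrib_right mult_ac)
  also have "\<dots> = (\<Sum>m\<in>S. cnj (c m) * c m)"
    by (subst Bochner_Integration.integral_sum)
      (simp_all add: mom integrable_w_mult \<open>integrable M p\<close>)
  also have "\<dots> = complex_of_real (\<Sum>n\<in>S. (cmod (c n))\<^sup>2)"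
    by (simp add: complex_norm_square mult.commute del: of_real_power)
  finally show "(\<integral>x. (cmod (p x))\<^sup>2 \<partial>M) = (\<Sum>n\<in>S. (cmod (c n))\<^sup>2)"
    by (simp only: of_real_eq_iff)
qed

lemma moments_finite:
  assumes S: "finite S"
  shows "moments (\<lambda>n. if n \<in> S then c n else 0) (\<Sum>n\<in>S. cmod (c n))"
proof (rule momentsI[OF integrable_trig_poly[OF S, of c] _ moments_trig_poly[OF S]])
  have "(\<integral>x. norm (\<Sum>n\<in>S. c n * cnj (w x) ^ n) \<partial>M) \<le> (\<integral>x. (\<Sum>n\<in>S. cmod (c n)) \<partial>M)"
    by (intro integral_mono integrable_norm integrable_trig_poly S norm_trig_poly) simp
  then show "(\<integral>x. norm (\<Sum>n\<in>S. c n * cnj (w x) ^ n) \<partial>M) \<le> (\<Sum>n\<in>S. cmod (c n))"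
    by (simp add: total)
qed

text \<open>As the total mass is one, the integral of |p| is at most the root of the integral of
  |p|^2; the parameter s, best taken as that root, avoids the root itself.\<close>

lemma moments_block:
  assumes S: "finite S" and s: "0 < s"
  shows "moments (\<lambda>n. if n \<in> S then c n else 0) ((s + (\<Sum>n\<in>S. (cmod (c n))\<^sup>2) / s) / 2)"
proof (rule momentsI[OF integrable_trig_poly[OF S, of c] _ moments_trig_poly[OF S]])
  let ?p = "\<lambda>x. \<Sum>n\<in>S. c n * cnj (w x) ^ n"
  have p: "integrable M ?p" by (rule integrable_trig_poly[OF S])
  have sq: "integrable M (\<lambda>x. (cmod (?p x))\<^sup>2)"
    by (rule integrable_bounded[of _ "(\<Sum>n\<in>S. cmod (c n))\<^sup>2"])
      (auto intro!: power_mono norm_trig_poly S)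
  have "(\<integral>x. norm (?p x) \<partial>M) \<le> (\<integral>x. (s + (cmod (?p x))\<^sup>2 / s) / 2 \<partial>M)"
  proof (intro integral_mono integrable_norm p)
    show "integrable M (\<lambda>x. (s + (cmod (?p x))\<^sup>2 / s) / 2)" using sq by simp
    fix x
    have "0 \<le> (cmod (?p x) - s)\<^sup>2" by simp
    then show "norm (?p x) \<le> (s + (cmod (?p x))\<^sup>2 / s) / 2"
      using s by (simp add: field_simps power2_eq_square)
  qed
  also have "\<dots> = (s + (\<Sum>n\<in>S. (cmod (c n))\<^sup>2) / s) / 2"
    using sq by (simp add: integral_norm_sq_trig_poly[OF S] total)
  finally show "(\<integral>x. norm (?p x) \<partial>M) \<le> (s + (\<Sum>n\<in>S. (cmod (c n))\<^sup>2) / s) / 2" .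
qed

text \<open>Completeness of the space of integrable functions: densities are chosen for each k, and
  their series converges absolutely almost everywhere.\<close>

lemma
  assumes c: "\<And>k. moments (c k) (B k)" and B: "summable B"
  shows moments_suminf: "moments (\<lambda>n. \<Sum>k. c k n) (suminf B)"
    and moments_summable: "summable (\<lambda>k. c k n)"
proof -
  have B0: "0 \<le> B k" for k using moments_coeff_bound[OF c[of k], of 0] norm_ge_zero order_trans by blast
  show "summable (\<lambda>k. c k n)"
    by (rule summable_comparison_test[OF _ B]) (use moments_coeff_bound[OF c] in auto)
  have "\<forall>k. \<exists>\<eta>. integrable M \<eta> \<and> (\<integral>x. norm (\<eta> x) \<partial>M) \<le> B k \<and> (\<forall>n. (\<integral>x. w x ^ n * \<eta> x \<partial>M) = c k n)"
    using c unfolding moments_def by simp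
  then obtain \<eta> where int [simp]: "\<And>k. integrable M (\<eta> k)" and le: "\<And>k. (\<integral>x. norm (\<eta> k x) \<partial>M) \<le> B k"
    and mom: "\<And>k n. (\<integral>x. w x ^ n * \<eta> k x \<partial>M) = c k n"
    by metis
  have [measurable]: "\<eta> k \<in> borel_measurable M" for k using int by (rule borel_measurable_integrable)
  have sumint: "summable (\<lambda>k. \<integral>x. norm (\<eta> k x) \<partial>M)"
    by (rule summable_comparison_test[OF _ B]) (use le in auto)
  have "(\<integral>\<^sup>+x. (\<Sum>k. ennreal (norm (\<eta> k x))) \<partial>M) = (\<Sum>k. \<integral>\<^sup>+x. ennreal (norm (\<eta> k x)) \<partial>M)"
    by (rule nn_integral_suminf) simp
  also have "\<dots> = (\<Sum>k. ennreal (\<integral>x. norm (\<eta> k x) \<partial>M))"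
    by (simp add: nn_integral_eq_integral)
  also have "\<dots> = ennreal (\<Sum>k. \<integral>x. norm (\<eta> k x) \<partial>M)"
    by (rule suminf_ennreal2) (simp_all add: sumint)
  finally have "(\<integral>\<^sup>+x. (\<Sum>k. ennreal (norm (\<eta> k x))) \<partial>M) \<noteq> \<infinity>" by simp
  then have "AE x in M. (\<Sum>k. ennreal (norm (\<eta> k x))) \<noteq> \<infinity>"
    by (intro nn_integral_PInf_AE) auto
  then have AE: "AE x in M. summable (\<lambda>k. norm (\<eta> k x))"
    by (rule AE_mp) (auto intro!: AE_I2 summable_suminf_not_top)
  show "moments (\<lambda>n. \<Sum>k. c k n) (suminf B)"
  proof (rule momentsI)
    show "integrable M (\<lambda>x. \<Sum>k. \<eta> k x)" by (rule integrable_suminf[OF int AE sumint])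
    have AE': "AE x in M. summable (\<lambda>k. norm (norm (\<eta> k x)))" using AE by simp
    have "(\<integral>x. norm (\<Sum>k. \<eta> k x) \<partial>M) \<le> (\<integral>x. (\<Sum>k. norm (\<eta> k x)) \<partial>M)"
      by (rule integral_mono_AE)
        (use AE in \<open>auto intro!: integrable_suminf[OF int AE sumint] integrable_suminf[OF _ AE'] sumint
           intro: AE_mp[OF AE] summable_norm\<close>)
    also have "\<dots> = (\<Sum>k. \<integral>x. norm (\<eta> k x) \<partial>M)"
      by (rule integral_suminf[OF _ AE']) (simp_all add: sumint)
    also have "\<dots> \<le> suminf B" by (rule suminf_le[OF le sumint B])
    finally show "(\<integral>x. norm (\<Sum>k. \<eta> k x) \<partial>M) \<le> suminf B" .
    fix n
    have "(\<integral>x. w x ^ n * (\<Sum>k. \<eta> k x) \<partial>M) = (\<integral>x. (\<Sum>k. w x ^ n * \<eta> k x) \<partial>M)"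
      by (rule integral_cong_AE)
        (use AE in \<open>auto intro!: suminf_mult[symmetric] borel_measurable_integrable
           integrable_suminf[OF int AE sumint] integrable_suminf[OF integrable_w_mult(1)[OF int]]
           intro: AE_mp[OF AE] summable_norm_cancel simp: norm_mult norm_power sumint\<close>)
    also have "\<dots> = (\<Sum>k. \<integral>x. w x ^ n * \<eta> k x \<partial>M)"
      by (rule integral_suminf) (use AE in \<open>simp_all add: integrable_w_mult norm_mult norm_power sumint\<close>)
    finally show "(\<integral>x. w x ^ n * (\<Sum>k. \<eta> k x) \<partial>M) = (\<Sum>k. c k n)" by (simp add: mom)
  qed
qed

text \<open>The proof sums over dyadic blocks, whose square sums decrease geometrically.\<close>

lemma moments_tail:
  assumes c: "\<And>n. cmod (c n) \<le> A / real (Suc n)" and A: "0 < A"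
  shows "moments (\<lambda>n. if Suc n < 2 ^ K then 0 else c n) (4 * A * (3/4) ^ K)"
proof -
  \<comment> \<open>The blocks are dyadic in \<open>Suc n\<close>, so that n = 0 forms block
    0.\<close>
  define S where "S k = {n::nat. 2 ^ k \<le> Suc n \<and> Suc n < 2 ^ Suc k}" for k
  have arith: "{n. a \<le> Suc n \<and> Suc n < 2 * a} = {a - 1..<2 * a - 1}" if "1 \<le> a" for a
    using that by auto
  have S_eq: "S k = {2 ^ k - 1..<2 * 2 ^ k - 1}" for k
    unfolding S_def power_Suc by (rule arith) simp
  have finS: "finite (S k)" for k unfolding S_eq by (rule finite_atLeastLessThan)
  have cardS: "card (S k) = 2 ^ k" for k
  proof -
    have "2 * a - 1 - (a - 1) = a" if "1 \<le> a" for a :: nat using that by linarith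
    from this[of "2 ^ k"] show ?thesis unfolding S_eq card_atLeastLessThan by simp
  qed
  define d where "d k n = (if n \<in> S (K + k) then c n else 0)" for k n
  define B where "B k = A * (3/4) ^ (K + k)" for k
  \<comment> \<open>The 2^k terms are at most A / 2^k each, so the natural bound is A / (sqrt 2)^k.
    The number 3/4 is a rational bound for 1 / sqrt 2, and (2/3) (3/4) 2 = 1 evaluates the
    quotient.\<close>
  have block: "moments (\<lambda>n. if n \<in> S k then c n else 0) (A * (3/4) ^ k)" for k
  proof (rule moments_mono[OF moments_block[OF finS, of "A * (3/4) ^ k"]])
    have "(\<Sum>n\<in>S k. (cmod (c n))\<^sup>2) \<le> (\<Sum>n\<in>S k. (A / 2 ^ k)\<^sup>2)"
    proof (rule sum_mono, rule power_mono)
      fix n assume "n \<in> S k"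
      then have "2 ^ k \<le> Suc n" by (simp add: S_def)
      then have "real (2 ^ k) \<le> real (Suc n)" by (simp only: of_nat_le_iff)
      then have "2 ^ k \<le> real (Suc n)" by (simp only: of_nat_power of_nat_numeral)
      then have "A / real (Suc n) \<le> A / 2 ^ k" using A by (intro divide_left_mono) auto
      with c[of n] show "cmod (c n) \<le> A / 2 ^ k" by linarith
    qed simp
    also have "\<dots> = A\<^sup>2 / 2 ^ k" by (simp add: cardS power_divide power2_eq_square)
    finally have "(\<Sum>n\<in>S k. (cmod (c n))\<^sup>2) / (A * (3/4) ^ k) \<le> A\<^sup>2 / 2 ^ k / (A * (3/4) ^ k)"
      using A by (intro divide_right_mono) auto
    also have "\<dots> = A * (2/3) ^ k"
    proof -
      have "p * q * t = 1 \<Longrightarrow> 0 < q \<Longrightarrow> 0 < t \<Longrightarrow> A\<^sup>2 / t / (A * q) = A * p" for p q t :: real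
        using A by (simp add: field_simps power2_eq_square)
      from this[of "(2/3) ^ k" "(3/4) ^ k" "2 ^ k"] show ?thesis by (simp flip: power_mult_distrib)
    qed
    also have "\<dots> \<le> A * (3/4) ^ k" using A by (intro mult_left_mono power_mono) auto
    finally show "(A * (3/4) ^ k + (\<Sum>n\<in>S k. (cmod (c n))\<^sup>2) / (A * (3/4) ^ k)) / 2 \<le> A * (3/4) ^ k"
      by simp
  qed (use A in simp)
  \<comment> \<open>The 4 in the claim is the sum of the geometric series with ratio 3/4.\<close>
  have B: "B sums (4 * A * (3/4) ^ K)"
    using sums_mult[OF geometric_sums[of "3/4 :: real"], of "A * (3/4) ^ K"]
    by (simp add: B_def[abs_def] power_add mult_ac)
  have dB: "moments (d k) (B k)" for k unfolding d_def B_def by (rule block)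
  have "(\<Sum>k. d k n) = (if Suc n < 2 ^ K then 0 else c n)" for n
  proof (cases "Suc n < 2 ^ K")
    case True
    have "d k n = 0" for k
    proof -
      have "(2::nat) ^ K \<le> 2 ^ (K + k)" by (rule power_increasing) auto
      with True have "n \<notin> S (K + k)" unfolding S_def mem_Collect_eq by linarith
      then show ?thesis by (simp add: d_def)
    qed
    with True show ?thesis by simp
  next
    case False
    obtain j where j: "2 ^ j \<le> Suc n" "Suc n < 2 ^ Suc j"
      using ex_power_ivl1[of 2 "Suc n"] by auto
    have "K \<le> j"
    proof (rule ccontr)
      assume "\<not> K \<le> j"
      then have "(2::nat) ^ Suc j \<le> 2 ^ K" by (intro power_increasing) auto
      with j False show False by simp
    qed
    then obtain i where i: "j = K + i" using le_Suc_ex by blast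
    have "d k n = 0" if "k \<noteq> i" for k
    proof (cases "k < i")
      case True
      then have "(2::nat) ^ Suc (K + k) \<le> 2 ^ j" unfolding i by (intro power_increasing) auto
      with j have "n \<notin> S (K + k)" unfolding S_def mem_Collect_eq by linarith
      then show ?thesis by (simp add: d_def)
    next
      case False
      with that have "(2::nat) ^ Suc j \<le> 2 ^ (K + k)" unfolding i by (intro power_increasing) auto
      with j have "n \<notin> S (K + k)" unfolding S_def mem_Collect_eq by linarith
      then show ?thesis by (simp add: d_def)
    qed
    then have "(\<lambda>k. d k n) = (\<lambda>k. if k = i then d k n else 0)" by auto
    then have "(\<lambda>k. d k n) sums (d i n)" using sums_single[of i "\<lambda>k. d k n"] by simp
    moreover have "d i n = c n" using j by (simp add: d_def S_def i)
    ultimately show ?thesis using False by (simp add: sums_iff)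
  qed
  with moments_suminf[OF dB sums_summable[OF B]] sums_unique[OF B] show ?thesis by simp
qed

text \<open>The density is \<open>2 Re (\<Sum>n. c n * cnj w ^ n) - c 0\<close>, as in Herglotz' theorem.\<close>

lemma moments_positive:
  assumes c: "\<And>n. cmod (c n) \<le> A * r ^ n" and r: "0 \<le> r" "r < 1" and c0: "Im (c 0) = 0"
    and pos: "\<And>\<zeta>. cmod \<zeta> = 1 \<Longrightarrow> Re (c 0) \<le> 2 * Re (\<Sum>n. c n * \<zeta> ^ n)"
  shows "moments c (Re (c 0))"
proof -
  have sg: "summable (\<lambda>n. A * r ^ n)" using r by (intro summable_mult summable_geometric) auto
  define g where "g x = (\<Sum>n. c n * cnj (w x) ^ n)" for x
  have nrm: "cmod (c n * cnj (w x) ^ n) = cmod (c n)" for n x by (simp add: norm_mult norm_power)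
  have sc: "summable (\<lambda>n. cmod (c n))" by (rule summable_comparison_test[OF _ sg]) (use c in auto)
  have int1: "integrable M (\<lambda>x. w x ^ m * (c n * cnj (w x) ^ n))" for m n
    using integrable_monomial[of m n] by (simp add: mult.left_commute)
  have nrm': "norm (w x ^ m * (c n * cnj (w x) ^ n)) = cmod (c n)" for m n x
    by (simp add: norm_mult norm_power)
  have sc': "summable (\<lambda>n. \<integral>x. norm (w x ^ m * (c n * cnj (w x) ^ n)) \<partial>M)" for m
    unfolding nrm' using sc by (simp add: total)
  have AE1: "AE x in M. summable (\<lambda>n. norm (w x ^ m * (c n * cnj (w x) ^ n)))" for m
    unfolding nrm' using sc by simp
  have sg': "summable (\<lambda>n. c n * cnj (w x) ^ n)" for x
    by (rule summable_norm_cancel) (simp add: nrm sc)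
  have wg: "w x ^ m * g x = (\<Sum>n. w x ^ m * (c n * cnj (w x) ^ n))" for x m
    unfolding g_def by (rule suminf_mult[OF sg', symmetric])
  have intg: "integrable M g"
    using integrable_suminf[OF int1 AE1 sc', of 0] by (simp add: g_def[abs_def])
  have mg: "(\<integral>x. w x ^ m * g x \<partial>M) = c m" for m
  proof -
    have "(\<integral>x. w x ^ m * g x \<partial>M) = (\<Sum>n. \<integral>x. w x ^ m * (c n * cnj (w x) ^ n) \<partial>M)"
      unfolding wg by (rule integral_suminf[OF int1 AE1 sc'])
    also have "\<dots> = (\<Sum>n. if n = m then c n else 0)"
      by (intro suminf_cong) (simp add: mult.left_commute[of _ "c _"] orthonormal_monomials)
    also have "\<dots> = c m" using sums_single[of m c] by (simp add: sums_iff)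
    finally show ?thesis .
  qed
  \<comment> \<open>\<open>cnj (g x)\<close> has only nonnegative powers of w, so all its moments of
    positive order vanish and its constant term alone survives.\<close>
  have mcg: "(\<integral>x. w x ^ m * cnj (g x) \<partial>M) = (if m = 0 then cnj (c 0) else 0)" for m
  proof -
    have "w x ^ m * cnj (g x) = (\<Sum>n. cnj (c n) * w x ^ (m + n))" for x
    proof -
      have "cnj (g x) = (\<Sum>n. cnj (c n) * w x ^ n)"
        unfolding g_def using sums_cnj[THEN iffD2, OF summable_sums[OF sg'[of x]]] by (simp add: sums_iff)
      moreover have "summable (\<lambda>n. cnj (c n) * w x ^ n)"
        by (rule summable_norm_cancel) (simp add: norm_mult norm_power sc)
      ultimately show ?thesis by (simp add: suminf_mult[symmetric] power_add mult.left_commute)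
    qed
    then have "(\<integral>x. w x ^ m * cnj (g x) \<partial>M) = (\<integral>x. (\<Sum>n. cnj (c n) * w x ^ (m + n)) \<partial>M)" by simp
    also have "\<dots> = (\<Sum>n. \<integral>x. cnj (c n) * w x ^ (m + n) \<partial>M)"
    proof (rule integral_suminf)
      show "integrable M (\<lambda>x. cnj (c n) * w x ^ (m + n))" for n
        using integrable_monomial[of "m + n" 0] by simp
    qed (use sc in \<open>simp_all add: norm_mult norm_power total\<close>)
    also have "\<dots> = (\<Sum>n. if n = 0 then (if m = 0 then cnj (c 0) else 0) else 0)"
    proof (intro suminf_cong)
      fix n
      show "(\<integral>x. cnj (c n) * w x ^ (m + n) \<partial>M) = (if n = 0 then (if m = 0 then cnj (c 0) else 0) else 0)"
        using orthonormal_monomials[of "m + n" 0] by auto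
    qed
    also have "\<dots> = (if m = 0 then cnj (c 0) else 0)"
      using sums_single[of 0 "\<lambda>_. if m = 0 then cnj (c 0) else 0"] by (simp add: sums_iff)
    finally show ?thesis .
  qed
  \<comment> \<open>The hypothesis \<open>pos\<close>, taken at \<open>cnj (w x)\<close>, says that
    h is nonnegative; its norm is then its integral, the zeroth moment.\<close>
  define h where "h x = 2 * Re (g x) - Re (c 0)" for x
  have h0: "0 \<le> h x" for x using pos[of "cnj (w x)"] by (simp add: h_def g_def)
  have heq: "complex_of_real (h x) = g x + cnj (g x) - c 0" for x
    using c0 by (simp add: h_def complex_eq_iff)
  have inth: "integrable M (\<lambda>x. complex_of_real (h x))" unfolding heq using intg by simp
  have mh: "(\<integral>x. w x ^ m * complex_of_real (h x) \<partial>M) = c m" for m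
  proof -
    have "(\<integral>x. w x ^ m * complex_of_real (h x) \<partial>M)
      = (\<integral>x. w x ^ m * g x + w x ^ m * cnj (g x) - c 0 * (w x ^ m * cnj (w x) ^ 0) \<partial>M)"
      unfolding heq by (simp add: algebra_simps)
    also have "\<dots> = c m + (if m = 0 then cnj (c 0) else 0) - c 0 * (if m = 0 then 1 else 0)"
      using integrable_monomial[of m 0]
      by (simp add: intg integrable_w_mult mg mcg orthonormal_monomials[of m 0, simplified])
    also have "\<dots> = c m" using c0 by (auto simp: complex_eq_iff)
    finally show ?thesis .
  qed
  show ?thesis
  proof (rule momentsI[OF inth _ mh])
    have "complex_of_real (\<integral>x. h x \<partial>M) = c 0" using mh[of 0] by simp
    then have "(\<integral>x. h x \<partial>M) = Re (c 0)" by (metis Re_complex_of_real)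
    then show "(\<integral>x. norm (complex_of_real (h x)) \<partial>M) \<le> Re (c 0)" using h0 by simp
  qed
qed

text \<open>The Abel mean is compared with c itself: the finitely many coefficients below 2^K
  converge as r -> 1, and the others are small in norm uniformly in r by
  \<open>moments_tail\<close>. Hence K is chosen before r.\<close>

lemma moments_Abel:
  assumes c: "\<And>n. cmod (c n) \<le> A / real (Suc n)"
    and r: "\<And>r. 0 < r \<Longrightarrow> r < 1 \<Longrightarrow> moments (\<lambda>n. of_real (r ^ n) * c n) B" and eps: "0 < \<epsilon>"
  shows "moments c (B + \<epsilon>)"
proof -
  define A' where "A' = \<bar>A\<bar> + 1"
  have A': "0 < A'" and cA': "cmod (c n) \<le> A' / real (Suc n)" for n
    using order_trans[OF c[of n] divide_right_mono[of A A' "real (Suc n)"]] by (auto simp: A'_def)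
  have "(\<lambda>K. 4 * A' * (3/4) ^ K) \<longlonglongrightarrow> 4 * A' * 0"
    by (intro tendsto_intros) auto
  then have "\<forall>\<^sub>F K in sequentially. 4 * A' * (3/4) ^ K < \<epsilon> / 2"
    using eps by (intro order_tendstoD) auto
  then obtain K where K: "4 * A' * (3/4) ^ K < \<epsilon> / 2" by (auto simp: eventually_sequentially)
  let ?S = "{n. Suc n < 2 ^ K}"
  have fin: "finite ?S" by (rule finite_subset[of _ "{..<2 ^ K}"]) auto
  have "((\<lambda>r::real. \<Sum>n\<in>?S. cmod (of_real (1 - r ^ n) * c n)) \<longlongrightarrow> (\<Sum>n\<in>?S. cmod (of_real (1 - 1 ^ n) * c n)))
      (at_left 1)"
    by (intro tendsto_intros)
  then have "\<forall>\<^sub>F r in at_left (1::real). (\<Sum>n\<in>?S. cmod (of_real (1 - r ^ n) * c n)) < \<epsilon> / 2"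
    using eps by (intro order_tendstoD) auto
  moreover have "\<forall>\<^sub>F r in at_left (1::real). r \<in> {0<..<1}"
    by (rule eventually_at_leftI[of 0]) auto
  ultimately have "\<forall>\<^sub>F r in at_left (1::real). (\<Sum>n\<in>?S. cmod (of_real (1 - r ^ n) * c n)) < \<epsilon> / 2 \<and> r \<in> {0<..<1}"
    by eventually_elim simp
  then obtain r :: real where r': "(\<Sum>n\<in>?S. cmod (of_real (1 - r ^ n) * c n)) < \<epsilon> / 2" "0 < r" "r < 1"
    using eventually_happens'[OF trivial_limit_at_left_real] by fastforce
  have "cmod (of_real (1 - r ^ n) * c n) \<le> A' / real (Suc n)" for n
  proof -
    have "\<bar>1 - r ^ n\<bar> \<le> 1" using r' power_le_one[of r n] by simp
    then have "cmod (of_real (1 - r ^ n) * c n) \<le> 1 * cmod (c n)"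
      unfolding norm_mult norm_of_real by (intro mult_right_mono) auto
    with cA'[of n] show ?thesis by linarith
  qed
  from moments_add[OF moments_add[OF r[OF r'(2,3)] moments_finite[OF fin, of "\<lambda>n. of_real (1 - r ^ n) * c n"]]
      moments_tail[OF this A', of K]]
  have "moments c (B + (\<Sum>n\<in>?S. cmod (of_real (1 - r ^ n) * c n)) + 4 * A' * (3/4) ^ K)"
    by (rule arg_cong2[where f = moments, THEN iffD1, rotated 2])
      (auto simp: algebra_simps fun_eq_iff)
  then show ?thesis by (rule moments_mono) (use K r' in linarith)
qed

text \<open>c itself has no decay, but its approximants d do. Those for epsilon = 2^-k have
  differences to which \<open>moments_Abel\<close> applies; they are summable in norm, and c is d 0
  plus their telescoping sum.\<close>

lemma moments_approximable:
  assumes approx: "\<And>\<epsilon>. 0 < \<epsilon> \<Longrightarrow> \<exists>d A. (\<forall>n. cmod (d n) \<le> A / real (Suc n)) \<and>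
      (\<forall>r. 0 < r \<longrightarrow> r < 1 \<longrightarrow> moments (\<lambda>n. of_real (r ^ n) * (c n - d n)) \<epsilon>)"
  shows "\<exists>B. moments c B"
proof -
  have "\<forall>k. \<exists>d A. (\<forall>n. cmod (d n) \<le> A / real (Suc n)) \<and>
      (\<forall>r. 0 < r \<longrightarrow> r < 1 \<longrightarrow> moments (\<lambda>n. of_real (r ^ n) * (c n - d n)) ((1/2) ^ k))"
    using approx by simp
  then obtain d A where d: "\<And>k n. cmod (d k n) \<le> A k / real (Suc n)"
    and e: "\<And>k r. 0 < r \<Longrightarrow> r < 1 \<Longrightarrow> moments (\<lambda>n. of_real (r ^ n) * (c n - d k n)) ((1/2) ^ k)"
    by metis
  have lim: "cmod (c n - d k n) \<le> (1/2) ^ k" for k n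
  proof -
    have "((\<lambda>r::real. cmod (of_real (r ^ n) * (c n - d k n))) \<longlongrightarrow> cmod (of_real (1 ^ n) * (c n - d k n))) (at_left 1)"
      by (intro tendsto_intros)
    moreover have "\<forall>\<^sub>F r in at_left (1::real). cmod (of_real (r ^ n) * (c n - d k n)) \<le> (1/2) ^ k"
      by (rule eventually_at_leftI[of 0]) (use moments_coeff_bound[OF e] in auto)
    ultimately show ?thesis using tendsto_upperbound[OF _ _ trivial_limit_at_left_real] by fastforce
  qed
  \<comment> \<open>The Abel means of the difference are bounded by 2^-k + 2^-(k+1), at most 2 *
    2^-k, and passing to r = 1 costs another 2^-k.\<close>
  have step: "moments (\<lambda>n. d (Suc k) n - d k n) (3 * (1/2) ^ k)" for k
  proof (rule moments_mono[OF moments_Abel[where A = "A (Suc k) + A k" and B = "2 * (1/2) ^ k" and \<epsilon> = "(1/2) ^ k"]])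
    show "cmod (d (Suc k) n - d k n) \<le> (A (Suc k) + A k) / real (Suc n)" for n
      using norm_triangle_ineq4[of "d (Suc k) n" "d k n"] d[of "Suc k" n] d[of k n]
      by (simp add: add_divide_distrib)
    fix r :: real assume r: "0 < r" "r < 1"
    have "moments (\<lambda>n. of_real (r ^ n) * (c n - d k n) + (-1) * (of_real (r ^ n) * (c n - d (Suc k) n)))
       ((1/2) ^ k + cmod (-1) * (1/2) ^ Suc k)"
      by (intro moments_add moments_cmult e r)
    then have "moments (\<lambda>n. of_real (r ^ n) * (d (Suc k) n - d k n)) ((1/2) ^ k + cmod (-1) * (1/2) ^ Suc k)"
      by (simp add: algebra_simps)
    then show "moments (\<lambda>n. of_real (r ^ n) * (d (Suc k) n - d k n)) (2 * (1/2) ^ k)"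
      by (rule moments_mono) simp
  qed auto
  have "summable (\<lambda>k. 3 * (1/2 :: real) ^ k)" by (intro summable_mult summable_geometric) auto
  from moments_suminf[OF step this] have
    tele: "moments (\<lambda>n. \<Sum>k. d (Suc k) n - d k n) (\<Sum>k. 3 * (1/2) ^ k)" .
  have "(\<Sum>k. d (Suc k) n - d k n) = c n - d 0 n" for n
  proof -
    have "(\<lambda>k. d k n - c n) \<longlonglongrightarrow> 0"
      by (rule Lim_null_comparison[of _ "\<lambda>k. (1/2) ^ k"])
        (auto intro!: always_eventually lim simp: norm_minus_commute LIMSEQ_power_zero)
    then have "(\<lambda>k. d k n) \<longlonglongrightarrow> c n" by (rule LIM_zero_cancel)
    from telescope_sums[OF this] show ?thesis by (simp add: sums_iff)
  qed
  with tele have *: "moments (\<lambda>n. c n - d 0 n) (\<Sum>k. 3 * (1/2) ^ k)" by simp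
  define A0 where "A0 = \<bar>A 0\<bar> + 1"
  have "cmod (d 0 n) \<le> A0 / real (Suc n)" "0 < A0" for n
    using order_trans[OF d[of 0 n] divide_right_mono[of "A 0" A0 "real (Suc n)"]] by (auto simp: A0_def)
  from moments_tail[OF this, of 0] have "moments (d 0) (4 * A0)" by simp
  from moments_add[OF * this] show ?thesis by auto
qed

text \<open>Multiplying the density by the k-th power of \<open>cnj w\<close> shifts its moments up.
  The first k of the new moments were of negative order and are removed by a trigonometric
  polynomial.\<close>

lemma moments_shift:
  assumes "moments c B"
  shows "\<exists>B'. moments (\<lambda>n. if n < k then 0 else c (n - k)) B'"
proof -
  obtain \<eta> where \<eta>: "integrable M \<eta>" "\<And>n. (\<integral>x. w x ^ n * \<eta> x \<partial>M) = c n"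
    using assms(1) by (auto simp: moments_def)
  let ?\<theta> = "\<lambda>x. cnj (w x) ^ k * \<eta> x"
  define v where "v n = (\<integral>x. w x ^ n * ?\<theta> x \<partial>M)" for n
  have v: "v n = c (n - k)" if "k \<le> n" for n
  proof -
    have "w x ^ n * ?\<theta> x = w x ^ (n - k) * \<eta> x" for x
    proof -
      have "w x ^ n * cnj (w x) ^ k = w x ^ (n - k) * (w x * cnj (w x)) ^ k"
        using that by (simp add: power_mult_distrib power_add[symmetric] flip: mult.assoc)
      then show ?thesis by (simp add: w_cnj mult.assoc[symmetric])
    qed
    then show ?thesis by (simp only: v_def \<eta>)
  qed
  have "moments v (\<integral>x. norm (?\<theta> x) \<partial>M)"
    by (rule momentsI[of ?\<theta>]) (simp_all add: integrable_w_mult \<eta> v_def)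
  moreover have "moments (\<lambda>n. if n \<in> {..<k} then - v n else 0) (\<Sum>n<k. cmod (- v n))"
    by (rule moments_finite) simp
  ultimately have "moments (\<lambda>n. v n + (if n \<in> {..<k} then - v n else 0))
      ((\<integral>x. norm (?\<theta> x) \<partial>M) + (\<Sum>n<k. cmod (- v n)))"
    by (rule moments_add)
  moreover have "v n + (if n \<in> {..<k} then - v n else 0) = (if n < k then 0 else c (n - k))" for n
    by (auto simp: v)
  ultimately show ?thesis by auto
qed

end

section \<open>Positive operators and their square roots\<close>

lemma neumann_series:
  fixes D :: "'a::complex_hilbert cop"
  assumes D: "norm D < 1"
  shows summable_neumann: "summable (\<lambda>k. D ^ k)"
    and neumann_left: "(\<Sum>k. D ^ k) * (1 - D) = 1"
    and neumann_right: "(1 - D) * (\<Sum>k. D ^ k) = 1"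
proof -
  show s: "summable (\<lambda>k. D ^ k)"
    by (rule summable_comparison_test[OF _ summable_geometric[of "norm D"]])
      (use D in \<open>auto intro: norm_power_cop\<close>)
  have lim: "(\<lambda>n. 1 - D ^ n) \<longlonglongrightarrow> 1 - 0"
    by (intro tendsto_intros summable_LIMSEQ_zero s)
  have "D ^ n * (1 - D) = D ^ n - D * D ^ n" for n
    by (simp add: right_diff_distrib power_commutes)
  then have "(\<Sum>k<n. D ^ k) * (1 - D) = 1 - D ^ n" for n
    by (induction n) (simp_all add: distrib_right)
  moreover have "(\<lambda>n. (\<Sum>k<n. D ^ k) * (1 - D)) \<longlonglongrightarrow> (\<Sum>k. D ^ k) * (1 - D)"
    by (intro tendsto_intros summable_LIMSEQ s)
  ultimately show "(\<Sum>k. D ^ k) * (1 - D) = 1"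
    using LIMSEQ_unique[OF _ lim] by simp
  have "(1 - D) * D ^ n = D ^ n - D * D ^ n" for n
    by (simp add: left_diff_distrib)
  then have "(1 - D) * (\<Sum>k<n. D ^ k) = 1 - D ^ n" for n
    by (induction n) (simp_all add: distrib_left)
  moreover have "(\<lambda>n. (1 - D) * (\<Sum>k<n. D ^ k)) \<longlonglongrightarrow> (1 - D) * (\<Sum>k. D ^ k)"
    by (intro tendsto_intros summable_LIMSEQ s)
  ultimately show "(1 - D) * (\<Sum>k. D ^ k) = 1"
    using LIMSEQ_unique[OF _ lim] by simp
qed

definition pos :: "'a::complex_hilbert cop \<Rightarrow> bool" where
  "pos P \<longleftrightarrow> (\<forall>x. cinner x (P \<cdot> x) \<in> \<real>\<^sub>\<ge>\<^sub>0)"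

lemma posD: "pos P \<Longrightarrow> 0 \<le> Re (cinner x (P \<cdot> x))" "pos P \<Longrightarrow> Im (cinner x (P \<cdot> x)) = 0"
  by (auto simp: pos_def complex_nonneg_Reals_iff)

lemma posI: "(\<And>x. 0 \<le> Re (cinner x (P \<cdot> x))) \<Longrightarrow> adj P = P \<Longrightarrow> pos P"
proof -
  assume P: "\<And>x. 0 \<le> Re (cinner x (P \<cdot> x))" and a: "adj P = P"
  have "cinner x (P \<cdot> x) = cnj (cinner x (P \<cdot> x))" for x
    by (metis a cinner_adj_left cinner_commute)
  then have "Im (cinner x (P \<cdot> x)) = 0" for x
    by (metis Reals_cnj_iff complex_is_Real_iff)
  with P show ?thesis by (auto simp: pos_def complex_nonneg_Reals_iff)
qed

text \<open>Polarization with x + y and x + i y, hence a fact of complex scalars.\<close>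

lemma quadratic_form_zero:
  assumes "\<And>x. cinner x (D \<cdot> x) = 0"
  shows "D = 0"
proof (rule cop_eqI, rule cinner_ext_right)
  fix x y
  have "cinner (x + y) (D \<cdot> (x + y)) = 0" "cinner (x + \<i> *\<^sub>C y) (D \<cdot> (x + \<i> *\<^sub>C y)) = 0"
    using assms by blast+
  then have a: "cinner x (D \<cdot> y) + cinner y (D \<cdot> x) = 0"
    and "\<i> * cinner x (D \<cdot> y) - \<i> * cinner y (D \<cdot> x) = 0"
    by (simp_all add: app_add_right cinner_add_left cinner_add_right app_scaleC cinner_scaleC_left
        cinner_scaleC_right assms)
  then have "\<i> * (cinner x (D \<cdot> y) - cinner y (D \<cdot> x)) = 0" by (simp only: right_diff_distrib)
  then have "cinner x (D \<cdot> y) = cinner y (D \<cdot> x)" by simp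
  with a show "cinner y (D \<cdot> x) = cinner y (0 \<cdot> x)" by simp
qed

lemma pos_adj: "pos P \<Longrightarrow> adj P = P"
proof -
  assume P: "pos P"
  have "cinner x ((P - adj P) \<cdot> x) = 0" for x
  proof -
    have "cinner x (adj P \<cdot> x) = cnj (cinner x (P \<cdot> x))"
      by (metis cinner_adj_right cinner_commute)
    also have "\<dots> = cinner x (P \<cdot> x)" using posD(2)[OF P, of x] by (simp add: complex_eq_iff)
    finally show ?thesis by (simp add: app_diff_left cinner_diff_right)
  qed
  from quadratic_form_zero[OF this] show ?thesis by simp
qed

lemma pos_cauchy_schwarz:
  assumes P: "pos P"
  shows "(cmod (cinner x (P \<cdot> y)))\<^sup>2 \<le> Re (cinner x (P \<cdot> x)) * Re (cinner y (P \<cdot> y))"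
proof -
  define a b \<beta> m where "a = Re (cinner x (P \<cdot> x))" and "b = Re (cinner y (P \<cdot> y))"
    and "\<beta> = cinner x (P \<cdot> y)" and "m = (cmod \<beta>)\<^sup>2"
  have quad: "0 \<le> a - 2 * s * m + s\<^sup>2 * m * b" for s :: real
  proof -
    \<comment> \<open>The phase of c makes both cross terms of the form at x + c y real, which
      leaves a real quadratic polynomial in s.\<close>
    define c where "c = - of_real s * cnj \<beta>"
    have yx: "cinner y (P \<cdot> x) = cnj \<beta>"
      unfolding \<beta>_def by (metis P cinner_adj_left cinner_commute pos_adj)
    have bb: "of_real m = \<beta> * cnj \<beta>" by (simp add: m_def complex_norm_square del: of_real_power)
    have cb: "c * \<beta> = of_real (- s * m)" "cnj c * cnj \<beta> = of_real (- s * m)"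
      "cnj c * c = of_real (s\<^sup>2 * m)"
      by (simp_all add: c_def bb mult_ac power2_eq_square)
    have "cinner (x + c *\<^sub>C y) (P \<cdot> (x + c *\<^sub>C y))
      = cinner x (P \<cdot> x) + c * \<beta> + cnj c * cnj \<beta> + cnj c * c * cinner y (P \<cdot> y)"
      by (simp add: app_add_right cinner_add_left cinner_add_right app_scaleC cinner_scaleC_left
          cinner_scaleC_right yx \<beta>_def algebra_simps)
    then have "cinner (x + c *\<^sub>C y) (P \<cdot> (x + c *\<^sub>C y))
      = cinner x (P \<cdot> x) + of_real (- s * m) + of_real (- s * m) + of_real (s\<^sup>2 * m) * cinner y (P \<cdot> y)"
      unfolding cb .
    then have "Re (cinner (x + c *\<^sub>C y) (P \<cdot> (x + c *\<^sub>C y))) = a - 2 * s * m + s\<^sup>2 * m * b"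
      by (simp add: a_def b_def del: of_real_mult of_real_power of_real_minus)
    with posD(1)[OF P] show ?thesis by metis
  qed
  have b: "0 \<le> b" using posD(1)[OF P] by (simp add: b_def)
  have m: "0 \<le> m" by (simp add: m_def)
  have "m \<le> a * b"
  proof (cases "b = 0")
    case True
    show ?thesis
    proof (rule ccontr)
      assume "\<not> m \<le> a * b"
      with True m have "0 < m" by simp
      \<comment> \<open>With b = 0 the polynomial is linear in s; at this s it takes the value
        -1.\<close>
      with quad[of "(a + 1) / (2 * m)"] True show False by simp
    qed
  next
    case False
    with b have "0 < b" by simp
    with quad[of "1 / b"] show ?thesis by (simp add: field_simps power2_eq_square)
  qed
  then show ?thesis by (simp add: a_def b_def m_def \<beta>_def)
qed

lemma pos_kernel:
  assumes "pos P" "cinner y (P \<cdot> y) = 0"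
  shows "P \<cdot> y = 0"
  using pos_cauchy_schwarz[OF assms(1), of "P \<cdot> y" y] assms(2) by simp

text \<open>Cauchy-Schwarz for the form of P at P x and x bounds |P x|^4 by <P x, P P x> <x, P x>,
  and both factors are bounded by q.\<close>

lemma pos_norm_le:
  assumes P: "pos P" and q: "\<And>x. Re (cinner x (P \<cdot> x)) \<le> q * (norm x)\<^sup>2" and q0: "0 \<le> q"
  shows "norm P \<le> q"
proof (rule norm_copI[OF _ q0])
  fix x
  let ?n = "norm (P \<cdot> x)"
  have e: "cmod (cinner (P \<cdot> x) (P \<cdot> x)) = ?n\<^sup>2" by (simp add: cinner_norm norm_power)
  have "(cmod (cinner (P \<cdot> x) (P \<cdot> x)))\<^sup>2 \<le> (q * ?n\<^sup>2) * (q * (norm x)\<^sup>2)"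
    using q0 by (intro order_trans[OF pos_cauchy_schwarz[OF P]] mult_mono q posD(1)[OF P]) auto
  then have "?n\<^sup>2 * ?n\<^sup>2 \<le> ?n\<^sup>2 * (q * norm x)\<^sup>2"
    unfolding e by (simp add: power2_eq_square mult_ac)
  then show "?n \<le> q * norm x"
  proof (cases "?n = 0")
    case False
    then have "0 < ?n\<^sup>2" by simp
    with \<open>?n\<^sup>2 * ?n\<^sup>2 \<le> ?n\<^sup>2 * (q * norm x)\<^sup>2\<close> have "?n\<^sup>2 \<le> (q * norm x)\<^sup>2"
      by (rule mult_left_le_imp_le)
    then show ?thesis by (rule power2_le_imp_le) (use q0 in simp)
  qed (use q0 in simp)
qed

text \<open>Polynomials in \<open>D\<close> with nonnegative coefficients, together with their value at \<open>1\<close>,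
  which dominates the norm when \<open>D\<close> is a contraction.\<close>

inductive nnpoly :: "'a::complex_hilbert cop \<Rightarrow> 'a cop \<Rightarrow> real \<Rightarrow> bool" for D where
  nnpoly_zero: "nnpoly D 0 0"
| nnpoly_base: "nnpoly D D 1"
| nnpoly_add: "nnpoly D A a \<Longrightarrow> nnpoly D B b \<Longrightarrow> nnpoly D (A + B) (a + b)"
| nnpoly_mult: "nnpoly D A a \<Longrightarrow> nnpoly D B b \<Longrightarrow> nnpoly D (A * B) (a * b)"
| nnpoly_scale: "nnpoly D A a \<Longrightarrow> 0 \<le> r \<Longrightarrow> nnpoly D (r *\<^sub>R A) (r * a)"

lemma nnpoly_norm: "nnpoly D A a \<Longrightarrow> norm D \<le> 1 \<Longrightarrow> norm A \<le> a"
proof (induction rule: nnpoly.induct)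
  case (nnpoly_mult A a B b)
  then have "norm A \<le> a" "norm B \<le> b" by auto
  moreover from this have "0 \<le> a" using norm_ge_zero[of A] by linarith
  ultimately have "norm A * norm B \<le> a * b" by (intro mult_mono) auto
  with norm_mult_ineq[of A B] show ?case by linarith
qed (auto intro: norm_triangle_mono mult_left_mono)

lemma nnpoly_commute: "nnpoly D A a \<Longrightarrow> B * D = D * B \<Longrightarrow> B * A = A * B"
proof (induction rule: nnpoly.induct)
  case (nnpoly_mult A a C c)
  then show ?case by (metis mult.assoc)
qed (simp_all add: distrib_left distrib_right)

lemma nnpoly_commute2: "nnpoly D A a \<Longrightarrow> nnpoly D B b \<Longrightarrow> A * B = B * A"
  by (metis nnpoly_commute)

lemma adj_scaleR: "adj (r *\<^sub>R A) = r *\<^sub>R adj A"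
  using adj_csc[of "of_real r" A] by (simp add: csc_of_real)

lemma nnpoly_adj: "nnpoly D A a \<Longrightarrow> adj D = D \<Longrightarrow> adj A = A"
proof (induction rule: nnpoly.induct)
  case (nnpoly_mult A a B b)
  then show ?case using nnpoly_commute2[of D A a B b] by (simp add: adj_mult)
qed (simp_all add: adj_add adj_scaleR)

lemma bounded_linear_adj: "bounded_linear adj"
  by (rule bounded_linear_intro[where K = 1]) (simp_all add: adj_add adj_scaleR)

text \<open>A limit L of the iteration Y -> (D + Y^2) / 2 with D = 1 - T satisfies (1 - L)^2 = T.
  The scalar iteration y at D = 1 increases and stays below 1. As the increments of Y are
  polynomials in the contraction D with nonnegative coefficients, those of y dominate their
  norms.\<close>

theorem square_root_exists_contraction:
  fixes T :: "'a::complex_hilbert cop"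
  assumes T: "pos T" and T1: "\<And>x. Re (cinner x (T \<cdot> x)) \<le> (norm x)\<^sup>2"
  shows "\<exists>Q. pos Q \<and> Q * Q = T \<and> (\<forall>B. B * T = T * B \<longrightarrow> B * Q = Q * B)"
proof -
  define D where "D = 1 - T"
  have adjD: "adj D = D" by (simp add: D_def adj_diff pos_adj[OF T])
  have formD: "Re (cinner x (D \<cdot> x)) = (norm x)\<^sup>2 - Re (cinner x (T \<cdot> x))" for x
    by (simp add: D_def app_diff_left cinner_diff_right norm_sq_eq_cinner)
  have posD': "pos D" by (rule posI) (simp_all add: adjD formD T1)
  have D1: "norm D \<le> 1" by (rule pos_norm_le[OF posD']) (simp_all add: formD posD[OF T])
  define Y where "Y = rec_nat 0 (\<lambda>_ Z. (1/2) *\<^sub>R (D + Z * Z))"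
  define y where "y = rec_nat 0 (\<lambda>_ z::real. (1/2) * (1 + z * z))"
  have Y0: "Y 0 = 0" and YS: "Y (Suc n) = (1/2) *\<^sub>R (D + Y n * Y n)" for n by (simp_all add: Y_def)
  have y0: "y 0 = 0" and yS: "y (Suc n) = (1/2) * (1 + y n * y n)" for n by (simp_all add: y_def)
  have Yn: "nnpoly D (Y n) (y n)" for n
    by (induction n) (simp_all only: Y0 y0 YS yS nnpoly.intros zero_le_divide_1_iff zero_le_numeral)
  \<comment> \<open>Successive increments are half the difference of two squares; all iterates
    commute, so this factors into an earlier increment and a sum of iterates, both with nonnegative
    coefficients.\<close>
  have inc: "nnpoly D (Y (Suc n) - Y n) (y (Suc n) - y n)" for n
  proof (induction n)
    case 0
    show ?case using nnpoly_scale[OF nnpoly_base, of "1/2" D] by (simp add: Y0 y0 YS yS)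
  next
    case (Suc n)
    have p: "nnpoly D ((1/2) *\<^sub>R ((Y (Suc n) - Y n) * (Y (Suc n) + Y n)))
        ((1/2) * ((y (Suc n) - y n) * (y (Suc n) + y n)))"
      by (intro nnpoly_scale nnpoly_mult nnpoly_add Suc Yn) simp
    have "(Y (Suc n) - Y n) * (Y (Suc n) + Y n) = Y (Suc n) * Y (Suc n) - Y n * Y n"
      using nnpoly_commute2[OF Yn[of "Suc n"] Yn[of n]] by (simp add: algebra_simps)
    then have e1: "(1/2) *\<^sub>R ((Y (Suc n) - Y n) * (Y (Suc n) + Y n)) = Y (Suc (Suc n)) - Y (Suc n)"
      by (simp only: YS[of "Suc n"] YS[of n] scaleR_diff_right[symmetric]) simp
    have e2: "(1/2) * ((y (Suc n) - y n) * (y (Suc n) + y n)) = y (Suc (Suc n)) - y (Suc n)"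
      unfolding yS[of "Suc n"] yS[of n] by algebra
    show ?case using p unfolding e1 e2 .
  qed
  have step: "norm (Y (Suc n) - Y n) \<le> y (Suc n) - y n" for n by (rule nnpoly_norm[OF inc D1])
  then have "y n \<le> y (Suc n)" for n using norm_ge_zero order_trans by (metis diff_ge_0_iff_ge)
  then have incy: "incseq y" by (rule incseq_SucI)
  have y01: "0 \<le> y n \<and> y n \<le> 1" for n
  proof (induction n)
    case (Suc n)
    then have "y n * y n \<le> 1" by (intro mult_le_one) auto
    with Suc show ?case by (simp add: yS)
  qed (simp add: y0)
  then have "convergent y"
    using incseq_convergent[OF incy, of 1] unfolding convergent_def by metis
  then have "summable (\<lambda>n. y (Suc n) - y n)"
    by (metis convergent_def telescope_sums sums_summable)
  then have "summable (\<lambda>n. Y (Suc n) - Y n)"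
    by (rule summable_comparison_test[rotated]) (use step in auto)
  then obtain L where L: "Y \<longlonglongrightarrow> L"
  proof -
    assume s: "summable (\<lambda>n. Y (Suc n) - Y n)"
    have "(\<Sum>k<n. Y (Suc k) - Y k) = Y n" for n by (induction n) (simp_all add: Y0)
    then have "Y \<longlonglongrightarrow> (\<Sum>n. Y (Suc n) - Y n)" using summable_LIMSEQ[OF s] by simp
    with that show ?thesis by blast
  qed
  have "(\<lambda>n. (1/2) *\<^sub>R (D + Y n * Y n)) \<longlonglongrightarrow> (1/2) *\<^sub>R (D + L * L)" by (intro tendsto_intros L)
  moreover have "(\<lambda>n. (1/2) *\<^sub>R (D + Y n * Y n)) \<longlonglongrightarrow> L"
    using LIMSEQ_Suc[OF L] by (simp add: YS)
  ultimately have "L = (1/2) *\<^sub>R (D + L * L)" using LIMSEQ_unique by blast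
  then have "2 *\<^sub>R L = 2 *\<^sub>R ((1/2) *\<^sub>R (D + L * L))" by simp
  then have L2: "L + L = D + L * L" by (simp add: scaleR_2)
  have "adj (Y n) = Y n" for n by (rule nnpoly_adj[OF Yn adjD])
  then have "Y \<longlonglongrightarrow> adj L" using bounded_linear.tendsto[OF bounded_linear_adj L] by simp
  then have adjL: "adj L = L" by (rule LIMSEQ_unique[OF _ L])
  have "norm L \<le> 1"
    by (rule LIMSEQ_le_const2[OF tendsto_norm[OF L]])
      (use order_trans[OF nnpoly_norm[OF Yn D1]] y01 in blast)
  have comL: "B * L = L * B" if B: "B * T = T * B" for B
  proof -
    have "B * D = D * B" using B by (simp add: D_def algebra_simps)
    then have eq: "B * Y n = Y n * B" for n by (rule nnpoly_commute[OF Yn])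
    have "(\<lambda>n. B * Y n) \<longlonglongrightarrow> B * L" "(\<lambda>n. Y n * B) \<longlonglongrightarrow> L * B" by (intro tendsto_intros L)+
    then show ?thesis unfolding eq by (rule LIMSEQ_unique)
  qed
  define Q where "Q = 1 - L"
  have "Q * Q = T"
  proof -
    have "Q * Q = 1 - (L + L) + L * L" by (simp add: Q_def algebra_simps)
    then show ?thesis unfolding L2 by (simp add: D_def)
  qed
  moreover have "pos Q"
  proof (rule posI)
    fix x
    have "cmod (cinner x (L \<cdot> x)) \<le> norm x * norm (L \<cdot> x)" by (rule cinner_cauchy_schwarz)
    also have "\<dots> \<le> norm x * norm x" by (intro mult_left_mono norm_app_contraction \<open>norm L \<le> 1\<close>) simp
    finally have "Re (cinner x (L \<cdot> x)) \<le> (norm x)\<^sup>2"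
      using complex_Re_le_cmod[of "cinner x (L \<cdot> x)"] by (simp add: power2_eq_square)
    then show "0 \<le> Re (cinner x (Q \<cdot> x))"
      by (simp add: Q_def app_diff_left cinner_diff_right norm_sq_eq_cinner)
  qed (simp add: Q_def adj_diff adjL)
  moreover have "B * Q = Q * B" if "B * T = T * B" for B
    using comL[OF that] by (simp add: Q_def algebra_simps)
  ultimately show ?thesis by blast
qed

lemma pos_scaleR: "pos P \<Longrightarrow> 0 \<le> r \<Longrightarrow> pos (r *\<^sub>R P)"
  by (auto simp: pos_def complex_nonneg_Reals_iff app_csc cinner_scaleC_right simp flip: csc_of_real)

theorem square_root_exists:
  fixes T :: "'a::complex_hilbert cop"
  assumes T: "pos T"
  shows "\<exists>Q. pos Q \<and> Q * Q = T \<and> (\<forall>B. B * T = T * B \<longrightarrow> B * Q = Q * B)"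
proof -
  define k where "k = norm T + 1"
  have k: "0 < k" using norm_ge_zero[of T] unfolding k_def by linarith
  have "pos ((1/k) *\<^sub>R T)" using T k by (intro pos_scaleR) auto
  moreover have "Re (cinner x ((1/k) *\<^sub>R T \<cdot> x)) \<le> (norm x)\<^sup>2" for x
  proof -
    have "Re (cinner x (T \<cdot> x)) \<le> norm x * norm (T \<cdot> x)"
      using complex_Re_le_cmod cinner_cauchy_schwarz order_trans by blast
    also have "norm x * norm (T \<cdot> x) \<le> norm x * (k * norm x)"
    proof (rule mult_left_mono)
      show "norm (T \<cdot> x) \<le> k * norm x"
        using norm_app[of T x] norm_ge_zero[of x] unfolding k_def distrib_right by linarith
    qed simp
    finally have "Re (cinner x (T \<cdot> x)) \<le> k * (norm x)\<^sup>2" by (simp add: power2_eq_square mult_ac)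
    then show ?thesis
      using k by (simp add: app_csc cinner_scaleC_right pos_divide_le_eq mult.commute flip: csc_of_real)
  qed
  ultimately obtain Q where Q: "pos Q" "Q * Q = (1/k) *\<^sub>R T"
    "\<And>B. B * ((1/k) *\<^sub>R T) = ((1/k) *\<^sub>R T) * B \<Longrightarrow> B * Q = Q * B"
    using square_root_exists_contraction by blast
  have "pos (sqrt k *\<^sub>R Q)" using Q(1) k by (intro pos_scaleR) auto
  moreover have "(sqrt k *\<^sub>R Q) * (sqrt k *\<^sub>R Q) = T"
    using k by (simp add: Q(2))
  moreover have "B * (sqrt k *\<^sub>R Q) = (sqrt k *\<^sub>R Q) * B" if "B * T = T * B" for B
    using Q(3)[of B] that by simp
  ultimately show ?thesis by blast
qed

text \<open>Another root P commutes with T = P P and hence with Q. For y = (P - Q) x this gives (P +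
  Q) y = 0, so both nonnegative forms vanish at y, P y = Q y = 0, and |y|^2 = <x, (P - Q) y> =
  0.\<close>

theorem square_root_unique:
  assumes T: "pos T"
  shows "\<exists>!Q. pos Q \<and> Q * Q = T"
proof -
  obtain Q where Q: "pos Q" "Q * Q = T" "\<And>B. B * T = T * B \<Longrightarrow> B * Q = Q * B"
    using square_root_exists[OF T] by blast
  have "P = Q" if P: "pos P" "P * P = T" for P
  proof -
    have "P * T = T * P" unfolding P(2)[symmetric] by (rule mult.assoc[symmetric])
    then have com: "P * Q = Q * P" by (rule Q(3))
    have "(P - Q) \<cdot> x = 0" for x
    proof -
      define y where "y = (P - Q) \<cdot> x"
      have "(P + Q) * (P - Q) = 0" using com P(2) Q(2) by (simp add: algebra_simps)
      then have "P \<cdot> y + Q \<cdot> y = 0"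
        by (metis app_add_left app_times app_zero_left y_def)
      then have "cinner y (P \<cdot> y) + cinner y (Q \<cdot> y) = 0"
        by (metis cinner_add_right cinner_zero_right)
      then have "cinner y (P \<cdot> y) = 0" "cinner y (Q \<cdot> y) = 0"
        using posD[OF P(1), of y] posD[OF Q(1), of y] by (auto simp: complex_eq_iff)
      then have "P \<cdot> y = 0" "Q \<cdot> y = 0" using pos_kernel P(1) Q(1) by blast+
      then have "(P - Q) \<cdot> y = 0" by (simp add: app_diff_left)
      then have "cinner x ((P - Q) \<cdot> y) = 0" by simp
      then have "cinner (adj (P - Q) \<cdot> x) y = 0" by (simp add: cinner_adj_left)
      then have "cinner y y = 0" by (simp add: adj_diff pos_adj P(1) Q(1) y_def)
      then show ?thesis by (simp add: y_def)
    qed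
    then have "P - Q = 0" by (intro cop_eqI) simp
    then show ?thesis by simp
  qed
  with Q show ?thesis by blast
qed

section \<open>Trace class operators\<close>

lemma pos_adj_mult_self: "pos (adj A * A)"
  by (rule posI) (simp_all add: app_times cinner_adj_right cinner_norm adj_mult)

lemma adjoint_blin: "adjoint_blinfun (blin A) = blin (adj A)"
  unfolding adjoint_blinfun_def
proof (rule the_equality)
  show "\<forall>x y. cinner (blinfun_apply (blin (adj A)) x) y = cinner x (blinfun_apply (blin A) y)"
    by (simp add: cinner_adj_left flip: app.rep_eq)
  fix B assume B: "\<forall>x y. cinner (blinfun_apply B x) y = cinner x (blinfun_apply (blin A) y)"
  show "B = blin (adj A)"
    by (intro blinfun_eqI cinner_ext_left) (simp add: B cinner_adj_left flip: app.rep_eq)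
qed

lemma complex_linear_blin [simp]: "complex_linear (blin A)"
  using blin[of A] by simp

lemma positive_blin_iff: "positive_blinfun (blin P) \<longleftrightarrow> pos P"
  by (simp add: positive_blinfun_def pos_def flip: app.rep_eq)

text \<open>Uniqueness of the positive root is what gives the description in
  \<open>abs_blinfun\<close> a meaning.\<close>

lemma abs_blin:
  obtains P where "pos P" "P * P = adj A * A" "abs_blinfun (blin A) = blin P"
proof -
  obtain P where P: "pos P" "P * P = adj A * A"
    and uniq: "\<And>Q. pos Q \<Longrightarrow> Q * Q = adj A * A \<Longrightarrow> Q = P"
    using square_root_unique[OF pos_adj_mult_self[of A]] by blast
  have "abs_blinfun (blin A) = blin P"
    unfolding abs_blinfun_def
  proof (rule the_equality)
    show "positive_blinfun (blin P) \<and> blin P o\<^sub>L blin P = adjoint_blinfun (blin A) o\<^sub>L blin A"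
      using P by (simp add: positive_blin_iff adjoint_blin flip: times_cop.rep_eq)
    fix Q assume Q: "positive_blinfun Q \<and> Q o\<^sub>L Q = adjoint_blinfun (blin A) o\<^sub>L blin A"
    then have "complex_linear Q" by (simp add: positive_blinfun_def)
    then have Q': "Q = blin (Cop Q)" by (simp add: Cop_inverse)
    have "Cop Q = P"
    proof (rule uniq)
      show "pos (Cop Q)" using Q Q' positive_blin_iff by metis
      have "blin (Cop Q * Cop Q) = blin (adj A * A)"
        using Q by (simp add: times_cop.rep_eq adjoint_blin flip: Q')
      then show "Cop Q * Cop Q = adj A * A" by (simp add: blin_inject)
    qed
    with Q' show "Q = blin P" by simp
  qed
  with P that show ?thesis by blast
qed

context onb
begin

text \<open>The contractions \<open>A (\<bar>A\<bar> + \<epsilon>)\<^sup>-\<^sup>1\<close> replace the partial isometry of the polar decomposition.\<close>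

lemma trace_classI:
  assumes A: "tc A t"
  shows "trace_class (blin A)"
proof -
  obtain P where P: "pos P" "P * P = adj A * A" and abs: "abs_blinfun (blin A) = blin P"
    by (rule abs_blin)
  have on: "norm e = 1" if "e \<in> E" for e
  proof -
    have "cinner e e = 1" using E that by (auto simp: orthonormal_basis_def)
    then have "(norm e)\<^sup>2 = 1" by (simp add: norm_sq_eq_cinner)
    then show ?thesis by (simp add: power2_eq_1_iff) (use norm_ge_zero[of e] in linarith)
  qed
  have *: "(\<Sum>e\<in>F. Re (cinner e (P \<cdot> e))) \<le> t" if F: "finite F" "F \<subseteq> E" for F
  proof -
    have "(\<Sum>e\<in>F. Re (cinner e (P \<cdot> e))) \<le> t + \<epsilon> * real (card F)" if eps: "0 < \<epsilon>" for \<epsilon>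
    proof -
      \<comment> \<open>S = P + epsilon is inverted by a Neumann series: after division by k, which
        bounds its norm, D = 1 - S / k lies between 0 and 1 - epsilon / k. Below, G is the inverse
        of S.\<close>
      define k where "k = norm P + \<epsilon>"
      have k: "0 < k" using norm_ge_zero[of P] eps unfolding k_def by linarith
      define S where "S = P + \<epsilon> *\<^sub>R 1"
      define D where "D = 1 - (1/k) *\<^sub>R S"
      have Sapp: "S \<cdot> x = P \<cdot> x + \<epsilon> *\<^sub>R x" for x
        by (simp add: S_def app_add_left app_csc scaleR_scaleC flip: csc_of_real)
      have formD: "Re (cinner x (D \<cdot> x)) = (norm x)\<^sup>2 - (Re (cinner x (P \<cdot> x)) + \<epsilon> * (norm x)\<^sup>2) / k" for x
        by (simp add: D_def app_diff_left cinner_diff_right norm_sq_eq_cinner app_csc cinner_scaleC_right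
            Sapp cinner_add_right cinner_real_scale_right add_divide_distrib flip: csc_of_real)
      have "pos D"
      proof (rule posI)
        fix x
        have "Re (cinner x (P \<cdot> x)) \<le> norm x * norm (P \<cdot> x)"
          using complex_Re_le_cmod cinner_cauchy_schwarz order_trans by blast
        also have "\<dots> \<le> norm x * (norm P * norm x)" by (intro mult_left_mono norm_app) auto
        finally have "Re (cinner x (P \<cdot> x)) + \<epsilon> * (norm x)\<^sup>2 \<le> k * (norm x)\<^sup>2"
          by (simp add: k_def power2_eq_square algebra_simps)
        then show "0 \<le> Re (cinner x (D \<cdot> x))" using k by (simp add: formD field_simps)
      qed (simp add: D_def S_def adj_diff adj_add adj_scaleR pos_adj[OF P(1)])
      moreover have "Re (cinner x (D \<cdot> x)) \<le> (1 - \<epsilon> / k) * (norm x)\<^sup>2" for x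
        using posD(1)[OF P(1), of x] k by (simp add: formD field_simps)
      ultimately have "norm D \<le> 1 - \<epsilon> / k"
        using norm_ge_zero[of P] k by (intro pos_norm_le) (auto simp: k_def)
      then have "norm D < 1" using eps k by (smt (verit) divide_pos_pos)
      define G where "G = (1/k) *\<^sub>R (\<Sum>j. D ^ j)"
      have "S = k *\<^sub>R (1 - D)" using k by (simp add: D_def)
      then have SG: "S * G = 1"
        using k neumann_right[OF \<open>norm D < 1\<close>] by (simp add: G_def)
      define W where "W = A * G"
      have PG: "norm (P \<cdot> (G \<cdot> x)) \<le> norm x" for x
      proof -
        define u where "u = G \<cdot> x"
        have "x = P \<cdot> u + \<epsilon> *\<^sub>R u" unfolding u_def using SG Sapp by (metis app_one app_times)
        then have "(norm x)\<^sup>2 = (norm (P \<cdot> u))\<^sup>2 + 2 * Re (cinner (P \<cdot> u) (\<epsilon> *\<^sub>R u)) + (norm (\<epsilon> *\<^sub>R u))\<^sup>2"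
          using norm_add_sq[of "P \<cdot> u" "\<epsilon> *\<^sub>R u"] by simp
        moreover have "Re (cinner (P \<cdot> u) (\<epsilon> *\<^sub>R u)) = \<epsilon> * Re (cinner u (P \<cdot> u))"
          using cinner_commute[of "P \<cdot> u" u] by (simp add: cinner_real_scale_right)
        ultimately have "(norm (P \<cdot> u))\<^sup>2 \<le> (norm x)\<^sup>2"
          using posD(1)[OF P(1), of u] eps by simp
        then show ?thesis unfolding u_def by (rule power2_le_imp_le) simp
      qed
      \<comment> \<open>A and P have the same inner products, since
        \<open>adj A * A = P * P\<close>; hence \<open>A * G\<close> is a contraction because
        \<open>P * G\<close> is one.\<close>
      have AP: "cinner (A \<cdot> u) (A \<cdot> v) = cinner (P \<cdot> u) (P \<cdot> v)" for u v
      proof -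
        have "cinner (A \<cdot> u) (A \<cdot> v) = cinner u ((adj A * A) \<cdot> v)" by (simp add: app_times cinner_adj_right)
        also have "\<dots> = cinner u ((adj P * P) \<cdot> v)" by (simp only: P(2)[symmetric] pos_adj[OF P(1)])
        also have "\<dots> = cinner (P \<cdot> u) (P \<cdot> v)" by (simp add: app_times cinner_adj_right)
        finally show ?thesis .
      qed
      have "norm W \<le> 1"
      proof (rule norm_copI)
        fix x
        have "(norm (W \<cdot> x))\<^sup>2 = (norm (P \<cdot> (G \<cdot> x)))\<^sup>2"
          unfolding norm_sq_eq_cinner W_def app_times AP ..
        then show "norm (W \<cdot> x) \<le> 1 * norm x" using PG[of x] by simp
      qed simp
      \<comment> \<open>Since P G e = e - epsilon G e, replacing <W e, A e> = <P G e, P e> by <e, P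
        e> costs epsilon <G e, P e> = epsilon <P G e, e>, of modulus at most epsilon.\<close>
      have "Re (cinner e (P \<cdot> e)) \<le> cmod (cinner (W \<cdot> e) (A \<cdot> e)) + \<epsilon>" if "e \<in> F" for e
      proof -
        have e: "norm e = 1" using on that F by auto
        have "S \<cdot> (G \<cdot> e) = e" by (simp add: SG flip: app_times)
        then have "P \<cdot> (G \<cdot> e) = e - \<epsilon> *\<^sub>R (G \<cdot> e)" by (simp only: Sapp eq_diff_eq)
        then have "cinner (W \<cdot> e) (A \<cdot> e) = cinner e (P \<cdot> e) - \<epsilon> *\<^sub>R cinner (G \<cdot> e) (P \<cdot> e)"
          by (simp add: W_def app_times AP cinner_diff_left cinner_real_scale_left)
        moreover have "cinner (G \<cdot> e) (P \<cdot> e) = cinner (P \<cdot> (G \<cdot> e)) e"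
          by (metis cinner_adj_left pos_adj[OF P(1)])
        moreover have "cmod (cinner (P \<cdot> (G \<cdot> e)) e) \<le> 1"
          using cinner_cauchy_schwarz[of "P \<cdot> (G \<cdot> e)" e] PG[of e] e by simp
        ultimately have f1: "cinner e (P \<cdot> e) = cinner (W \<cdot> e) (A \<cdot> e) + \<epsilon> *\<^sub>R cinner (P \<cdot> (G \<cdot> e)) e"
          and f2: "cmod (\<epsilon> *\<^sub>R cinner (P \<cdot> (G \<cdot> e)) e) \<le> \<epsilon>"
          using eps by (simp_all add: mult_left_le)
        have "cmod (cinner e (P \<cdot> e)) \<le> cmod (cinner (W \<cdot> e) (A \<cdot> e)) + cmod (\<epsilon> *\<^sub>R cinner (P \<cdot> (G \<cdot> e)) e)"
          unfolding f1 by (rule norm_triangle_ineq)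
        then show ?thesis
          using complex_Re_le_cmod[of "cinner e (P \<cdot> e)"] f2 by linarith
      qed
      then have "(\<Sum>e\<in>F. Re (cinner e (P \<cdot> e))) \<le> (\<Sum>e\<in>F. cmod (cinner (W \<cdot> e) (A \<cdot> e)) + \<epsilon>)"
        by (rule sum_mono)
      also have "\<dots> \<le> t + \<epsilon> * real (card F)"
        using tcD[OF A \<open>norm W \<le> 1\<close> F] by (simp add: sum.distrib mult.commute)
      finally show ?thesis .
    qed
    then show ?thesis
    proof -
      assume le: "\<And>\<epsilon>. 0 < \<epsilon> \<Longrightarrow> (\<Sum>e\<in>F. Re (cinner e (P \<cdot> e))) \<le> t + \<epsilon> * real (card F)"
      have "(\<Sum>e\<in>F. Re (cinner e (P \<cdot> e))) \<le> t + \<delta>" if "0 < \<delta>" for \<delta>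
      proof -
        have "\<delta> / (real (card F) + 1) * real (card F) \<le> \<delta>" using that by (simp add: field_simps)
        moreover have "0 < \<delta> / (real (card F) + 1)" using that by simp
        ultimately show ?thesis using le[of "\<delta> / (real (card F) + 1)"] by linarith
      qed
      then show ?thesis by (rule field_le_epsilon)
    qed
  qed
  have "(\<lambda>e. Re (cinner e (P \<cdot> e))) summable_on E"
    by (rule nonneg_bdd_above_summable_on)
      (use * posD(1)[OF P(1)] in \<open>auto intro!: bdd_aboveI2[of _ _ t]\<close>)
  then have "(\<lambda>e. complex_of_real (Re (cinner e (P \<cdot> e)))) summable_on E"
    by (rule summable_on_of_real)
  moreover have "complex_of_real (Re (cinner e (P \<cdot> e))) = cinner e (P \<cdot> e)" for e
    using posD(2)[OF P(1), of e] by (simp add: complex_eq_iff)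
  ultimately show ?thesis
    unfolding trace_class_def abs using E by (auto simp flip: app.rep_eq)
qed

end

section \<open>Moments of averaged operator words\<close>

text \<open>Induction on q by integrating the derivative of u^(p+1) (1 - u)^(q+1), which vanishes at
  both ends.\<close>

lemma beta_integral:
  "((\<lambda>u::real. u ^ p * (1 - u) ^ q) has_integral (fact p * fact q / fact (p + q + 1))) {0..1}"
proof (induction q arbitrary: p)
  case 0
  have "((\<lambda>u::real. u ^ p) has_integral (1 ^ Suc p / real (Suc p) - 0 ^ Suc p / real (Suc p))) {0..1}"
    by (rule fundamental_theorem_of_calculus)
      (auto intro!: derivative_eq_intros simp del: power_Suc of_nat_Suc
        simp flip: has_real_derivative_iff_has_vector_derivative)
  moreover have "1 ^ Suc p / real (Suc p) - 0 ^ Suc p / real (Suc p) = fact p * fact 0 / fact (p + 0 + 1)"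
    by (simp add: divide_simps)
  ultimately show ?case by simp
next
  case (Suc q)
  let ?g = "\<lambda>u::real. u ^ Suc p * (1 - u) ^ Suc q"
  have "((\<lambda>u. real (Suc p) * (u ^ p * (1 - u) ^ Suc q) - real (Suc q) * (u ^ Suc p * (1 - u) ^ q))
      has_integral (?g 1 - ?g 0)) {0..1}"
  proof (rule fundamental_theorem_of_calculus)
    fix u :: real
    have "(?g has_real_derivative real (Suc p) * (u ^ p * (1 - u) ^ Suc q) - real (Suc q) * (u ^ Suc p * (1 - u) ^ q))
        (at u within {0..1})"
      by (rule derivative_eq_intros refl)+ (simp add: algebra_simps)
    then show "(?g has_vector_derivative real (Suc p) * (u ^ p * (1 - u) ^ Suc q) - real (Suc q) * (u ^ Suc p * (1 - u) ^ q))
        (at u within {0..1})"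
      by (simp add: has_real_derivative_iff_has_vector_derivative)
  qed simp
  from has_integral_add[OF this has_integral_mult_right[OF Suc[of "Suc p"], of "real (Suc q)"]]
  have "((\<lambda>u. real (Suc p) * (u ^ p * (1 - u) ^ Suc q)) has_integral
      real (Suc q) * (fact (Suc p) * fact q / fact (Suc p + q + 1))) {0..1}"
    by simp
  then have "((\<lambda>u. (1 / real (Suc p)) * (real (Suc p) * (u ^ p * (1 - u) ^ Suc q))) has_integral
      (1 / real (Suc p)) * (real (Suc q) * (fact (Suc p) * fact q / fact (Suc p + q + 1)))) {0..1}"
    by (rule has_integral_mult_right)
  moreover have "(1 / real (Suc p)) * (real (Suc p) * y) = y" for y :: real
    by (simp del: of_nat_Suc)
  ultimately have "((\<lambda>u. u ^ p * (1 - u) ^ Suc q) has_integral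
      (1 / real (Suc p)) * (real (Suc q) * (fact (Suc p) * fact q / fact (Suc p + q + 1)))) {0..1}"
    by (simp only:)
  moreover have "(1 / real (Suc p)) * (real (Suc q) * (fact (Suc p) * fact q / fact (Suc p + q + 1)))
     = fact p * fact (Suc q) / fact (p + Suc q + 1)"
    by (simp add: fact_Suc[of p] fact_Suc[of q] del: of_nat_Suc fact_Suc)
  ultimately show ?case by (simp only:)
qed

text \<open>The binomial probability of k in n trials, averaged over the success probability u with
  weight u.\<close>

lemma binomial_beta_integral:
  assumes "k \<le> n"
  shows "((\<lambda>u::real. u * (real (n choose k) * u ^ k * (1 - u) ^ (n - k))) has_integral
    (real (Suc k) / (real (Suc n) * real (n + 2)))) {0..1}"
proof -
  have "((\<lambda>u::real. real (n choose k) * (u ^ Suc k * (1 - u) ^ (n - k))) has_integral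
      real (n choose k) * (fact (Suc k) * fact (n - k) / fact (Suc k + (n - k) + 1))) {0..1}"
    by (intro has_integral_mult_right beta_integral)
  moreover have "real (n choose k) * (fact (Suc k) * fact (n - k) / fact (Suc k + (n - k) + 1))
      = real (Suc k) / (real (Suc n) * real (n + 2))"
  proof -
    have "real (n choose k) = fact n / (fact k * fact (n - k))" by (rule binomial_fact[OF assms])
    moreover have "fact (Suc k + (n - k) + 1) = real (n + 2) * (real (Suc n) * fact n)"
      using assms by (simp add: fact_Suc[of "Suc n"] fact_Suc[of n] del: fact_Suc of_nat_Suc)
    moreover have "fact (Suc k) = real (Suc k) * fact k" by (rule fact_Suc)
    ultimately show ?thesis by (simp add: field_simps del: of_nat_Suc of_nat_add fact_Suc)
  qed
  ultimately show ?thesis by (simp add: mult_ac)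
qed

text \<open>\<open>ip_bound\<close> is not homogeneous; scaling A by the root of s and B by its
  inverse leaves the inner product unchanged and restores the balance.\<close>

lemma ip_bound_scaled:
  assumes A: "hs E A" and B: "hs E B" and s: "0 < s"
  shows "cmod (ip E A B) \<le> (s * hsq E A + hsq E B / s) / 2"
proof -
  let ?t = "complex_of_real (sqrt s)"
  have t: "inverse ?t * cnj ?t = 1" using s by simp
  have "ip E A B = inverse ?t * (cnj ?t * ip E A B)" by (simp only: mult.assoc[symmetric] t mult_1_left)
  also have "\<dots> = ip E (?t \<odot> A) (inverse ?t \<odot> B)" by (simp only: ip_csc_left ip_csc_right)
  finally have "cmod (ip E A B) = cmod (ip E (?t \<odot> A) (inverse ?t \<odot> B))" by (rule arg_cong)
  also have "\<dots> \<le> (hsq E (?t \<odot> A) + hsq E (inverse ?t \<odot> B)) / 2"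
    by (rule ip_bound[OF hs_csc[OF A] hs_csc[OF B]])
  also have "\<dots> = (s * hsq E A + hsq E B / s) / 2"
  proof -
    have n: "(cmod ?t)\<^sup>2 = s" using s by simp
    have "(cmod (inverse ?t))\<^sup>2 = inverse s" unfolding norm_inverse power_inverse n ..
    then show ?thesis unfolding hsq_csc n by (simp only: divide_inverse mult.commute)
  qed
  finally show ?thesis .
qed

lemma hs_scaleR: "hs E A \<Longrightarrow> hs E (r *\<^sub>R A)"
  using hs_csc[of E A "of_real r"] by (simp add: csc_of_real)

lemma hsq_scaleR: "hsq E (r *\<^sub>R A) = r\<^sup>2 * hsq E A"
  using hsq_csc[of E "of_real r" A] by (simp add: csc_of_real)

lemma ip_scaleR_left: "ip E (r *\<^sub>R A) B = of_real r * ip E A B"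
  using ip_csc_left[of E "of_real r" A B] by (simp add: csc_of_real)

lemma ip_scaleR_right: "ip E A (r *\<^sub>R B) = of_real r * ip E A B"
  using ip_csc_right[of E A "of_real r" B] by (simp add: csc_of_real)

section \<open>Words in two unitary operators\<close>

locale unitary_pair = onb E for E :: "'a::complex_hilbert set" +
  fixes A B :: "'a cop"
  assumes A: "unitary A" and B: "unitary B"
begin

lemma HS_word: "HS X \<Longrightarrow> HS (A ^ a * X * B ^ b)"
  by (intro HS_mult_right hs_mult_left)

lemma HSQ_word: "HS X \<Longrightarrow> HSQ (A ^ a * X * B ^ b) \<le> HSQ X"
  by (rule order_trans[OF HSQ_contract_right HSQ_contract_left])
    (auto intro: hs_mult_left norm_unitary unitary_power A B)

text \<open>Left multiplication by \<open>A\<close> and right multiplication by \<open>B\<close> are commuting isometries of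
  the Hilbert-Schmidt operators; \<open>mix u\<close> is their convex combination.\<close>

definition mix :: "real \<Rightarrow> 'a cop \<Rightarrow> 'a cop" where
  "mix u X = u *\<^sub>R (A * X) + (1 - u) *\<^sub>R (X * B)"

lemma mix_add: "mix u (X + Y) = mix u X + mix u Y"
  by (simp add: mix_def algebra_simps)

lemma mix_csc: "mix u (c \<odot> X) = c \<odot> mix u X"
  by (simp add: mix_def csc_add_right csc_mult_left csc_mult_right csc_csc mult.commute
      flip: csc_of_real)

lemma mix_sum: "mix u (sum f S) = (\<Sum>i\<in>S. mix u (f i))"
  by (induction S rule: infinite_finite_induct) (simp_all add: mix_add, simp_all add: mix_def)

lemma HS_mix: "HS X \<Longrightarrow> HS (mix u X)"
  unfolding mix_def by (intro hs_add hs_scaleR HS_mult_right hs_mult_left)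

lemma HS_mix_power: "HS X \<Longrightarrow> HS ((mix u ^^ n) X)"
  by (induction n) (simp_all add: HS_mix)

lemma HSQ_mix:
  assumes X: "HS X" and u: "0 \<le> u" "u \<le> 1"
  shows "HSQ (mix u X) \<le> HSQ X"
proof -
  let ?P = "A * X" and ?Q = "X * B"
  have P: "HS ?P" and Q: "HS ?Q" using X by (auto intro: hs_mult_left HS_mult_right)
  have p: "HSQ ?P \<le> HSQ X" and q: "HSQ ?Q \<le> HSQ X"
    using X A B by (auto intro: HSQ_contract_left HSQ_contract_right norm_unitary)
  have "Re (IP ?P ?Q) \<le> (HSQ ?P + HSQ ?Q) / 2"
    using complex_Re_le_cmod ip_bound[OF P Q] order_trans by blast
  also have "\<dots> \<le> HSQ X" using p q by simp
  finally have r: "Re (IP ?P ?Q) \<le> HSQ X" .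
  have "HSQ (mix u X) = u\<^sup>2 * HSQ ?P + 2 * (u * (1 - u)) * Re (IP ?P ?Q) + (1 - u)\<^sup>2 * HSQ ?Q"
    unfolding mix_def by (subst hsq_add) (simp_all add: P Q hs_scaleR hsq_scaleR ip_scaleR_left ip_scaleR_right mult_ac)
  also have "\<dots> \<le> u\<^sup>2 * HSQ X + 2 * (u * (1 - u)) * HSQ X + (1 - u)\<^sup>2 * HSQ X"
    using u by (intro add_mono mult_left_mono p q r) auto
  also have "\<dots> = HSQ X" by (simp add: power2_eq_square algebra_simps)
  finally show ?thesis .
qed

lemma HSQ_mix_power: "HS X \<Longrightarrow> 0 \<le> u \<Longrightarrow> u \<le> 1 \<Longrightarrow> HSQ ((mix u ^^ n) X) \<le> HSQ X"
proof (induction n)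
  case (Suc n)
  then show ?case using HSQ_mix[OF HS_mix_power[of X n u]] by fastforce
qed simp

text \<open>The binomial theorem, valid because left multiplication by A commutes with right
  multiplication by B.\<close>

lemma mix_power:
  "(mix u ^^ n) X = (\<Sum>k\<le>n. (real (n choose k) * u ^ k * (1 - u) ^ (n - k)) *\<^sub>R (A ^ k * X * B ^ (n - k)))"
proof (induction n)
  case (Suc n)
  define v where "v = 1 - u"
  define t where "t m k = real (m choose k) * u ^ k * v ^ (m - k)" for m k
  define Z where "Z k = A ^ k * X * B ^ (Suc n - k)" for k
  have t_Suc: "t (Suc n) (Suc k) = u * t n k + v * t n (Suc k)" if "k \<le> n" for k
  proof (cases "k = n")
    case False
    with that have "n - k = Suc (n - Suc k)" by simp
    then have "v * v ^ (n - Suc k) = v ^ (n - k)" by simp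
    then show ?thesis by (simp add: t_def algebra_simps)
  qed (simp add: t_def algebra_simps)
  have "mix u (\<Sum>k\<le>n. t n k *\<^sub>R (A ^ k * X * B ^ (n - k)))
      = (\<Sum>k\<le>n. (u * t n k) *\<^sub>R Z (Suc k) + (v * t n k) *\<^sub>R Z k)"
    unfolding mix_sum
  proof (intro sum.cong refl)
    fix k assume "k \<in> {..n}"
    then have k: "Suc n - k = Suc (n - k)" by simp
    show "mix u (t n k *\<^sub>R (A ^ k * X * B ^ (n - k))) = (u * t n k) *\<^sub>R Z (Suc k) + (v * t n k) *\<^sub>R Z k"
      unfolding mix_def Z_def k v_def by (simp add: mult.assoc power_commutes)
  qed
  also have "\<dots> = (\<Sum>k\<le>n. (u * t n k) *\<^sub>R Z (Suc k)) + (\<Sum>k\<le>Suc n. (v * t n k) *\<^sub>R Z k)"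
    by (simp add: sum.distrib t_def)
  also have "(\<Sum>k\<le>Suc n. (v * t n k) *\<^sub>R Z k) = (v * t n 0) *\<^sub>R Z 0 + (\<Sum>k\<le>n. (v * t n (Suc k)) *\<^sub>R Z (Suc k))"
    by (rule sum.atMost_Suc_shift)
  also have "(\<Sum>k\<le>n. (u * t n k) *\<^sub>R Z (Suc k)) + ((v * t n 0) *\<^sub>R Z 0 + (\<Sum>k\<le>n. (v * t n (Suc k)) *\<^sub>R Z (Suc k)))
      = t (Suc n) 0 *\<^sub>R Z 0 + (\<Sum>k\<le>n. t (Suc n) (Suc k) *\<^sub>R Z (Suc k))"
  proof -
    have "(\<Sum>k\<le>n. t (Suc n) (Suc k) *\<^sub>R Z (Suc k))
        = (\<Sum>k\<le>n. (u * t n k) *\<^sub>R Z (Suc k) + (v * t n (Suc k)) *\<^sub>R Z (Suc k))"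
      by (intro sum.cong refl) (simp add: t_Suc scaleR_add_left)
    then show ?thesis by (simp add: sum.distrib t_def)
  qed
  also have "\<dots> = (\<Sum>k\<le>Suc n. t (Suc n) k *\<^sub>R Z k)" by (rule sum.atMost_Suc_shift[symmetric])
  finally show ?case using Suc by (simp only: funpow.simps o_apply t_def Z_def v_def)
qed simp

text \<open>The integral over [0,1] of u <X, \<open>mix u\<close> ^ n Y> in evaluated form, as
  \<open>wmean_integral\<close> states for X = Y. The words in it are those in the trace of a
  remainder.\<close>

definition wmean :: "'a cop \<Rightarrow> 'a cop \<Rightarrow> nat \<Rightarrow> complex" where
  "wmean X Y n = (\<Sum>k\<le>n. of_real (real (Suc k) / (real (Suc n) * real (n + 2))) * IP X (A ^ k * Y * B ^ (n - k)))"

lemma sum_weights: "(\<Sum>k\<le>n. real (Suc k) / (real (Suc n) * real (n + 2))) = 1 / 2"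
proof -
  have "(\<Sum>k\<le>n. real (Suc k)) = real (Suc n) * real (n + 2) / 2"
    by (induction n) (simp_all add: field_simps)
  moreover have "real (Suc n) * real (n + 2) \<noteq> 0" by simp
  ultimately show ?thesis by (simp only: sum_divide_distrib[symmetric]) (simp del: of_nat_Suc of_nat_add)
qed

lemma wmean_bound:
  assumes "HS X" "HS Y"
  shows "cmod (wmean X Y n) \<le> (HSQ X + HSQ Y) / 4"
proof -
  let ?c = "\<lambda>k. real (Suc k) / (real (Suc n) * real (n + 2))"
  have "cmod (wmean X Y n) \<le> (\<Sum>k\<le>n. ?c k * ((HSQ X + HSQ Y) / 2))"
    unfolding wmean_def
  proof (rule order_trans[OF norm_sum], rule sum_mono)
    fix k
    have "cmod (IP X (A ^ k * Y * B ^ (n - k))) \<le> (HSQ X + HSQ Y) / 2"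
      using ip_bound[OF assms(1) HS_word[OF assms(2), of k "n - k"]] HSQ_word[OF assms(2), of k "n - k"]
      by simp
    then have "?c k * cmod (IP X (A ^ k * Y * B ^ (n - k))) \<le> ?c k * ((HSQ X + HSQ Y) / 2)"
      by (intro mult_left_mono) simp_all
    then show "cmod (of_real (?c k) * IP X (A ^ k * Y * B ^ (n - k))) \<le> ?c k * ((HSQ X + HSQ Y) / 2)"
      by (simp only: norm_mult norm_of_real) simp
  qed
  also have "\<dots> = (HSQ X + HSQ Y) / 4"
    unfolding sum_distrib_right[symmetric] sum_weights by simp
  finally show ?thesis .
qed

lemma wmean_integral:
  assumes X: "HS X"
  shows "((\<lambda>u. of_real u * IP X ((mix u ^^ n) X)) has_integral wmean X X n) {0..1}"
proof -
  have "IP X ((mix u ^^ n) X) = (\<Sum>k\<le>n. of_real (real (n choose k) * u ^ k * (1 - u) ^ (n - k)) * IP X (A ^ k * X * B ^ (n - k)))" for u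
    unfolding mix_power by (subst ip_sum_right) (auto simp: X HS_word hs_scaleR ip_scaleR_right)
  then have eq: "of_real u * IP X ((mix u ^^ n) X)
     = (\<Sum>k\<le>n. of_real (u * (real (n choose k) * u ^ k * (1 - u) ^ (n - k))) * IP X (A ^ k * X * B ^ (n - k)))" for u
    by (simp add: sum_distrib_left mult.assoc)
  show ?thesis
    unfolding eq wmean_def
    by (intro has_integral_sum has_integral_mult_left has_integral_of_real binomial_beta_integral) auto
qed

text \<open>With z = r zeta and y the sum of z^k \<open>mix u\<close> ^ k X over k < N, the
  difference of y and z \<open>mix u\<close> y is XN = X - z^N \<open>mix u\<close> ^ N X. As z
  \<open>mix u\<close> is a contraction, |y - XN|^2 is at most |y|^2, that is, |XN|^2 is at most 2
  Re <y, XN>. Finite sums avoid limits inside the Hilbert-Schmidt operators; replacing XN by X costs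
  the terms with r^N.\<close>

lemma positivity_estimate:
  assumes X: "HS X" and u: "0 \<le> u" "u \<le> 1" and \<zeta>: "cmod \<zeta> = 1" and r: "0 < r" "r < 1"
  shows "HSQ X * (1 - 2 * r ^ N - 2 * real N * r ^ N)
     \<le> 2 * Re (\<Sum>k<N. (of_real r * \<zeta>) ^ k * IP X ((mix u ^^ k) X))"
proof -
  define z where "z = of_real r * \<zeta>"
  have z: "cmod z = r" using r \<zeta> by (simp add: z_def norm_mult)
  define x where "x k = (mix u ^^ k) X" for k
  have x: "HS (x k)" "HSQ (x k) \<le> HSQ X" for k
    unfolding x_def using X u by (auto intro: HS_mix_power HSQ_mix_power)
  have x0: "x 0 = X" by (simp add: x_def)
  have ipx: "cmod (IP (x j) (x k)) \<le> HSQ X" for j k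
    using ip_bound[OF x(1) x(1), of j k] add_mono[OF x(2)[of j] x(2)[of k]] by simp
  define y where "y = (\<Sum>k<N. z ^ k \<odot> x k)"
  have y: "HS y" unfolding y_def by (intro hs_sum hs_csc x)
  define XN where "XN = X - z ^ N \<odot> x N"
  have XN: "HS XN" unfolding XN_def by (intro hs_diff hs_csc x X)
  have "z \<odot> mix u y = (\<Sum>k<N. z ^ Suc k \<odot> x (Suc k))"
    unfolding y_def mix_sum csc_sum_right by (simp add: mix_csc csc_csc x_def)
  moreover have "(\<Sum>k<N. z ^ Suc k \<odot> x (Suc k)) = y + z ^ N \<odot> x N - X"
  proof -
    have "(\<Sum>k<Suc N. z ^ k \<odot> x k) = X + (\<Sum>k<N. z ^ Suc k \<odot> x (Suc k))"
      by (subst sum.lessThan_Suc_shift) (simp add: x0)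
    then show ?thesis by (simp add: y_def algebra_simps)
  qed
  ultimately have "y - XN = z \<odot> mix u y" by (simp add: XN_def)
  then have "HSQ (y - XN) = r\<^sup>2 * HSQ (mix u y)" by (simp add: hsq_csc z)
  also have "\<dots> \<le> 1 * HSQ y"
    using r by (intro mult_mono HSQ_mix[OF y u] power_le_one) (auto simp: hsq_nonneg)
  finally have "HSQ XN \<le> 2 * Re (IP y XN)" unfolding hsq_diff[OF y XN] by simp
  moreover have "HSQ XN \<ge> HSQ X - 2 * r ^ N * HSQ X"
  proof -
    have "HSQ XN = HSQ X - 2 * Re (z ^ N * IP X (x N)) + HSQ (z ^ N \<odot> x N)"
      unfolding XN_def by (subst hsq_diff[OF X hs_csc[OF x(1)]]) (simp only: ip_csc_right)
    moreover have "Re (z ^ N * IP X (x N)) \<le> r ^ N * HSQ X"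
    proof -
      have "cmod (z ^ N * IP X (x N)) \<le> r ^ N * HSQ X"
        unfolding norm_mult norm_power z using ipx[of 0 N] r by (intro mult_left_mono) (auto simp: x0)
      then show ?thesis using complex_Re_le_cmod order_trans by blast
    qed
    ultimately show ?thesis using hsq_nonneg[of E "z ^ N \<odot> x N"] by simp
  qed
  moreover have "Re (IP y XN) \<le> Re (IP X y) + real N * r ^ N * HSQ X"
  proof -
    have "Re (IP y XN) = Re (IP XN y)" by (subst ip_commute) simp
    also have "IP XN y = IP X y - cnj (z ^ N) * IP (x N) y"
      unfolding XN_def by (subst ip_diff_left) (auto simp: X y x hs_csc ip_csc_left)
    also have "Re \<dots> \<le> Re (IP X y) + cmod (cnj (z ^ N) * IP (x N) y)"
      using abs_Re_le_cmod[of "cnj (z ^ N) * IP (x N) y"] by simp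
    also have "cmod (cnj (z ^ N) * IP (x N) y) \<le> r ^ N * (real N * HSQ X)"
      unfolding norm_mult complex_mod_cnj norm_power z
    proof (rule mult_left_mono)
      have "cmod (IP (x N) y) \<le> (\<Sum>k<N. HSQ X)"
        unfolding y_def
      proof (subst ip_sum_right)
        show "cmod (\<Sum>k<N. IP (x N) (z ^ k \<odot> x k)) \<le> (\<Sum>k<N. HSQ X)"
        proof (rule order_trans[OF norm_sum], rule sum_mono)
          fix k
          have "r ^ k \<le> 1" using r by (intro power_le_one) auto
          then have "r ^ k * cmod (IP (x N) (x k)) \<le> 1 * HSQ X"
            using ipx[of N k] by (intro mult_mono) auto
          then show "cmod (IP (x N) (z ^ k \<odot> x k)) \<le> HSQ X"
            by (simp add: ip_csc_right norm_mult norm_power z)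
        qed
      qed (auto simp: x hs_csc)
      then show "cmod (IP (x N) y) \<le> real N * HSQ X" by simp
    qed (use r in simp)
    finally show ?thesis by (simp add: mult_ac)
  qed
  moreover have "IP X y = (\<Sum>k<N. z ^ k * IP X (x k))"
    unfolding y_def by (subst ip_sum_right) (auto simp: X x hs_csc ip_csc_right)
  ultimately show ?thesis unfolding z_def[symmetric] x_def[symmetric] by (simp add: algebra_simps)
qed

end

section \<open>Moments of the diagonal means by positivity\<close>

locale unitary_pair_moments = unitary_pair E A B + circle_space M w
  for E :: "'a::complex_hilbert set" and A B and M :: "'b measure" and w
begin

text \<open>\<open>positivity_estimate\<close> is multiplied by u and integrated over [0,1], where u
  has integral 1/2; N -> infinity yields the hypothesis of \<open>moments_positive\<close> with
  constant coefficient \<open>HSQ X / 2\<close>.\<close>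

lemma moments_wmean_diagonal:
  assumes X: "HS X" and r: "0 < r" "r < 1"
  shows "moments (\<lambda>n. of_real (r ^ n) * wmean X X n) (HSQ X / 2)"
proof -
  have w0: "wmean X X 0 = of_real (HSQ X / 2)"
    using X by (simp add: wmean_def ip_self)
  have "moments (\<lambda>n. of_real (r ^ n) * wmean X X n) (Re (of_real (r ^ 0) * wmean X X 0))"
  proof (rule moments_positive[where A = "HSQ X / 2" and r = r])
    show "cmod (of_real (r ^ n) * wmean X X n) \<le> HSQ X / 2 * r ^ n" for n
      using wmean_bound[OF X X, of n] r by (simp add: norm_mult norm_power mult.commute mult_left_mono)
    show "0 \<le> r" "r < 1" using r by auto
    show "Im (of_real (r ^ 0) * wmean X X 0) = 0" by (simp add: w0)
    fix \<zeta> :: complex assume \<zeta>: "cmod \<zeta> = 1"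
    have fin: "HSQ X / 2 * (1 - 2 * r ^ N - 2 * real N * r ^ N)
       \<le> 2 * Re (\<Sum>k<N. of_real (r ^ k) * wmean X X k * \<zeta> ^ k)" for N
    proof -
      have I: "((\<lambda>u. 2 * Re (\<Sum>k<N. (of_real r * \<zeta>) ^ k * (of_real u * IP X ((mix u ^^ k) X))))
          has_integral 2 * Re (\<Sum>k<N. (of_real r * \<zeta>) ^ k * wmean X X k)) {0..1}"
        by (intro has_integral_mult_right has_integral_Re has_integral_sum wmean_integral X) auto
      have J: "((\<lambda>u::real. HSQ X * (1 - 2 * r ^ N - 2 * real N * r ^ N) * u)
          has_integral HSQ X * (1 - 2 * r ^ N - 2 * real N * r ^ N) * (1/2)) {0..1}"
        using beta_integral[of 1 0] by (intro has_integral_mult_right) (simp add: numeral_2_eq_2)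
      have "HSQ X * (1 - 2 * r ^ N - 2 * real N * r ^ N) * (1/2) \<le> 2 * Re (\<Sum>k<N. (of_real r * \<zeta>) ^ k * wmean X X k)"
      proof (rule has_integral_le[OF J I])
        fix u :: real assume u: "u \<in> {0..1}"
        have "u * (HSQ X * (1 - 2 * r ^ N - 2 * real N * r ^ N))
           \<le> u * (2 * Re (\<Sum>k<N. (of_real r * \<zeta>) ^ k * IP X ((mix u ^^ k) X)))"
          using u by (intro mult_left_mono positivity_estimate X \<zeta> r) auto
        also have "\<dots> = 2 * Re (of_real u * (\<Sum>k<N. (of_real r * \<zeta>) ^ k * IP X ((mix u ^^ k) X)))"
          by simp
        also have "of_real u * (\<Sum>k<N. (of_real r * \<zeta>) ^ k * IP X ((mix u ^^ k) X))
           = (\<Sum>k<N. (of_real r * \<zeta>) ^ k * (of_real u * IP X ((mix u ^^ k) X)))"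
          by (simp add: sum_distrib_left mult.left_commute)
        finally show "HSQ X * (1 - 2 * r ^ N - 2 * real N * r ^ N) * u
           \<le> 2 * Re (\<Sum>k<N. (of_real r * \<zeta>) ^ k * (of_real u * IP X ((mix u ^^ k) X)))"
          by (simp only: mult.commute)
      qed
      then show ?thesis by (simp add: power_mult_distrib mult_ac)
    qed
    have "summable (\<lambda>n. of_real (r ^ n) * wmean X X n * \<zeta> ^ n)"
    proof (rule summable_comparison_test[OF _ summable_mult[OF summable_geometric[of r], of "HSQ X / 2"]])
      show "\<exists>N. \<forall>n\<ge>N. norm (of_real (r ^ n) * wmean X X n * \<zeta> ^ n) \<le> HSQ X / 2 * r ^ n"
        using wmean_bound[OF X X] r \<zeta> by (auto simp: norm_mult norm_power mult.commute mult_left_mono)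
    qed (use r in simp)
    then have lim1: "(\<lambda>N. 2 * Re (\<Sum>k<N. of_real (r ^ k) * wmean X X k * \<zeta> ^ k))
        \<longlonglongrightarrow> 2 * Re (\<Sum>n. of_real (r ^ n) * wmean X X n * \<zeta> ^ n)"
      by (intro tendsto_intros summable_LIMSEQ)
    have lim2: "(\<lambda>N. HSQ X / 2 * (1 - 2 * r ^ N - 2 * (real N * r ^ N))) \<longlonglongrightarrow> HSQ X / 2 * (1 - 2 * 0 - 2 * 0)"
      using r by (intro tendsto_intros LIMSEQ_power_zero powser_times_n_limit_0) auto
    have "HSQ X / 2 * (1 - 2 * 0 - 2 * 0) \<le> 2 * Re (\<Sum>n. of_real (r ^ n) * wmean X X n * \<zeta> ^ n)"
      by (rule LIMSEQ_le[OF lim2 lim1]) (use fin in \<open>auto simp: mult.assoc\<close>)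
    then show "Re (of_real (r ^ 0) * wmean X X 0) \<le> 2 * Re (\<Sum>n. of_real (r ^ n) * wmean X X n * \<zeta> ^ n)"
      by (simp add: w0)
  qed
  then show ?thesis by (simp add: w0)
qed

end

section \<open>Polarization of the means, and their decay on commutators\<close>

context unitary_pair
begin

lemma wmean_add_right: "HS X \<Longrightarrow> HS Y \<Longrightarrow> HS Y' \<Longrightarrow> wmean X (Y + Y') n = wmean X Y n + wmean X Y' n"
  unfolding wmean_def sum.distrib[symmetric]
  by (intro sum.cong refl) (simp add: distrib_left distrib_right ip_add_right HS_word)

lemma wmean_add_left: "HS X \<Longrightarrow> HS X' \<Longrightarrow> HS Y \<Longrightarrow> wmean (X + X') Y n = wmean X Y n + wmean X' Y n"
  unfolding wmean_def sum.distrib[symmetric]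
  by (intro sum.cong refl) (simp add: distrib_left ip_add_left HS_word)

lemma wmean_csc_right: "wmean X (c \<odot> Y) n = c * wmean X Y n"
  unfolding wmean_def sum_distrib_left
  by (intro sum.cong refl) (simp add: csc_mult_left csc_mult_right ip_csc_right)

lemma wmean_csc_left: "wmean (c \<odot> X) Y n = cnj c * wmean X Y n"
  unfolding wmean_def sum_distrib_left
  by (intro sum.cong refl) (simp add: ip_csc_left)

lemma wmean_polarization:
  assumes X: "HS X" and Y: "HS Y"
  shows "4 * wmean X Y n = wmean (X + Y) (X + Y) n - wmean (X + (-1) \<odot> Y) (X + (-1) \<odot> Y) n
     - \<i> * wmean (X + \<i> \<odot> Y) (X + \<i> \<odot> Y) n + \<i> * wmean (X + (- \<i>) \<odot> Y) (X + (- \<i>) \<odot> Y) n"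
  using X Y by (simp add: wmean_add_right wmean_add_left wmean_csc_right wmean_csc_left hs_add hs_csc
      algebra_simps)

text \<open>The word of a commutator is a difference of neighbouring words of Z. With weights
  proportional to k + 1, summation by parts leaves terms of total size O(n) against the
  normalization (n + 1) (n + 2).\<close>

lemma wmean_commutator_bound:
  assumes X: "HS X" and Z: "HS Z"
  shows "cmod (wmean X (A * Z - Z * B) n) \<le> (HSQ X + HSQ Z) / real (Suc n)"
proof -
  define h where "h k = IP X (A ^ k * Z * B ^ (Suc n - k))" for k
  have hb: "cmod (h k) \<le> (HSQ X + HSQ Z) / 2" for k
    unfolding h_def
    using ip_bound[OF X HS_word[OF Z, of k "Suc n - k"]] HSQ_word[OF Z, of k "Suc n - k"] by simp
  have tele: "(\<Sum>k<m. of_nat (Suc k) * (h (Suc k) - h k)) = of_nat m * h m - (\<Sum>k<m. h k)" for m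
    by (induction m) (simp_all add: algebra_simps)
  have "IP X (A ^ k * (A * Z - Z * B) * B ^ (n - k)) = h (Suc k) - h k" if "k \<le> n" for k
  proof -
    have k: "Suc n - k = Suc (n - k)" using that by simp
    have "A ^ k * (A * Z - Z * B) * B ^ (n - k) = A ^ Suc k * Z * B ^ (n - k) - A ^ k * Z * B ^ Suc (n - k)"
      by (simp add: algebra_simps power_commutes) (simp add: mult.assoc[symmetric] power_commutes)
    then show ?thesis unfolding h_def k by (simp only: ip_diff_right X HS_word Z diff_Suc_Suc)
  qed
  then have "wmean X (A * Z - Z * B) n
      = (\<Sum>k\<le>n. of_real (real (Suc k) / (real (Suc n) * real (n + 2))) * (h (Suc k) - h k))"
    unfolding wmean_def by (intro sum.cong) auto
  also have "\<dots> = (\<Sum>k<Suc n. of_nat (Suc k) * (h (Suc k) - h k)) / of_real (real (Suc n) * real (n + 2))"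
    unfolding lessThan_Suc_atMost sum_divide_distrib by (intro sum.cong) (simp_all del: of_nat_Suc of_nat_add)
  finally have eq: "wmean X (A * Z - Z * B) n
      = (of_nat (Suc n) * h (Suc n) - (\<Sum>k<Suc n. h k)) / of_real (real (Suc n) * real (n + 2))"
    unfolding tele .
  let ?H = "(HSQ X + HSQ Z) / 2"
  have "cmod (of_nat (Suc n) * h (Suc n) - (\<Sum>k<Suc n. h k)) \<le> real (Suc n) * ?H + (\<Sum>k<Suc n. ?H)"
  proof (rule order_trans[OF norm_triangle_ineq4], rule add_mono)
    show "cmod (of_nat (Suc n) * h (Suc n)) \<le> real (Suc n) * ?H"
      unfolding norm_mult norm_of_nat by (intro mult_left_mono hb) simp
    show "cmod (\<Sum>k<Suc n. h k) \<le> (\<Sum>k<Suc n. ?H)"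
      by (rule order_trans[OF norm_sum], rule sum_mono, rule hb)
  qed
  also have "\<dots> = real (Suc n) * (HSQ X + HSQ Z)" by (simp add: field_simps)
  finally have "cmod (wmean X (A * Z - Z * B) n) \<le> real (Suc n) * (HSQ X + HSQ Z) / (real (Suc n) * real (n + 2))"
    unfolding eq norm_divide norm_of_real abs_of_nonneg[OF mult_nonneg_nonneg[OF of_nat_0_le_iff of_nat_0_le_iff]]
    by (rule divide_right_mono) simp
  also have "\<dots> = (HSQ X + HSQ Z) / real (n + 2)" by (simp del: of_nat_Suc of_nat_add)
  also have "\<dots> \<le> (HSQ X + HSQ Z) / real (Suc n)"
    using hsq_nonneg[of E X] hsq_nonneg[of E Z] by (intro divide_left_mono) auto
  finally show ?thesis .
qed

end

section \<open>Ergodic averages\<close>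

lemma ip_remove_finite:
  assumes X: "hs E X" and Y: "hs E Y" and F: "finite F" "F \<subseteq> E"
  shows "ip E X Y = (\<Sum>e\<in>F. cinner (X \<cdot> e) (Y \<cdot> e)) + ip (E - F) X Y"
proof -
  have "ip E X Y = infsum (\<lambda>e. cinner (X \<cdot> e) (Y \<cdot> e)) (F \<union> (E - F))"
    using F by (simp add: ip_def Un_absorb1)
  also have "\<dots> = infsum (\<lambda>e. cinner (X \<cdot> e) (Y \<cdot> e)) F + ip (E - F) X Y"
    unfolding ip_def
    by (rule infsum_Un_disjoint)
      (use F summable_on_subset_banach[OF ip_summable[OF X Y], of "E - F"] in auto)
  finally show ?thesis using F by simp
qed

lemma hs_subset: "hs E X \<Longrightarrow> F \<subseteq> E \<Longrightarrow> hs F X"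
  unfolding hs_def by (rule summable_on_subset_banach)

lemma hsq_subset:
  assumes X: "hs E X" and F: "F \<subseteq> E"
  shows "hsq F X \<le> hsq E X"
  unfolding hsq_def
  by (rule infsum_mono_neutral) (use assms hs_subset[OF X F] in \<open>auto simp: hs_def\<close>)

lemma hsq_tail_small:
  assumes X: "hs E X" and \<delta>: "0 < \<delta>"
  shows "\<exists>F. finite F \<and> F \<subseteq> E \<and> hsq (E - F) X < \<delta>"
proof -
  have "((\<lambda>e. (norm (X \<cdot> e))\<^sup>2) has_sum hsq E X) E"
    using X unfolding hsq_def hs_def by (rule has_sum_infsum)
  then have "\<forall>\<^sub>F F in finite_subsets_at_top E. dist (\<Sum>e\<in>F. (norm (X \<cdot> e))\<^sup>2) (hsq E X) < \<delta>"
    unfolding has_sum_def using \<delta> by (rule tendstoD)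
  then obtain F where F: "finite F" "F \<subseteq> E" "dist (\<Sum>e\<in>F. (norm (X \<cdot> e))\<^sup>2) (hsq E X) < \<delta>"
    unfolding eventually_finite_subsets_at_top by auto
  have "hsq E X = (\<Sum>e\<in>F. (norm (X \<cdot> e))\<^sup>2) + hsq (E - F) X"
  proof -
    have "complex_of_real (hsq E X) = of_real (\<Sum>e\<in>F. (norm (X \<cdot> e))\<^sup>2) + of_real (hsq (E - F) X)"
      using ip_remove_finite[OF X X F(1,2)] X hs_subset[OF X, of "E - F"]
      by (simp add: ip_self cinner_norm)
    then show ?thesis by (simp only: of_real_add[symmetric] of_real_eq_iff)
  qed
  with F show ?thesis by (intro exI[of _ F]) (auto simp: dist_real_def)
qed

section \<open>Orbit sums of the difference of the two unitaries\<close>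

context unitary_pair
begin

text \<open>A unitary map of the Hilbert-Schmidt operators, whose fixed points are the intertwiners
  A X = X B.\<close>

definition conj_shift :: "'a cop \<Rightarrow> 'a cop" where
  "conj_shift X = adj A * X * B"

lemma HS_conj_shift: "HS X \<Longrightarrow> HS ((conj_shift ^^ k) X)"
  by (induction k) (simp_all add: conj_shift_def HS_mult_right hs_mult_left)

lemma IP_conj_shift: "HS X \<Longrightarrow> HS Y \<Longrightarrow> IP (conj_shift X) (conj_shift Y) = IP X Y"
proof -
  assume X: "HS X" and Y: "HS Y"
  have "IP (adj A * X * B) (adj A * Y * B) = IP (adj A * X) (adj A * Y * B * adj B)"
    by (intro IP_adj_right HS_mult_right hs_mult_left X Y)
  also have "\<dots> = IP X (A * (adj A * Y))"
    by (simp add: mult.assoc unitary_cancel B IP_adj_left)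
  finally show ?thesis by (simp add: conj_shift_def unitary_cancel A)
qed

lemma IP_conj_shift_power:
  assumes "HS X" "HS Y"
  shows "IP ((conj_shift ^^ k) X) ((conj_shift ^^ k) Y) = IP X Y"
  by (induction k) (simp_all add: IP_conj_shift HS_conj_shift assms)

lemma HSQ_conj_shift_power: "HS X \<Longrightarrow> HSQ ((conj_shift ^^ k) X) = HSQ X"
  using IP_conj_shift_power[of X X k] HS_conj_shift[of X k] by (simp add: ip_self)

lemma sum_conj_shift_telescope:
  "(\<Sum>k<N. (conj_shift ^^ k) (B - A)) = A * (adj A ^ N * B ^ N - 1)"
proof -
  \<comment> \<open>G 0 = 1, and the k-th term of the orbit of B - A is A (G (k+1) - G k), so the
    orbit sum telescopes.\<close>
  define G where "G j = adj A ^ j * B ^ j" for j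
  have s: "adj A * (G j * B) = G (Suc j)" for j
    by (simp add: G_def mult.assoc power_commutes)
  have *: "(conj_shift ^^ k) (B - A) = A * (G (Suc k) - G k)" for k
  proof (induction k)
    case 0
    show ?case by (simp add: G_def right_diff_distrib unitary_cancel A)
  next
    case (Suc k)
    have "conj_shift (A * (G (Suc k) - G k)) = A * (adj A * ((G (Suc k) - G k) * B))"
      by (simp add: conj_shift_def unitary_cancel A mult.assoc[of "adj A"] mult.assoc[of A])
    also have "\<dots> = A * (G (Suc (Suc k)) - G (Suc k))"
      by (simp only: left_diff_distrib right_diff_distrib s)
    finally show ?case using Suc by simp
  qed
  have "(\<Sum>k<N. A * (G (Suc k) - G k)) = A * (G N - G 0)"
    by (induction N) (simp_all add: algebra_simps)
  then show ?thesis by (simp only: *) (simp add: G_def)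
qed

text \<open>The bound is uniform in N because the orbit starts at the difference of the two
  unitaries; for a fixed point of \<open>conj_shift\<close> the sums would grow like N.\<close>

lemma norm_sum_conj_shift: "norm (\<Sum>k<N. (conj_shift ^^ k) (B - A)) \<le> 2"
proof -
  have u: "norm (adj A ^ N * B ^ N) \<le> 1"
    by (intro norm_unitary unitary_mult unitary_power unitary_adj A B)
  have "norm (A * (adj A ^ N * B ^ N - 1)) \<le> norm A * norm (adj A ^ N * B ^ N - 1)"
    by (rule norm_mult_ineq)
  moreover have "norm A * norm (adj A ^ N * B ^ N - 1) \<le> 1 * norm (adj A ^ N * B ^ N - 1)"
    by (intro mult_right_mono norm_unitary A) simp
  moreover have "norm (adj A ^ N * B ^ N - 1) \<le> norm (adj A ^ N * B ^ N) + norm (1 :: 'a cop)"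
    by (rule norm_triangle_ineq4)
  ultimately show ?thesis unfolding sum_conj_shift_telescope using u norm_one_cop[where 'a = 'a] by simp
qed

lemma HSQ_sum_le: "HS X \<Longrightarrow> HSQ (\<Sum>k<N. (conj_shift ^^ k) X) \<le> (real N)\<^sup>2 * HSQ X"
proof (induction N)
  case 0
  show ?case by (simp add: hsq_def)
next
  case (Suc N)
  let ?S = "\<Sum>k<N. (conj_shift ^^ k) X"
  have S: "HS ?S" by (intro hs_sum HS_conj_shift Suc)
  have I: "Re (IP ?S ((conj_shift ^^ N) X)) \<le> real N * HSQ X"
  proof -
    have "cmod (IP ((conj_shift ^^ N) X) ?S) \<le> (\<Sum>k<N. HSQ X)"
    proof (subst ip_sum_right)
      show "cmod (\<Sum>k<N. IP ((conj_shift ^^ N) X) ((conj_shift ^^ k) X)) \<le> (\<Sum>k<N. HSQ X)"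
      proof (rule order_trans[OF norm_sum], rule sum_mono)
        fix k
        show "cmod (IP ((conj_shift ^^ N) X) ((conj_shift ^^ k) X)) \<le> HSQ X"
          using ip_bound[OF HS_conj_shift HS_conj_shift, OF Suc.prems Suc.prems, of N k]
          by (simp add: HSQ_conj_shift_power Suc.prems)
      qed
    qed (auto intro: HS_conj_shift Suc.prems)
    moreover have "Re (IP ?S ((conj_shift ^^ N) X)) = Re (IP ((conj_shift ^^ N) X) ?S)"
      by (subst ip_commute) simp
    ultimately show ?thesis using complex_Re_le_cmod[of "IP ((conj_shift ^^ N) X) ?S"] by simp
  qed
  have "HSQ (\<Sum>k<Suc N. (conj_shift ^^ k) X) = HSQ ?S + 2 * Re (IP ?S ((conj_shift ^^ N) X)) + HSQ X"
    using hsq_add[OF S HS_conj_shift[OF Suc.prems, of N]] by (simp add: HSQ_conj_shift_power Suc.prems)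
  also have "\<dots> \<le> (real N)\<^sup>2 * HSQ X + 2 * (real N * HSQ X) + HSQ X"
    using Suc I by simp
  also have "\<dots> = (real (Suc N))\<^sup>2 * HSQ X" by (simp add: power2_eq_square algebra_simps)
  finally show ?case .
qed

text \<open>The orbit sums are bounded in operator norm, so finitely many basis vectors contribute a
  constant C. On the remaining basis vectors B - A is small in Hilbert-Schmidt norm, and the crude
  growth N of the sums there is multiplied by that smallness.\<close>

lemma ergodic_weak:
  assumes V: "HS (B - A)" and \<epsilon>: "0 < \<epsilon>"
  shows "\<exists>C. \<forall>N. cmod (IP (B - A) (\<Sum>k<N. (conj_shift ^^ k) (B - A))) \<le> C + \<epsilon> * real N"
proof -
  let ?S = "\<lambda>N. \<Sum>k<N. (conj_shift ^^ k) (B - A)"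
  \<comment> \<open>In \<open>ip_bound_scaled\<close> with s = N t, a tail below epsilon / t
    contributes N epsilon and the orbit sum contributes N \<open>HSQ (B - A)\<close> / t; this t
    makes the latter at most N epsilon too.\<close>
  define t where "t = HSQ (B - A) / \<epsilon> + 1"
  have t: "0 < t" using hsq_nonneg[of E "B - A"] \<epsilon> by (simp add: t_def add_nonneg_pos)
  have ht: "HSQ (B - A) / t \<le> \<epsilon>"
  proof -
    have "HSQ (B - A) \<le> \<epsilon> * t" using \<epsilon> by (simp add: t_def distrib_left)
    then show ?thesis using t by (simp add: pos_divide_le_eq)
  qed
  obtain F where F: "finite F" "F \<subseteq> E" "hsq (E - F) (B - A) < \<epsilon> / t"
    using hsq_tail_small[OF V, of "\<epsilon> / t"] \<epsilon> t by auto
  have S: "HS (?S N)" for N by (intro hs_sum HS_conj_shift V)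
  define C where "C = (\<Sum>e\<in>F. norm ((B - A) \<cdot> e) * (2 * norm e))"
  have "cmod (IP (B - A) (?S N)) \<le> C + \<epsilon> * real N" for N
  proof (cases "N = 0")
    case True
    have "0 \<le> C" unfolding C_def by (intro sum_nonneg) simp
    with True show ?thesis by simp
  next
    case False
    have "cmod (\<Sum>e\<in>F. cinner ((B - A) \<cdot> e) (?S N \<cdot> e)) \<le> C"
      unfolding C_def
    proof (rule order_trans[OF norm_sum], rule sum_mono)
      fix e
      have "cmod (cinner ((B - A) \<cdot> e) (?S N \<cdot> e)) \<le> norm ((B - A) \<cdot> e) * norm (?S N \<cdot> e)"
        by (rule cinner_cauchy_schwarz)
      also have "\<dots> \<le> norm ((B - A) \<cdot> e) * (norm (?S N) * norm e)"
        by (intro mult_left_mono norm_app) simp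
      also have "\<dots> \<le> norm ((B - A) \<cdot> e) * (2 * norm e)"
        by (intro mult_left_mono mult_right_mono norm_sum_conj_shift) auto
      finally show "cmod (cinner ((B - A) \<cdot> e) (?S N \<cdot> e)) \<le> norm ((B - A) \<cdot> e) * (2 * norm e)" .
    qed
    moreover have "cmod (ip (E - F) (B - A) (?S N)) \<le> \<epsilon> * real N"
    proof -
      have s: "0 < real N * t" using False t by simp
      have "cmod (ip (E - F) (B - A) (?S N))
          \<le> (real N * t * hsq (E - F) (B - A) + hsq (E - F) (?S N) / (real N * t)) / 2"
        by (rule ip_bound_scaled[OF _ _ s]) (auto intro: hs_subset[OF V] hs_subset[OF S])
      also have "\<dots> \<le> (real N * t * (\<epsilon> / t) + (real N)\<^sup>2 * HSQ (B - A) / (real N * t)) / 2"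
        using F(3) s hsq_subset[OF S[of N], of "E - F"] HSQ_sum_le[OF V, of N]
        by (intro divide_right_mono add_mono mult_left_mono) auto
      also have "\<dots> = (real N * \<epsilon> + real N * (HSQ (B - A) / t)) / 2"
        using False t by (simp add: power2_eq_square)
      also have "\<dots> \<le> (real N * \<epsilon> + real N * \<epsilon>) / 2"
        by (intro divide_right_mono add_mono mult_left_mono ht) auto
      finally show ?thesis by (simp add: mult.commute)
    qed
    ultimately show ?thesis
      unfolding ip_remove_finite[OF V S F(1,2)]
      using norm_triangle_ineq[of "\<Sum>e\<in>F. cinner ((B - A) \<cdot> e) (?S N \<cdot> e)" "ip (E - F) (B - A) (?S N)"]
      by linarith
  qed
  then show ?thesis by blast
qed

text \<open>Correlations of orbit terms depend only on the difference of their indices, so the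
  growth of the square norm from N to N + 1 is controlled by <X, orbit sum>. This turns the weak
  estimate of \<open>ergodic_weak\<close> into one in norm.\<close>

lemma HSQ_sum_conj_shift:
  assumes X: "HS X"
  shows "HSQ (\<Sum>k<N. (conj_shift ^^ k) X) \<le> (\<Sum>m<N. 2 * cmod (IP X (\<Sum>k<Suc m. (conj_shift ^^ k) X)))"
proof (induction N)
  case 0
  show ?case by (simp add: hsq_def)
next
  case (Suc N)
  let ?S = "\<lambda>N. \<Sum>k<N. (conj_shift ^^ k) X"
  have S: "HS (?S N)" for N by (intro hs_sum HS_conj_shift X)
  have V: "HS ((conj_shift ^^ k) X)" for k by (rule HS_conj_shift[OF X])
  have g: "IP ((conj_shift ^^ j) X) ((conj_shift ^^ N) X) = IP X ((conj_shift ^^ (N - j)) X)" if "j \<le> N" for j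
  proof -
    have "(conj_shift ^^ N) X = (conj_shift ^^ j) ((conj_shift ^^ (N - j)) X)"
      using that by (simp add: funpow_add[symmetric, THEN fun_cong, unfolded o_apply])
    then show ?thesis using IP_conj_shift_power[OF X V] by simp
  qed
  have "IP ((conj_shift ^^ N) X) (?S N) = cnj (\<Sum>j<N. IP X ((conj_shift ^^ (N - j)) X))"
  proof -
    have "IP ((conj_shift ^^ N) X) (?S N) = (\<Sum>j<N. IP ((conj_shift ^^ N) X) ((conj_shift ^^ j) X))"
      by (rule ip_sum_right) (auto intro: V)
    also have "\<dots> = (\<Sum>j<N. cnj (IP X ((conj_shift ^^ (N - j)) X)))"
      by (intro sum.cong refl) (subst ip_commute, simp add: g)
    finally show ?thesis by simp
  qed
  then have "Re (IP (?S N) ((conj_shift ^^ N) X)) = Re (\<Sum>j<N. IP X ((conj_shift ^^ (N - j)) X))"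
    by (subst ip_commute) simp
  also have "(\<Sum>j<N. IP X ((conj_shift ^^ (N - j)) X)) = (\<Sum>j<N. IP X ((conj_shift ^^ Suc j) X))"
    by (rule sum.reindex_bij_witness[of _ "\<lambda>j. N - Suc j" "\<lambda>j. N - Suc j"])
      (auto simp: Suc_diff_Suc simp del: funpow.simps)
  \<comment> \<open>Shift 0 is missing from the sum. Subtracting it leaves - \<open>HSQ X\<close> in
    the end, a negative term that may be dropped.\<close>
  also have "\<dots> = IP X (?S (Suc N)) - IP X X"
    by (subst ip_sum_right) (auto simp: X V sum.lessThan_Suc_shift simp del: sum.lessThan_Suc)
  finally have r: "Re (IP (?S N) ((conj_shift ^^ N) X)) = Re (IP X (?S (Suc N))) - HSQ X"
    by (simp add: ip_self X)
  have "HSQ (?S (Suc N)) = HSQ (?S N) + 2 * Re (IP (?S N) ((conj_shift ^^ N) X)) + HSQ X"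
    using hsq_add[OF S V, of N N] by (simp add: HSQ_conj_shift_power X)
  also have "\<dots> \<le> HSQ (?S N) + 2 * cmod (IP X (?S (Suc N)))"
    unfolding r using complex_Re_le_cmod[of "IP X (?S (Suc N))"] hsq_nonneg[of E X] by simp
  also have "\<dots> \<le> (\<Sum>m<N. 2 * cmod (IP X (?S (Suc m)))) + 2 * cmod (IP X (?S (Suc N)))"
    using Suc by simp
  finally show ?case by simp
qed

text \<open>\<open>B - A\<close> is orthogonal to the fixed points of \<open>X \<mapsto> A\<^sup>* X B\<close>, since its orbit sums
  telescope. Hence its ergodic means tend to zero, that is, \<open>B - A\<close> is a limit of operators
  \<open>A Z - Z B\<close> with \<open>Z\<close> Hilbert-Schmidt.\<close>

lemma commutator_approximation:
  assumes V: "HS (B - A)" and \<delta>: "0 < \<delta>"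
  shows "\<exists>Z. HS Z \<and> HSQ (B - A - (A * Z - Z * B)) \<le> \<delta>"
proof -
  let ?T = "\<lambda>k. (conj_shift ^^ k) (B - A)"
  let ?S = "\<lambda>N. \<Sum>k<N. ?T k"
  obtain C where C: "\<And>N. cmod (IP (B - A) (?S N)) \<le> C + \<delta> / 4 * real N"
    using ergodic_weak[OF V, of "\<delta> / 4"] \<delta> by auto
  \<comment> \<open>N is so large that 4 C is at most N delta; then the constant of the weak
    estimate is absorbed, and the mean has square norm at most delta.\<close>
  obtain N where N: "4 * \<bar>C\<bar> / \<delta> + 1 < real N" using reals_Archimedean2 by blast
  have C0: "0 \<le> 4 * \<bar>C\<bar> / \<delta>" using \<delta> by simp
  have N0: "0 < real N" using N C0 by linarith
  have "4 * \<bar>C\<bar> < (real N - 1) * \<delta>"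
  proof -
    have "4 * \<bar>C\<bar> / \<delta> < real N - 1" using N by linarith
    then show ?thesis using \<delta> by (simp add: pos_divide_less_eq)
  qed
  then have C2: "4 * C \<le> real N * \<delta>" using \<delta> by (simp add: algebra_simps)
  have "HSQ (?S N) \<le> (\<Sum>m<N. 2 * (C + \<delta> / 4 * real N))"
  proof (rule order_trans[OF HSQ_sum_conj_shift[OF V]], rule sum_mono)
    fix m assume "m \<in> {..<N}"
    then have "\<delta> / 4 * real (Suc m) \<le> \<delta> / 4 * real N" using \<delta> by (intro mult_left_mono) auto
    then have "cmod (IP (B - A) (?S (Suc m))) \<le> C + \<delta> / 4 * real N"
      by (intro order_trans[OF C[of "Suc m"]] add_left_mono)
    then show "2 * cmod (IP (B - A) (?S (Suc m))) \<le> 2 * (C + \<delta> / 4 * real N)"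
      by (rule mult_left_mono) simp
  qed
  also have "\<dots> = real N * (2 * C + \<delta> / 2 * real N)" by (simp add: algebra_simps)
  also have "\<dots> \<le> real N * (\<delta> * real N)"
    using C2 by (intro mult_left_mono) (auto simp: algebra_simps)
  finally have "HSQ ((1 / real N) *\<^sub>R ?S N) \<le> \<delta>"
    unfolding hsq_scaleR using N0 by (simp add: power_divide power2_eq_square field_simps)
  \<comment> \<open>For each k the inner sum solves A Z - Z B = (B - A) - T^k (B - A), where T is
    \<open>conj_shift\<close>, because A (\<open>adj A\<close> T^j) - \<open>adj A\<close> T^j B =
    T^j - T^(j+1) on B - A. Averaging over k < N leaves the ergodic mean as the error.\<close>
  moreover define Z where "Z = (1 / real N) *\<^sub>R (\<Sum>k<N. \<Sum>j<k. adj A * ?T j)"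
  have "HS Z" unfolding Z_def by (intro hs_scaleR hs_sum hs_mult_left HS_conj_shift V)
  moreover have "B - A - (A * Z - Z * B) = (1 / real N) *\<^sub>R ?S N"
  proof -
    have inner: "A * (\<Sum>j<k. adj A * ?T j) - (\<Sum>j<k. adj A * ?T j) * B = B - A - ?T k" for k
    proof (induction k)
      case (Suc k)
      have "?T (Suc k) = adj A * ?T k * B" by (simp add: conj_shift_def)
      with Suc show ?case
        by (simp add: distrib_left distrib_right unitary_cancel A algebra_simps del: funpow.simps)
    qed simp
    have "A * (\<Sum>k<N. \<Sum>j<k. adj A * ?T j) - (\<Sum>k<N. \<Sum>j<k. adj A * ?T j) * B = (\<Sum>k<N. B - A - ?T k)"
      unfolding sum_distrib_left[of A] sum_distrib_right[of _ _ B] sum_subtractf[symmetric] inner[symmetric]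
      by (simp add: sum_distrib_left sum_distrib_right)
    also have "\<dots> = real N *\<^sub>R (B - A) - ?S N"
      by (simp only: sum_subtractf sum_constant_scaleR card_lessThan scaleR_diff_right)
    finally have "A * Z - Z * B = (1 / real N) *\<^sub>R (real N *\<^sub>R (B - A) - ?S N)"
      unfolding Z_def by (simp flip: scaleR_diff_right)
    also have "\<dots> = (B - A) - (1 / real N) *\<^sub>R ?S N" using N0 by (simp add: scaleR_diff_right)
    finally show ?thesis by simp
  qed
  ultimately show ?thesis by metis
qed

end

section \<open>Moments attached to the difference B - A\<close>

context unitary_pair_moments
begin

text \<open>Polarization reduces this to the diagonal case. The four square norms add up to four
  times the sum of those of X and Y, which gives the constant.\<close>

lemma moments_wmean:
  assumes X: "HS X" and Y: "HS Y" and r: "0 < r" "r < 1"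
  shows "moments (\<lambda>n. of_real (r ^ n) * wmean X Y n) ((HSQ X + HSQ Y) / 2)"
proof -
  let ?q = "\<lambda>c n. of_real (r ^ n) * wmean (X + c \<odot> Y) (X + c \<odot> Y) n"
  have q: "moments (\<lambda>n. a * ?q c n) (cmod a * (HSQ (X + c \<odot> Y) / 2))" for a c
    by (intro moments_cmult moments_wmean_diagonal hs_add hs_csc X Y r)
  have "moments (\<lambda>n. 1/4 * ?q 1 n + (-1/4) * ?q (-1) n + (-\<i>/4) * ?q \<i> n + \<i>/4 * ?q (-\<i>) n)
      (cmod (1/4) * (HSQ (X + 1 \<odot> Y) / 2) + cmod (-1/4) * (HSQ (X + (-1) \<odot> Y) / 2)
       + cmod (-\<i>/4) * (HSQ (X + \<i> \<odot> Y) / 2) + cmod (\<i>/4) * (HSQ (X + (-\<i>) \<odot> Y) / 2))"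
    by (intro moments_add q)
  moreover have "1/4 * ?q 1 n + (-1/4) * ?q (-1) n + (-\<i>/4) * ?q \<i> n + \<i>/4 * ?q (-\<i>) n
     = of_real (r ^ n) * wmean X Y n" for n
  proof -
    have "of_real (r ^ n) * wmean X Y n = of_real (r ^ n) * (4 * wmean X Y n) / 4" by simp
    then show ?thesis unfolding wmean_polarization[OF X Y] by (simp add: algebra_simps add_divide_distrib diff_divide_distrib)
  qed
  moreover have "cmod (1/4) * (HSQ (X + 1 \<odot> Y) / 2) + cmod (-1/4) * (HSQ (X + (-1) \<odot> Y) / 2)
       + cmod (-\<i>/4) * (HSQ (X + \<i> \<odot> Y) / 2) + cmod (\<i>/4) * (HSQ (X + (-\<i>) \<odot> Y) / 2) = (HSQ X + HSQ Y) / 2"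
    by (subst (1 2 3 4) hsq_add[OF X hs_csc[OF Y]]) (simp add: ip_csc_right hsq_csc norm_divide field_simps)
  ultimately show ?thesis by (simp only:)
qed

text \<open>The commutator part of B - A supplies coefficients of size O(1/n). The small rest Y has
  Abel moments of small norm for every r by \<open>moments_wmean\<close>, which is the hypothesis of
  \<open>moments_approximable\<close>.\<close>

theorem moments_wmean_difference:
  assumes V: "HS (B - A)" and X: "HS X"
  shows "\<exists>C. moments (wmean X (B - A)) C"
proof (rule moments_approximable)
  fix \<epsilon> :: real assume \<epsilon>: "0 < \<epsilon>"
  \<comment> \<open>t balances the sum of squares: X is scaled by the root of t and Y by its
    inverse, and both t \<open>HSQ X\<close> and \<open>HSQ Y\<close> / t are at most
    epsilon.\<close>
  define t where "t = \<epsilon> / (HSQ X + 1)"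
  have hx: "0 \<le> HSQ X" by (rule hsq_nonneg)
  have t: "0 < t" using \<epsilon> hx by (simp add: t_def)
  have tx: "t * HSQ X \<le> \<epsilon>" using \<epsilon> hx by (simp add: t_def field_simps)
  obtain Z where Z: "HS Z" "HSQ (B - A - (A * Z - Z * B)) \<le> \<epsilon> * t"
    using commutator_approximation[OF V, of "\<epsilon> * t"] \<epsilon> t by auto
  define Y where "Y = B - A - (A * Z - Z * B)"
  have AZ: "HS (A * Z - Z * B)" by (intro hs_diff HS_mult_right hs_mult_left Z)
  have Y: "HS Y" unfolding Y_def by (intro hs_diff[OF V AZ])
  show "\<exists>d C. (\<forall>n. cmod (d n) \<le> C / real (Suc n)) \<and>
      (\<forall>r. 0 < r \<longrightarrow> r < 1 \<longrightarrow> moments (\<lambda>n. of_real (r ^ n) * (wmean X (B - A) n - d n)) \<epsilon>)"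
  proof (intro exI conjI allI impI)
    show "cmod (wmean X (A * Z - Z * B) n) \<le> (HSQ X + HSQ Z) / real (Suc n)" for n
      by (rule wmean_commutator_bound[OF X Z(1)])
    fix r :: real assume r: "0 < r" "r < 1"
    let ?s = "complex_of_real (sqrt t)"
    have inv: "inverse ?s * cnj ?s = 1" using t by simp
    have n: "(cmod ?s)\<^sup>2 = t" using t by simp
    have n': "(cmod (inverse ?s))\<^sup>2 = inverse t" unfolding norm_inverse power_inverse n ..
    have "wmean X (B - A) n - wmean X (A * Z - Z * B) n = wmean (?s \<odot> X) (inverse ?s \<odot> Y) n" for n
    proof -
      have "wmean X (B - A) n = wmean X Y n + wmean X (A * Z - Z * B) n"
        using wmean_add_right[OF X Y AZ, of n] by (simp add: Y_def)
      moreover have "wmean X Y n = wmean (?s \<odot> X) (inverse ?s \<odot> Y) n"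
        unfolding wmean_csc_left wmean_csc_right mult.assoc[symmetric]
        by (simp only: mult.commute[of "cnj ?s"] inv mult_1_left)
      ultimately show ?thesis by simp
    qed
    then have "moments (\<lambda>n. of_real (r ^ n) * (wmean X (B - A) n - wmean X (A * Z - Z * B) n))
        ((HSQ (?s \<odot> X) + HSQ (inverse ?s \<odot> Y)) / 2)"
      using moments_wmean[OF hs_csc[OF X] hs_csc[OF Y] r] by simp
    moreover have "(HSQ (?s \<odot> X) + HSQ (inverse ?s \<odot> Y)) / 2 \<le> \<epsilon>"
    proof -
      have "inverse t * HSQ Y \<le> inverse t * (\<epsilon> * t)"
        using Z(2) t by (intro mult_left_mono) (auto simp: Y_def)
      also have "\<dots> = \<epsilon>" using t by simp
      finally show ?thesis unfolding hsq_csc n n' using add_mono[OF tx] by fastforce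
    qed
    ultimately show "moments (\<lambda>n. of_real (r ^ n) * (wmean X (B - A) n - wmean X (A * Z - Z * B) n)) \<epsilon>"
      by (rule moments_mono)
  qed
qed

end

section \<open>Second-order remainders of powers\<close>

definition power_deriv :: "'a::complex_hilbert cop \<Rightarrow> 'a cop \<Rightarrow> nat \<Rightarrow> 'a cop" where
  "power_deriv A V n = (\<Sum>j<n. A ^ j * V * A ^ (n - Suc j))"

definition power_remainder :: "'a::complex_hilbert cop \<Rightarrow> 'a cop \<Rightarrow> nat \<Rightarrow> 'a cop" where
  "power_remainder A B n = B ^ n - A ^ n - power_deriv A (B - A) n"

lemma power_diff_cop:
  fixes A B :: "'a::complex_hilbert cop"
  shows "B ^ n - A ^ n = (\<Sum>j<n. B ^ j * (B - A) * A ^ (n - Suc j))"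
proof (induction n)
  case (Suc n)
  have "(\<Sum>j<n. B ^ j * (B - A) * A ^ (Suc n - Suc j)) = (\<Sum>j<n. B ^ j * (B - A) * A ^ (n - Suc j)) * A"
    unfolding sum_distrib_right
  proof (intro sum.cong refl)
    fix j assume "j \<in> {..<n}"
    then have "Suc n - Suc j = Suc (n - Suc j)" by auto
    then show "B ^ j * (B - A) * A ^ (Suc n - Suc j) = B ^ j * (B - A) * A ^ (n - Suc j) * A"
      by (simp only: power_Suc2 mult.assoc)
  qed
  then have "(\<Sum>j<Suc n. B ^ j * (B - A) * A ^ (Suc n - Suc j)) = (B ^ n - A ^ n) * A + B ^ n * (B - A)"
    by (simp add: Suc)
  then show ?case by (simp add: algebra_simps power_commutes)
qed simp

text \<open>With powers of A on the left, a further power of A in front can be merged into the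
  word.\<close>

lemma power_diff_cop': "B ^ n - A ^ n = (\<Sum>j<n. A ^ j * (B - A) * B ^ (n - Suc j))"
  for A B :: "'a::complex_hilbert cop"
proof -
  have "B ^ n - A ^ n = - (\<Sum>j<n. A ^ j * (A - B) * B ^ (n - Suc j))"
    using power_diff_cop[of A n B] by (simp add: algebra_simps)
  also have "\<dots> = (\<Sum>j<n. A ^ j * (B - A) * B ^ (n - Suc j))"
    unfolding sum_negf[symmetric] by (intro sum.cong refl) (simp add: algebra_simps)
  finally show ?thesis .
qed

text \<open>The first-order difference has powers of B on the left, the derivative powers of A;
  subtracting leaves a second difference. Every term then has two factors B - A and is a product of
  two Hilbert-Schmidt operators.\<close>

lemma power_remainder_eq:
  "power_remainder A B n = (\<Sum>j<n. (B ^ j - A ^ j) * ((B - A) * A ^ (n - Suc j)))"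
  unfolding power_remainder_def power_deriv_def power_diff_cop[of B n A] sum_subtractf[symmetric]
  by (intro sum.cong refl) (simp add: left_diff_distrib mult.assoc)

lemma power_remainder_expand:
  "power_remainder A B n
     = (\<Sum>j<n. \<Sum>l<j. (B ^ l * (B - A) * A ^ (j - Suc l)) * ((B - A) * A ^ (n - Suc j)))"
  unfolding power_remainder_eq power_diff_cop[of B _ A] sum_distrib_right ..

lemma norm_word_le:
  fixes P V Q :: "'a::complex_hilbert cop"
  assumes "norm P \<le> 1" "norm Q \<le> 1"
  shows "norm (P * V * Q) \<le> norm V"
proof -
  have "norm (P * V * Q) \<le> norm (P * V) * norm Q" by (rule norm_mult_ineq)
  also have "\<dots> \<le> norm (P * V) * 1" using assms by (intro mult_left_mono) auto
  also have "norm (P * V) * 1 \<le> norm P * norm V" using norm_mult_ineq[of P V] by simp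
  also have "\<dots> \<le> 1 * norm V" using assms by (intro mult_right_mono) auto
  finally show ?thesis by simp
qed

lemma double_sum_le_square: "(\<Sum>j<n. \<Sum>l<j. c) \<le> (real n)\<^sup>2 * c" if "0 \<le> (c::real)"
proof -
  have "(\<Sum>j<n. \<Sum>l<j. c) \<le> (\<Sum>j<n. real n * c)"
    using that by (intro sum_mono) (auto intro!: mult_right_mono)
  then show ?thesis by (simp add: power2_eq_square)
qed

lemma norm_power_remainder:
  assumes A: "norm A \<le> 1" and B: "norm B \<le> 1"
  shows "norm (power_remainder A B n) \<le> (real n)\<^sup>2 * (norm (B - A))\<^sup>2"
proof -
  have "norm (power_remainder A B n) \<le> (\<Sum>j<n. \<Sum>l<j. (norm (B - A))\<^sup>2)"
    unfolding power_remainder_expand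
  proof (rule order_trans[OF norm_sum], rule sum_mono, rule order_trans[OF norm_sum], rule sum_mono)
    fix j l
    have "norm ((B ^ l * (B - A) * A ^ (j - Suc l)) * ((B - A) * A ^ (n - Suc j)))
      \<le> norm (B ^ l * (B - A) * A ^ (j - Suc l)) * norm (1 * (B - A) * A ^ (n - Suc j))"
      using norm_mult_ineq by simp
    also have "\<dots> \<le> norm (B - A) * norm (B - A)"
      by (intro mult_mono norm_word_le norm_power_contraction A B norm_one_cop) auto
    finally show "norm ((B ^ l * (B - A) * A ^ (j - Suc l)) * ((B - A) * A ^ (n - Suc j))) \<le> (norm (B - A))\<^sup>2"
      by (simp add: power2_eq_square)
  qed
  also have "\<dots> \<le> (real n)\<^sup>2 * (norm (B - A))\<^sup>2" by (rule double_sum_le_square) simp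
  finally show ?thesis .
qed

lemma norm_power_deriv:
  assumes A: "norm A \<le> 1"
  shows "norm (power_deriv A V n) \<le> real n * norm V"
proof -
  have "norm (power_deriv A V n) \<le> (\<Sum>j<n. norm V)"
    unfolding power_deriv_def
    by (rule order_trans[OF norm_sum], rule sum_mono, intro norm_word_le norm_power_contraction A)
  then show ?thesis by simp
qed

lemma power_deriv_scaleR: "power_deriv A (s *\<^sub>R V) n = s *\<^sub>R power_deriv A V n"
  by (simp add: power_deriv_def scaleR_sum_right)

lemma weighted_summable:
  assumes a: "summable (\<lambda>k. (real k)\<^sup>2 * cmod (a k))"
  shows "summable (\<lambda>k. real k * cmod (a k))" "summable (\<lambda>k. cmod (a k))"
proof -
  show a1: "summable (\<lambda>k. real k * cmod (a k))"
  proof (rule summable_comparison_test[OF _ a], intro exI allI impI)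
    fix k
    have "real k \<le> (real k)\<^sup>2" by (cases k) (simp_all add: power2_eq_square)
    then show "norm (real k * cmod (a k)) \<le> (real k)\<^sup>2 * cmod (a k)" by (simp add: mult_right_mono)
  qed
  show "summable (\<lambda>k. cmod (a k))"
  proof (rule summable_comparison_test[OF _ a1], intro exI[of _ 1] allI impI)
    fix k :: nat assume "1 \<le> k"
    then have "1 * cmod (a k) \<le> real k * cmod (a k)" by (intro mult_right_mono) auto
    then show "norm (cmod (a k)) \<le> real k * cmod (a k)" by simp
  qed
qed

lemma norm_convex_path:
  fixes A B :: "'a::complex_hilbert cop"
  assumes A: "norm A \<le> 1" and B: "norm B \<le> 1" and s: "0 \<le> s" "s \<le> 1"
  shows "norm (A + s *\<^sub>R (B - A)) \<le> 1"
proof -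
  have "A + s *\<^sub>R (B - A) = (1 - s) *\<^sub>R A + s *\<^sub>R B" by (simp add: algebra_simps)
  then have "norm (A + s *\<^sub>R (B - A)) \<le> norm ((1 - s) *\<^sub>R A) + norm (s *\<^sub>R B)"
    by (simp only: norm_triangle_ineq)
  also have "\<dots> \<le> (1 - s) * 1 + s * 1"
    using s A B by (intro add_mono) (auto intro: mult_left_le)
  finally show ?thesis by simp
qed

text \<open>The second-order remainder of the k-th power is at most k^2 s^2 |B - A|^2. It is
  summable against a, so the error of the linear approximation is O(s^2).\<close>

lemma power_path_derivative:
  fixes A B :: "'a::complex_hilbert cop"
  assumes A: "norm A \<le> 1" and B: "norm B \<le> 1" and a: "summable (\<lambda>k. (real k)\<^sup>2 * cmod (a k))"
  shows "((\<lambda>s. \<Sum>k. a k \<odot> (A + s *\<^sub>R (B - A)) ^ k) has_vector_derivative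
     (\<Sum>k. a k \<odot> power_deriv A (B - A) k)) (at 0 within {0..1})"
    and "summable (\<lambda>k. a k \<odot> power_deriv A (B - A) k)"
    and "\<And>C :: 'a cop. norm C \<le> 1 \<Longrightarrow> summable (\<lambda>k. a k \<odot> C ^ k)"
proof -
  note a1 = weighted_summable(1)[OF a] and a0 = weighted_summable(2)[OF a]
  show sC: "summable (\<lambda>k. a k \<odot> C ^ k)" if "norm C \<le> 1" for C :: "'a cop"
    by (rule summable_comparison_test[OF _ a0])
      (use norm_power_contraction[OF that] in \<open>auto simp: norm_csc mult_left_le\<close>)
  show sD: "summable (\<lambda>k. a k \<odot> power_deriv A (B - A) k)"
  proof (rule summable_comparison_test[OF _ summable_mult2[OF a1, of "norm (B - A)"]], intro exI allI impI)
    fix k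
    show "norm (a k \<odot> power_deriv A (B - A) k) \<le> real k * cmod (a k) * norm (B - A)"
      using mult_left_mono[OF norm_power_deriv[OF A, of "B - A" k], of "cmod (a k)"]
      by (simp add: norm_csc mult_ac)
  qed
  let ?U = "\<lambda>s. A + s *\<^sub>R (B - A)"
  let ?F = "\<lambda>s. \<Sum>k. a k \<odot> ?U s ^ k" and ?L = "\<Sum>k. a k \<odot> power_deriv A (B - A) k"
  define K where "K = (norm (B - A))\<^sup>2 * (\<Sum>k. (real k)\<^sup>2 * cmod (a k))"
  note Us = norm_convex_path[OF A B]
  have main: "norm (?F s - (?F 0 + s *\<^sub>R ?L)) \<le> K * s\<^sup>2" if s: "0 \<le> s" "s \<le> 1" for s
  proof -
    \<comment> \<open>The derivative is linear in the direction, so the remainder along the path is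
      that of the pair A, \<open>?U s\<close>, whose difference is s (B - A).\<close>
    have rem: "?U s ^ k - A ^ k - s *\<^sub>R power_deriv A (B - A) k = power_remainder A (?U s) k" for k
      by (simp add: power_remainder_def power_deriv_scaleR)
    have "(\<lambda>k. a k \<odot> ?U s ^ k - (a k \<odot> A ^ k + s *\<^sub>R (a k \<odot> power_deriv A (B - A) k))) sums
        (?F s - ((\<Sum>k. a k \<odot> A ^ k) + s *\<^sub>R ?L))"
      by (intro sums_diff sums_add sums_scaleR_right summable_sums sC sD Us s A)
    moreover have "a k \<odot> ?U s ^ k - (a k \<odot> A ^ k + s *\<^sub>R (a k \<odot> power_deriv A (B - A) k))
        = a k \<odot> power_remainder A (?U s) k" for k
      unfolding rem[symmetric]
      by (simp add: csc_diff_right csc_csc mult.commute flip: csc_of_real)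
    ultimately have sm: "(\<lambda>k. a k \<odot> power_remainder A (?U s) k) sums (?F s - (?F 0 + s *\<^sub>R ?L))" by simp
    have le: "norm (a k \<odot> power_remainder A (?U s) k) \<le> (norm (B - A))\<^sup>2 * s\<^sup>2 * ((real k)\<^sup>2 * cmod (a k))" for k
    proof -
      have "norm (power_remainder A (?U s) k) \<le> (real k)\<^sup>2 * (s\<^sup>2 * (norm (B - A))\<^sup>2)"
        using norm_power_remainder[OF A Us[OF s], of k] by (simp add: power_mult_distrib)
      then show ?thesis
        using mult_left_mono[of _ _ "cmod (a k)"] by (fastforce simp: norm_csc mult_ac)
    qed
    have "norm (\<Sum>k. a k \<odot> power_remainder A (?U s) k) \<le> (\<Sum>k. (norm (B - A))\<^sup>2 * s\<^sup>2 * ((real k)\<^sup>2 * cmod (a k)))"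
      by (rule norm_suminf_le[OF le]) (intro summable_mult a)
    then show ?thesis
      using sums_unique[OF sm] suminf_mult[OF a, of "(norm (B - A))\<^sup>2 * s\<^sup>2"] by (simp add: K_def mult_ac)
  qed
  show "(?F has_vector_derivative ?L) (at 0 within {0..1})"
    unfolding has_vector_derivative_def has_derivative_within
  proof (intro conjI bounded_linear_scaleR_left)
    show "((\<lambda>y. (1 / norm (y - 0)) *\<^sub>R (?F y - (?F 0 + (y - 0) *\<^sub>R ?L))) \<longlongrightarrow> 0) (at 0 within {0..1})"
    proof (rule Lim_null_comparison)
      show "\<forall>\<^sub>F y in at 0 within {0..1}. norm ((1 / norm (y - 0)) *\<^sub>R (?F y - (?F 0 + (y - 0) *\<^sub>R ?L))) \<le> K * \<bar>y\<bar>"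
        unfolding eventually_at_filter
      proof (intro always_eventually allI impI)
        fix y :: real assume y: "y \<noteq> 0" "y \<in> {0..1}"
        then have y: "0 < y" "y \<le> 1" by auto
        have "(1 / y) * norm (?F y - (?F 0 + y *\<^sub>R ?L)) \<le> (1 / y) * (K * y\<^sup>2)"
          using y by (intro mult_left_mono main) auto
        then show "norm ((1 / norm (y - 0)) *\<^sub>R (?F y - (?F 0 + (y - 0) *\<^sub>R ?L))) \<le> K * \<bar>y\<bar>"
          using y by (simp add: power2_eq_square)
      qed
      have "((\<lambda>y::real. K * \<bar>y\<bar>) \<longlongrightarrow> K * \<bar>0\<bar>) (at 0 within {0..1})" by (intro tendsto_intros)
      then show "((\<lambda>y::real. K * \<bar>y\<bar>) \<longlongrightarrow> 0) (at 0 within {0..1})" by simp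
    qed
  qed
qed

text \<open>Reversing j turns the index into i + b with i + b < n - 1, and the value k is attained k
  + 1 times.\<close>

lemma triangular_sum:
  fixes f :: "nat \<Rightarrow> complex"
  shows "(\<Sum>j<n. \<Sum>b<j. f (n - Suc j + b)) = (\<Sum>k<n - 1. of_nat (Suc k) * f k)"
proof -
  have "(\<Sum>j<n. \<Sum>b<j. f (n - Suc j + b)) = (\<Sum>i<n. \<Sum>b<n - Suc i. f (i + b))"
    by (rule sum.reindex_bij_witness[of _ "\<lambda>i. n - Suc i" "\<lambda>i. n - Suc i"]) auto
  also have "\<dots> = (\<Sum>k<n - 1. of_nat (Suc k) * f k)"
  proof (induction n)
    case (Suc n)
    have "(\<Sum>i<n. \<Sum>b<n - i. f (i + b)) = (\<Sum>i<n. (\<Sum>b<n - Suc i. f (i + b)) + f (n - 1))"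
    proof (intro sum.cong refl)
      fix i assume i: "i \<in> {..<n}"
      then have e: "n - i = Suc (n - Suc i)" by auto
      have "(\<Sum>b<n - i. f (i + b)) = (\<Sum>b<n - Suc i. f (i + b)) + f (i + (n - Suc i))"
        unfolding e by simp
      moreover have "i + (n - Suc i) = n - 1" using i by auto
      ultimately show "(\<Sum>b<n - i. f (i + b)) = (\<Sum>b<n - Suc i. f (i + b)) + f (n - 1)" by simp
    qed
    also have "\<dots> = (\<Sum>k<n - 1. of_nat (Suc k) * f k) + of_nat n * f (n - 1)"
      by (simp add: sum.distrib Suc)
    also have "\<dots> = (\<Sum>k<n. of_nat (Suc k) * f k)"
      by (cases n) simp_all
    finally show ?case by simp
  qed simp
  finally show ?thesis .
qed

section \<open>Traces of the remainders\<close>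

context unitary_pair
begin

lemma tc_power_remainder:
  assumes V: "HS (B - A)"
  shows "tc (power_remainder A B n) ((real n)\<^sup>2 * HSQ (B - A))"
proof (rule tc_mono)
  show "tc (power_remainder A B n) (\<Sum>j<n. \<Sum>l<j. HSQ (B - A))"
    unfolding power_remainder_expand
  proof (intro tc_sum)
    fix j l
    let ?X = "B ^ l * (B - A) * A ^ (j - Suc l)" and ?Y = "(B - A) * A ^ (n - Suc j)"
    have nA: "norm (A ^ k) \<le> 1" and nB: "norm (B ^ k) \<le> 1" for k
      by (intro norm_power_contraction norm_unitary A B)+
    have "HSQ ?X \<le> HSQ (B ^ l * (B - A))" "HSQ (B ^ l * (B - A)) \<le> HSQ (B - A)" "HSQ ?Y \<le> HSQ (B - A)"
      by (intro HSQ_contract_left HSQ_contract_right hs_mult_left V nA nB)+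
    moreover have "tc (?X * ?Y) ((HSQ ?X + HSQ ?Y) / 2)"
      by (intro tc_mult HS_mult_right hs_mult_left V)
    ultimately show "tc (?X * ?Y) (HSQ (B - A))" by (elim tc_mono) simp
  qed
  show "(\<Sum>j<n. \<Sum>l<j. HSQ (B - A)) \<le> (real n)\<^sup>2 * HSQ (B - A)"
    by (rule double_sum_le_square[OF hsq_nonneg])
qed

lemma HS_power_diff: "HS (B - A) \<Longrightarrow> HS (B ^ n - A ^ n)"
  unfolding power_diff_cop by (intro hs_sum HS_mult_right hs_mult_left)

text \<open>Cyclicity moves the factor \<open>(B - A) * A ^ c\<close> to the front, where its power
  of A merges with those of \<open>power_diff_cop'\<close>. What remains is tr ((B - A) X) =
  <\<open>adj (B - A)\<close>, X>, and equal words are counted by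
  \<open>triangular_sum\<close>.\<close>

lemma tr_power_remainder:
  assumes V: "HS (B - A)"
  shows "tr (power_remainder A B n)
     = (\<Sum>k<n - 1. of_nat (Suc k) * IP (adj (B - A)) (A ^ k * (B - A) * B ^ (n - 2 - k)))"
proof -
  define f where "f k = IP (adj (B - A)) (A ^ k * (B - A) * B ^ (n - 2 - k))" for k
  have "tr (power_remainder A B n) = (\<Sum>j<n. tr ((B ^ j - A ^ j) * ((B - A) * A ^ (n - Suc j))))"
    unfolding power_remainder_eq
    by (rule tr_sum, rule tc_mult) (intro HS_power_diff HS_mult_right V)+
  also have "\<dots> = (\<Sum>j<n. \<Sum>b<j. f (n - Suc j + b))"
  proof (intro sum.cong refl)
    fix j assume j: "j \<in> {..<n}"
    let ?c = "n - Suc j"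
    have "tr ((B ^ j - A ^ j) * ((B - A) * A ^ ?c)) = tr (((B - A) * A ^ ?c) * (B ^ j - A ^ j))"
      by (intro tr_mult_commute HS_power_diff HS_mult_right V)
    also have "\<dots> = IP (adj (B - A)) (A ^ ?c * (B ^ j - A ^ j))"
      unfolding mult.assoc tr_mult ..
    also have "\<dots> = IP (adj (B - A)) (\<Sum>b<j. A ^ ?c * (A ^ b * (B - A) * B ^ (j - Suc b)))"
      unfolding power_diff_cop'[of B j A] sum_distrib_left ..
    also have "\<dots> = (\<Sum>b<j. IP (adj (B - A)) (A ^ ?c * (A ^ b * (B - A) * B ^ (j - Suc b))))"
      by (intro ip_sum_right HS_adj hs_mult_left HS_mult_right V)
    also have "\<dots> = (\<Sum>b<j. f (?c + b))"
    proof (intro sum.cong refl)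
      fix b assume "b \<in> {..<j}"
      then have "n - 2 - (?c + b) = j - Suc b" using j by auto
      then show "IP (adj (B - A)) (A ^ ?c * (A ^ b * (B - A) * B ^ (j - Suc b))) = f (?c + b)"
        by (simp add: f_def power_add mult.assoc)
    qed
    finally show "tr ((B ^ j - A ^ j) * ((B - A) * A ^ ?c)) = (\<Sum>b<j. f (?c + b))" .
  qed
  also have "\<dots> = (\<Sum>k<n - 1. of_nat (Suc k) * f k)" by (rule triangular_sum)
  finally show ?thesis unfolding f_def .
qed

end

context unitary_pair_moments
begin

lemma tr_power_remainder_wmean:
  assumes "HS (B - A)"
  shows "tr (power_remainder A B (m + 2)) = of_nat (Suc m) * of_nat (m + 2) * wmean (adj (B - A)) (B - A) m"
proof -
  let ?f = "\<lambda>k. IP (adj (B - A)) (A ^ k * (B - A) * B ^ (m - k))"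
  have nz: "(of_nat (Suc m) * of_nat (m + 2) :: complex) \<noteq> 0"
    by (simp only: mult_eq_0_iff of_nat_eq_0_iff) simp
  have "wmean (adj (B - A)) (B - A) m = (\<Sum>k\<le>m. of_nat (Suc k) * ?f k / (of_nat (Suc m) * of_nat (m + 2)))"
    unfolding wmean_def by (intro sum.cong refl) (simp del: of_nat_Suc of_nat_add)
  then have "of_nat (Suc m) * of_nat (m + 2) * wmean (adj (B - A)) (B - A) m = (\<Sum>k\<le>m. of_nat (Suc k) * ?f k)"
    using nz by (simp only: sum_divide_distrib[symmetric]) (simp del: of_nat_Suc of_nat_add)
  then show ?thesis
    unfolding tr_power_remainder[OF assms] by (simp add: lessThan_Suc_atMost del: of_nat_Suc of_nat_add)
qed

text \<open>The trace is n (n - 1) q (n - 2) with q a moment sequence. Writing n (n - 1) = n^2 (1 -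
  1/n), the part with 1/n has size O(1/n) and is a moment sequence by \<open>moments_tail\<close>.
  For n < 2 both sides vanish.\<close>

lemma spectral_shift_exists:
  assumes V: "HS (B - A)"
  shows "\<exists>\<eta>. integrable M \<eta> \<and>
    (\<forall>n. of_nat (n\<^sup>2) * (\<integral>x. w x ^ n * \<eta> x \<partial>M) = tr (power_remainder A B n))"
proof -
  define q where "q = wmean (adj (B - A)) (B - A)"
  obtain C where C: "moments q C"
    unfolding q_def using moments_wmean_difference[OF V HS_adj[OF V]] by blast
  obtain C' where C': "moments (\<lambda>n. if n < 2 then 0 else q (n - 2)) C'"
    using moments_shift[OF C, of 2] by blast
  define e where "e n = (if n < 2 then 0 else - q (n - 2) / of_nat n)" for n
  have qC: "cmod (q n) \<le> C" for n by (rule moments_coeff_bound[OF C])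
  then have C0: "0 \<le> C" using norm_ge_zero order_trans by blast
  \<comment> \<open>C / n is at most 2 C / (n + 1); the added 1 makes the constant positive, as
    \<open>moments_tail\<close> demands.\<close>
  have "cmod (e n) \<le> (2 * C + 1) / real (Suc n)" for n
  proof (cases "n < 2")
    case False
    have "cmod (e n) \<le> C / real n" using False qC[of "n - 2"] by (simp add: e_def norm_divide divide_right_mono)
    also have "\<dots> \<le> (2 * C + 1) / real (Suc n)"
    proof -
      have "C * 2 \<le> C * real n" using False C0 by (intro mult_left_mono) auto
      then have "C * real (Suc n) \<le> (2 * C + 1) * real n" using False C0 by (simp add: algebra_simps)
      then show ?thesis using False by (simp add: field_simps)
    qed
    finally show ?thesis .
  qed (use C0 in \<open>simp add: e_def\<close>)
  then have "moments (\<lambda>n. if Suc n < 2 ^ 0 then 0 else e n) (4 * (2 * C + 1) * (3/4) ^ 0)"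
    by (rule moments_tail) (use C0 in simp)
  then have "moments e (4 * (2 * C + 1))" by simp
  from moments_add[OF C' this]
  obtain \<eta> where \<eta>: "integrable M \<eta>"
    "\<And>n. (\<integral>x. w x ^ n * \<eta> x \<partial>M) = (if n < 2 then 0 else q (n - 2)) + e n"
    unfolding moments_def by blast
  have "of_nat (n\<^sup>2) * (\<integral>x. w x ^ n * \<eta> x \<partial>M) = tr (power_remainder A B n)" for n
  proof (cases "n < 2")
    case True
    then have "n = 0 \<or> n = 1" by auto
    then have "tr (power_remainder A B n) = 0" unfolding tr_power_remainder[OF V] by auto
    then show ?thesis using True by (simp add: \<eta> e_def)
  next
    case False
    then obtain m where m: "n = m + 2" by (metis add.commute le_Suc_ex not_less)
    have nz: "(of_nat (m + 2) :: complex) \<noteq> 0" by (simp only: of_nat_eq_0_iff)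
    have gen: "N * N * (u + - u / N) = N * (N - 1) * u" if "N \<noteq> 0" for N u :: complex
      using that by (simp add: field_simps)
    have "(\<integral>x. w x ^ n * \<eta> x \<partial>M) = q m + - q m / of_nat (m + 2)"
      using \<eta>(2)[of n] unfolding e_def m by (simp del: of_nat_add)
    then have "of_nat (n\<^sup>2) * (\<integral>x. w x ^ n * \<eta> x \<partial>M) = of_nat (m + 2) * (of_nat (m + 2) - 1) * q m"
      unfolding m power2_eq_square of_nat_mult using gen[OF nz, of "q m"] by (simp only:)
    also have "\<dots> = of_nat (Suc m) * of_nat (m + 2) * q m" by simp
    finally show ?thesis unfolding m tr_power_remainder_wmean[OF V] q_def .
  qed
  with \<eta>(1) show ?thesis by blast
qed

text \<open>Trace norms and moments of the k-th term are both of order k^2 |a k|, which is summable;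
  this justifies exchanging the series with the trace and with the integral.\<close>

lemma trace_formula_series:
  assumes V: "HS (B - A)" and \<eta>: "integrable M \<eta>"
    and mom: "\<And>n. of_nat (n\<^sup>2) * (\<integral>x. w x ^ n * \<eta> x \<partial>M) = tr (power_remainder A B n)"
    and a: "summable (\<lambda>k. (real k)\<^sup>2 * cmod (a k))"
  shows "tc (\<Sum>k. a k \<odot> power_remainder A B k) (\<Sum>k. cmod (a k) * ((real k)\<^sup>2 * HSQ (B - A)))"
    and "tr (\<Sum>k. a k \<odot> power_remainder A B k) = (\<integral>x. (\<Sum>k. of_nat (k\<^sup>2) * a k * w x ^ k) * \<eta> x \<partial>M)"
proof -
  have tc: "tc (a k \<odot> power_remainder A B k) (cmod (a k) * ((real k)\<^sup>2 * HSQ (B - A)))" for k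
    by (intro tc_csc tc_power_remainder V)
  have s1: "summable (\<lambda>k. cmod (a k) * ((real k)\<^sup>2 * HSQ (B - A)))"
    using summable_mult2[OF a, of "HSQ (B - A)"] by (simp add: mult_ac)
  have s2: "summable (\<lambda>k. a k \<odot> power_remainder A B k)"
  proof (rule summable_comparison_test[OF _ summable_mult2[OF a, of "(norm (B - A))\<^sup>2"]], intro exI allI impI)
    fix k
    show "norm (a k \<odot> power_remainder A B k) \<le> (real k)\<^sup>2 * cmod (a k) * (norm (B - A))\<^sup>2"
      using mult_left_mono[OF norm_power_remainder[OF norm_unitary[OF A] norm_unitary[OF B], of k], of "cmod (a k)"]
      by (simp add: norm_csc mult_ac)
  qed
  show "tc (\<Sum>k. a k \<odot> power_remainder A B k) (\<Sum>k. cmod (a k) * ((real k)\<^sup>2 * HSQ (B - A)))"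
    by (rule tc_suminf[OF tc s1 s2])
  have nrm: "norm (of_nat (k\<^sup>2) * a k * (w x ^ k * \<eta> x)) = (real k)\<^sup>2 * cmod (a k) * norm (\<eta> x)" for k x
    by (simp add: norm_mult norm_power)
  have "tr (\<Sum>k. a k \<odot> power_remainder A B k) = (\<Sum>k. tr (a k \<odot> power_remainder A B k))"
    by (rule sums_unique[OF tr_suminf[OF tc s1 s2]])
  also have "\<dots> = (\<Sum>k. \<integral>x. of_nat (k\<^sup>2) * a k * (w x ^ k * \<eta> x) \<partial>M)"
  proof (intro suminf_cong)
    fix k
    have "(\<integral>x. of_nat (k\<^sup>2) * a k * (w x ^ k * \<eta> x) \<partial>M) = of_nat (k\<^sup>2) * a k * (\<integral>x. w x ^ k * \<eta> x \<partial>M)"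
      by (rule integral_mult_right_zero)
    also have "\<dots> = a k * (of_nat (k\<^sup>2) * (\<integral>x. w x ^ k * \<eta> x \<partial>M))" by simp
    finally show "tr (a k \<odot> power_remainder A B k) = (\<integral>x. of_nat (k\<^sup>2) * a k * (w x ^ k * \<eta> x) \<partial>M)"
      by (simp only: mom tr_csc)
  qed
  also have "\<dots> = (\<integral>x. (\<Sum>k. of_nat (k\<^sup>2) * a k * (w x ^ k * \<eta> x)) \<partial>M)"
  proof (rule integral_suminf[symmetric])
    show "integrable M (\<lambda>x. of_nat (k\<^sup>2) * a k * (w x ^ k * \<eta> x))" for k
      by (intro integrable_mult_right integrable_w_mult \<eta>)
    show "AE x in M. summable (\<lambda>k. norm (of_nat (k\<^sup>2) * a k * (w x ^ k * \<eta> x)))"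
      unfolding nrm by (intro AE_I2 summable_mult2 a)
    show "summable (\<lambda>k. \<integral>x. norm (of_nat (k\<^sup>2) * a k * (w x ^ k * \<eta> x)) \<partial>M)"
      unfolding nrm by (simp add: summable_mult2[OF a])
  qed
  also have "\<dots> = (\<integral>x. (\<Sum>k. of_nat (k\<^sup>2) * a k * w x ^ k) * \<eta> x \<partial>M)"
  proof (rule Bochner_Integration.integral_cong[OF refl])
    fix x
    have "summable (\<lambda>k. of_nat (k\<^sup>2) * a k * w x ^ k)"
      by (rule summable_comparison_test[OF _ a]) (auto simp: norm_mult norm_power)
    from suminf_mult2[OF this, of "\<eta> x"]
    show "(\<Sum>k. of_nat (k\<^sup>2) * a k * (w x ^ k * \<eta> x)) = (\<Sum>k. of_nat (k\<^sup>2) * a k * w x ^ k) * \<eta> x"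
      by (simp add: mult.assoc)
  qed
  finally show "tr (\<Sum>k. a k \<odot> power_remainder A B k) = (\<integral>x. (\<Sum>k. of_nat (k\<^sup>2) * a k * w x ^ k) * \<eta> x \<partial>M)" .
qed

end

section \<open>Resolvents and Cayley transforms of self-adjoint operators\<close>

lemma unitaryI:
  assumes iso: "\<And>x. norm (U \<cdot> x) = norm x" and surj: "\<And>y. \<exists>x. U \<cdot> x = y"
  shows "unitary U"
proof -
  have "cinner x ((adj U * U - 1) \<cdot> x) = 0" for x
    by (simp add: app_diff_left app_times cinner_diff_right cinner_adj_right cinner_norm iso)
  from quadratic_form_zero[OF this] have UU: "adj U * U = 1" by simp
  have "U * adj U = 1"
  proof (rule cop_eqI)
    fix y
    obtain x where x: "y = U \<cdot> x" using surj by metis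
    have "(U * adj U) \<cdot> y = U \<cdot> ((adj U * U) \<cdot> x)" by (simp add: x app_times)
    then show "(U * adj U) \<cdot> y = 1 \<cdot> y" by (simp add: UU x)
  qed
  with UU show ?thesis by (simp add: unitary_def)
qed

lemma orthogonal_dense_zero:
  fixes w :: "'a::complex_hilbert"
  assumes S: "closure S = UNIV" and z: "\<And>x. x \<in> S \<Longrightarrow> cinner w x = 0"
  shows "w = 0"
proof -
  have "w \<in> closure S" using S by simp
  then obtain u where u: "\<And>n. u n \<in> S" "u \<longlonglongrightarrow> w" by (meson closure_sequential)
  have "(\<lambda>n. cinner w (u n)) \<longlonglongrightarrow> cinner w w" by (intro tendsto_intros u)
  then have "cinner w w = 0" by (simp add: z u LIMSEQ_const_iff)
  then show ?thesis by simp
qed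

section \<open>Resolvents and Cayley transform of one self-adjoint operator\<close>

locale selfadjoint_op =
  fixes T :: "'a::complex_hilbert unbounded_op"
  assumes sa: "selfadjoint T"
begin

abbreviation D where "D \<equiv> dom T"
abbreviation ap where "ap x \<equiv> the (T x)"

lemma sub: "complex_vector.subspace D"
  and ap_add: "x \<in> D \<Longrightarrow> y \<in> D \<Longrightarrow> ap (x + y) = ap x + ap y"
  and ap_scale: "x \<in> D \<Longrightarrow> ap (c *\<^sub>C x) = c *\<^sub>C ap x"
  and dense: "closure D = UNIV"
  using sa by (auto simp: selfadjoint_def linear_op_def)

lemma D_closed: "x \<in> D \<Longrightarrow> y \<in> D \<Longrightarrow> x + y \<in> D" "x \<in> D \<Longrightarrow> c *\<^sub>C x \<in> D"
  "x \<in> D \<Longrightarrow> y \<in> D \<Longrightarrow> x - y \<in> D"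
  by (rule complex_vector.subspace_add[OF sub] complex_vector.subspace_scale[OF sub]
      complex_vector.subspace_diff[OF sub]; assumption)+

lemma ap_diff: "x \<in> D \<Longrightarrow> y \<in> D \<Longrightarrow> ap (x - y) = ap x - ap y"
  using ap_add[of x "(-1) *\<^sub>C y"] ap_scale[of y "-1"] D_closed(2)[of y "-1"] by (simp add: scaleC_minus_one)

text \<open>\<open>op_adjoint T = T\<close> read in both directions: the adjoint extends T, which is
  symmetry, and T extends the adjoint. Density makes the vector w of the definition unique.\<close>

lemma adjoint_cases:
  shows symmetric: "y \<in> D \<Longrightarrow> x \<in> D \<Longrightarrow> cinner y (ap x) = cinner (ap y) x"
    and adjoint_mem: "(\<And>x. x \<in> D \<Longrightarrow> cinner y (ap x) = cinner w x) \<Longrightarrow> y \<in> D \<and> ap y = w"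
proof -
  have adj: "op_adjoint T y = T y" for y using sa by (simp add: selfadjoint_def)
  have uniq: "w = w'" if "\<forall>x\<in>D. cinner y (ap x) = cinner w x" "\<forall>x\<in>D. cinner y (ap x) = cinner w' x" for w w' y
  proof -
    have "w - w' = 0"
      by (rule orthogonal_dense_zero[OF dense]) (use that in \<open>simp add: cinner_diff_left\<close>)
    then show ?thesis by simp
  qed
  have the: "(THE w. \<forall>x\<in>D. cinner y (ap x) = cinner w x) = w" if "\<forall>x\<in>D. cinner y (ap x) = cinner w x" for y w
    by (rule the_equality[where P = "\<lambda>w. \<forall>x\<in>D. cinner y (ap x) = cinner w x", OF that uniq[OF _ that]])
  show "y \<in> D \<and> ap y = w" if *: "\<And>x. x \<in> D \<Longrightarrow> cinner y (ap x) = cinner w x"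
  proof -
    have P: "\<forall>x\<in>D. cinner y (ap x) = cinner w x" using * by blast
    then have "op_adjoint T y = Some w" unfolding op_adjoint_def using the[OF P] by auto
    then show ?thesis by (auto simp: adj)
  qed
  show "cinner y (ap x) = cinner (ap y) x" if y: "y \<in> D" and x: "x \<in> D" for x y
  proof -
    have "op_adjoint T y \<noteq> None" using y by (simp add: adj domIff)
    then obtain w where w: "\<forall>x\<in>D. cinner y (ap x) = cinner w x"
      unfolding op_adjoint_def by (auto split: if_splits)
    then have "op_adjoint T y = Some w" unfolding op_adjoint_def using the[OF w] by auto
    then have "ap y = w" by (simp add: adj)
    with w x show ?thesis by simp
  qed
qed

lemma real_form: "x \<in> D \<Longrightarrow> Im (cinner x (ap x)) = 0"
proof -
  assume "x \<in> D"
  then have "cinner x (ap x) = cnj (cinner x (ap x))"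
    using symmetric[of x x] by (metis cinner_commute)
  then show ?thesis by (metis Reals_cnj_iff complex_is_Real_iff)
qed

text \<open><x, T x> is real, so the imaginary part of <x, (T - z) x> is - Im z |x|^2;
  Cauchy-Schwarz then bounds it from above.\<close>

lemma lower_bound: "x \<in> D \<Longrightarrow> \<bar>Im z\<bar> * norm x \<le> norm (ap x - z *\<^sub>C x)"
proof -
  assume x: "x \<in> D"
  have "Im (cinner x (ap x - z *\<^sub>C x)) = - (Im z * (norm x)\<^sup>2)"
    using real_form[OF x] by (simp add: cinner_diff_right cinner_scaleC_right cinner_norm flip: of_real_power)
  then have "\<bar>Im z\<bar> * (norm x)\<^sup>2 = \<bar>Im (cinner x (ap x - z *\<^sub>C x))\<bar>" by (simp add: abs_mult)
  also have "\<dots> \<le> cmod (cinner x (ap x - z *\<^sub>C x))" by (rule abs_Im_le_cmod)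
  also have "\<dots> \<le> norm x * norm (ap x - z *\<^sub>C x)" by (rule cinner_cauchy_schwarz)
  finally have "norm x * (\<bar>Im z\<bar> * norm x) \<le> norm x * norm (ap x - z *\<^sub>C x)"
    by (simp add: power2_eq_square mult_ac)
  then show ?thesis by (cases "norm x = 0") (auto simp: mult_le_cancel_left)
qed

lemma shift_inj:
  assumes "Im z \<noteq> 0" "x \<in> D" "y \<in> D" "ap x - z *\<^sub>C x = ap y - z *\<^sub>C y"
  shows "x = y"
proof -
  have "ap (x - y) - z *\<^sub>C (x - y) = 0"
    using assms by (simp add: ap_diff complex_vector.scale_right_diff_distrib algebra_simps)
  with lower_bound[OF D_closed(3)[OF assms(2,3)], of z] have "\<bar>Im z\<bar> * norm (x - y) \<le> 0" by simp
  with assms(1) show ?thesis by (simp add: mult_le_0_iff)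
qed

text \<open>The range of T - z is closed, by the lower bound and the closedness of T, and a vector
  orthogonal to it would be an eigenvector for \<open>cnj z\<close>, which is not real.\<close>

lemma shift_surj:
  assumes z: "Im z \<noteq> 0"
  shows "\<exists>x\<in>D. ap x - z *\<^sub>C x = y"
proof -
  define S where "S = (\<lambda>x. ap x - z *\<^sub>C x) ` D"
  have "S = UNIV"
  proof (rule dense_subspaceI)
    show "complex_vector.subspace S"
    proof (rule complex_vector.subspaceI)
      have "0 \<in> D" using complex_vector.subspace_0[OF sub] .
      moreover have "ap 0 - z *\<^sub>C 0 = 0"
        using ap_scale[OF \<open>0 \<in> D\<close>, of 0] by (simp add: scaleC_zero_left)
      ultimately show "0 \<in> S" unfolding S_def by (intro image_eqI[where x = 0]) auto
    next
      fix u v assume "u \<in> S" "v \<in> S"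
      then obtain x y where "x \<in> D" "y \<in> D" "u = ap x - z *\<^sub>C x" "v = ap y - z *\<^sub>C y" unfolding S_def by blast
      then have "u + v = ap (x + y) - z *\<^sub>C (x + y)" "x + y \<in> D"
        by (simp_all add: ap_add scaleC_add_right D_closed)
      then show "u + v \<in> S" unfolding S_def by blast
    next
      fix c u assume "u \<in> S"
      then obtain x where "x \<in> D" "u = ap x - z *\<^sub>C x" unfolding S_def by blast
      then have "c *\<^sub>C u = ap (c *\<^sub>C x) - z *\<^sub>C (c *\<^sub>C x)" "c *\<^sub>C x \<in> D"
        by (simp_all add: ap_scale D_closed complex_vector.scale_right_diff_distrib scaleC_scaleC mult.commute)
      then show "c *\<^sub>C u \<in> S" unfolding S_def by blast
    qed
  next
    show "closed S"
      unfolding closed_sequential_limits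
    proof (intro allI impI)
      fix u l assume ul: "(\<forall>n. u n \<in> S) \<and> u \<longlonglongrightarrow> l"
      then have "\<forall>n. \<exists>x\<in>D. u n = ap x - z *\<^sub>C x" unfolding S_def by blast
      then obtain x where x: "\<And>n. x n \<in> D" "\<And>n. u n = ap (x n) - z *\<^sub>C x n" by metis
      have "Cauchy x"
      proof (rule CauchyI)
        fix e :: real assume e: "0 < e"
        have "Cauchy u" using ul by (intro LIMSEQ_imp_Cauchy) auto
        then obtain N where N: "\<And>m n. N \<le> m \<Longrightarrow> N \<le> n \<Longrightarrow> norm (u m - u n) < e * \<bar>Im z\<bar>"
          using CauchyD[of u "e * \<bar>Im z\<bar>"] e z by auto
        show "\<exists>N. \<forall>m\<ge>N. \<forall>n\<ge>N. norm (x m - x n) < e"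
        proof (intro exI allI impI)
          fix m n assume mn: "N \<le> m" "N \<le> n"
          have "u m - u n = ap (x m - x n) - z *\<^sub>C (x m - x n)"
            by (simp add: x ap_diff complex_vector.scale_right_diff_distrib)
          then have "\<bar>Im z\<bar> * norm (x m - x n) \<le> norm (u m - u n)"
            using lower_bound[OF D_closed(3)[OF x(1) x(1)], of z m n] by simp
          also have "\<dots> < e * \<bar>Im z\<bar>" by (rule N[OF mn])
          finally show "norm (x m - x n) < e" using z by (simp add: mult.commute)
        qed
      qed
      then obtain p where p: "x \<longlonglongrightarrow> p" using Cauchy_convergent_iff convergent_def by blast
      have zp: "(\<lambda>n. z *\<^sub>C x n) \<longlonglongrightarrow> z *\<^sub>C p" by (rule bounded_linear.tendsto[OF bounded_linear_scaleC p])
      have Tx: "(\<lambda>n. ap (x n)) \<longlonglongrightarrow> l + z *\<^sub>C p"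
        using tendsto_add[OF conjunct2[OF ul] zp] by (simp add: x)
      \<comment> \<open>Closedness of T: by symmetry the limit p satisfies the relation that defines
        the domain of the adjoint.\<close>
      have "p \<in> D \<and> ap p = l + z *\<^sub>C p"
      proof (rule adjoint_mem)
        fix v assume v: "v \<in> D"
        have "(\<lambda>n. cinner (x n) (ap v)) \<longlonglongrightarrow> cinner p (ap v)" by (intro tendsto_intros p)
        moreover have "(\<lambda>n. cinner (x n) (ap v)) \<longlonglongrightarrow> cinner (l + z *\<^sub>C p) v"
          using tendsto_cinner[OF Tx tendsto_const[of v]] by (simp add: symmetric x v)
        ultimately show "cinner p (ap v) = cinner (l + z *\<^sub>C p) v" by (rule LIMSEQ_unique)
      qed
      then show "l \<in> S" unfolding S_def by (intro image_eqI[of _ _ p]) auto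
    qed
  next
    fix y assume y: "\<And>s. s \<in> S \<Longrightarrow> cinner y s = 0"
    have "y \<in> D \<and> ap y = cnj z *\<^sub>C y"
    proof (rule adjoint_mem)
      fix x assume x: "x \<in> D"
      then have "cinner y (ap x - z *\<^sub>C x) = 0" by (intro y) (simp add: S_def)
      then show "cinner y (ap x) = cinner (cnj z *\<^sub>C y) x"
        by (simp add: cinner_diff_right cinner_scaleC_right cinner_scaleC_left)
    qed
    then have "Im (cnj z * of_real ((norm y)\<^sup>2)) = 0"
      using real_form[of y] by (simp add: cinner_scaleC_right cinner_norm)
    then show "y = 0" using z by simp
  qed
  then have "y \<in> S" by simp
  then show ?thesis unfolding S_def by (auto simp only: image_iff)
qed

definition rs :: "complex \<Rightarrow> 'a cop" where
  "rs z = mk (\<lambda>y. THE x. x \<in> D \<and> ap x - z *\<^sub>C x = y)"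

lemma rs_iff:
  assumes z: "Im z \<noteq> 0"
  shows "x = rs z \<cdot> y \<longleftrightarrow> x \<in> D \<and> ap x - z *\<^sub>C x = y"
proof -
  define f where "f y = (THE x. x \<in> D \<and> ap x - z *\<^sub>C x = y)" for y
  have ex1: "\<exists>!x. x \<in> D \<and> ap x - z *\<^sub>C x = y" for y
    using shift_surj[OF z, of y] shift_inj[OF z] by blast
  have f: "f y \<in> D" "ap (f y) - z *\<^sub>C f y = y" for y
    using theI'[OF ex1[of y]] by (simp_all add: f_def)
  have fI: "f y = x" if "x \<in> D" "ap x - z *\<^sub>C x = y" for x y
    using ex1[of y] f[of y] that by blast
  have "mk f \<cdot> y = f y"
  proof (rule app_mk)
    show "f (u + v) = f u + f v" for u v
      by (rule fI) (use f[of u] f[of v] in \<open>simp_all add: D_closed ap_add scaleC_add_right algebra_simps\<close>)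
    show "f (c *\<^sub>C u) = c *\<^sub>C f u" for c u
    proof (rule fI)
      show "c *\<^sub>C f u \<in> D" by (intro D_closed f)
      have "ap (c *\<^sub>C f u) - z *\<^sub>C c *\<^sub>C f u = c *\<^sub>C (ap (f u) - z *\<^sub>C f u)"
        by (simp add: ap_scale f(1) complex_vector.scale_right_diff_distrib scaleC_scaleC mult.commute)
      also have "ap (f u) - z *\<^sub>C f u = u" by (rule f)
      finally show "ap (c *\<^sub>C f u) - z *\<^sub>C c *\<^sub>C f u = c *\<^sub>C u" .
    qed
    show "norm (f u) \<le> norm u * (1 / \<bar>Im z\<bar>)" for u
      using lower_bound[OF f(1)[of u], of z] z by (simp add: f field_simps)
  qed
  then have "rs z \<cdot> y = f y" by (simp add: rs_def f_def[abs_def])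
  then show ?thesis using f fI by metis
qed

lemma
  assumes z: "Im z \<noteq> 0"
  shows rs_dom: "rs z \<cdot> y \<in> D"
    and ap_rs: "ap (rs z \<cdot> y) = y + z *\<^sub>C (rs z \<cdot> y)"
    and rs_shift: "x \<in> D \<Longrightarrow> rs z \<cdot> (ap x - z *\<^sub>C x) = x"
proof -
  have *: "rs z \<cdot> y \<in> D \<and> ap (rs z \<cdot> y) - z *\<^sub>C (rs z \<cdot> y) = y"
    using rs_iff[OF z, of "rs z \<cdot> y" y] by simp
  then show "rs z \<cdot> y \<in> D" "ap (rs z \<cdot> y) = y + z *\<^sub>C (rs z \<cdot> y)" by (auto simp: algebra_simps)
  show "rs z \<cdot> (ap x - z *\<^sub>C x) = x" if "x \<in> D"
    using rs_iff[OF z, of x "ap x - z *\<^sub>C x"] that by simp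
qed

lemma op_inverse_shift:
  assumes z: "Im z \<noteq> 0"
  shows "op_inverse (T -\<^sub>o scalar_op z) y = Some (rs z \<cdot> y)"
proof -
  have eq: "(T -\<^sub>o scalar_op z) x = Some y \<longleftrightarrow> x = rs z \<cdot> y" for x y
    unfolding rs_iff[OF z] by (auto simp: op_diff_def scalar_op_def dom_def)
  show ?thesis unfolding op_inverse_def eq by simp
qed

lemma resolvent_eq: "Im z \<noteq> 0 \<Longrightarrow> resolvent T z = blin (rs z)"
  unfolding resolvent_def blinfun_of_op_def
  by (simp add: op_inverse_shift app.rep_eq blinfun_apply_inverse)

lemma resolvent_identity:
  assumes z: "Im z \<noteq> 0" and z': "Im z' \<noteq> 0"
  shows "rs z - rs z' = (z - z') \<odot> (rs z * rs z')"
proof (rule cop_eqI)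
  fix y
  let ?x = "rs z' \<cdot> y"
  have e: "ap ?x - z *\<^sub>C ?x = y - (z - z') *\<^sub>C ?x"
    by (simp add: ap_rs[OF z'] complex_vector.scale_left_diff_distrib)
  have "rs z \<cdot> (ap ?x - z *\<^sub>C ?x) = ?x" by (rule rs_shift[OF z rs_dom[OF z']])
  then have "rs z \<cdot> y - (z - z') *\<^sub>C (rs z \<cdot> ?x) = ?x"
    unfolding e app_diff_right app_scaleC .
  then show "(rs z - rs z') \<cdot> y = ((z - z') \<odot> (rs z * rs z')) \<cdot> y"
    unfolding app_diff_left app_csc app_times by (simp only: diff_eq_eq eq_diff_eq add.commute)
qed

text \<open>\<open>rs (- \<i>)\<close> is the inverse of T + i, and i - T = 2 i - (T + i); so this
  is (i - T) (i + T)^-1.\<close>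

definition cay :: "'a cop" where
  "cay = (2 * \<i>) \<odot> rs (- \<i>) - 1"

lemma unitary_cay: "unitary cay"
proof (rule unitaryI)
  have i: "Im (- \<i>) \<noteq> 0" by simp
  have cay_eq: "cay \<cdot> (ap x + \<i> *\<^sub>C x) = \<i> *\<^sub>C x - ap x" if "x \<in> D" for x
  proof -
    have "rs (- \<i>) \<cdot> (ap x + \<i> *\<^sub>C x) = x" using rs_shift[OF i that] by (simp add: complex_vector.scale_minus_left)
    then have "cay \<cdot> (ap x + \<i> *\<^sub>C x) = (\<i> + \<i>) *\<^sub>C x - (ap x + \<i> *\<^sub>C x)"
      by (simp add: cay_def app_diff_left app_csc)
    then show ?thesis unfolding scaleC_add_left by simp
  qed
  show "norm (cay \<cdot> y) = norm y" for y
  proof -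
    obtain x where x: "x \<in> D" "y = ap x + \<i> *\<^sub>C x"
      using shift_surj[OF i, of y] by (auto simp: complex_vector.scale_minus_left)
    have "Re (cinner (\<i> *\<^sub>C x) (ap x)) = 0" using real_form[OF x(1)] by (simp add: cinner_scaleC_left)
    then have "(norm (\<i> *\<^sub>C x - ap x))\<^sup>2 = (norm (\<i> *\<^sub>C x + ap x))\<^sup>2"
      unfolding norm_diff_sq norm_add_sq by simp
    then show ?thesis unfolding x(2) cay_eq[OF x(1)] by (simp add: add.commute)
  qed
  show "\<exists>x. cay \<cdot> x = y" for y
  proof -
    have "Im \<i> \<noteq> 0" by simp
    from shift_surj[OF this, of "- y"] obtain x where x: "x \<in> D" "ap x - \<i> *\<^sub>C x = - y" by blast
    then have "\<i> *\<^sub>C x - ap x = y" by (metis minus_diff_eq add.inverse_inverse)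
    with cay_eq[OF x(1)] show ?thesis by blast
  qed
qed

end

lemma op_inverse_Some_iff:
  assumes inj: "\<And>u v. T u = Some w \<Longrightarrow> T v = Some w \<Longrightarrow> u = v"
  shows "op_inverse T w = Some v \<longleftrightarrow> T v = Some w"
proof (cases "\<exists>x. T x = Some w")
  case True
  then obtain x where x: "T x = Some w" by blast
  have ex1: "\<exists>!x. T x = Some w" using x inj by blast
  have the: "(THE x. T x = Some w) = x" by (rule the_equality[where P = "\<lambda>x. T x = Some w", OF x]) (rule inj[OF _ x])
  have "op_inverse T w = Some x" unfolding op_inverse_def using ex1 the by simp
  with x inj show ?thesis by auto
qed (auto simp: op_inverse_def)

text \<open>Stated through the graph of an everywhere defined inverse G of i + T, so that it applies
  to the operators \<open>W_path\<close> as well as to self-adjoint ones.\<close>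

lemma cayley_eqI:
  assumes G: "\<And>x y. (scalar_op \<i> +\<^sub>o T) x = Some y \<longleftrightarrow> x = G \<cdot> y"
  shows "cayley T = blin ((2 * \<i>) \<odot> G - 1)"
proof -
  have "((scalar_op \<i> -\<^sub>o T) \<circ>\<^sub>m op_inverse (scalar_op \<i> +\<^sub>o T)) y = Some (((2 * \<i>) \<odot> G - 1) \<cdot> y)" for y
  proof -
    have inv: "op_inverse (scalar_op \<i> +\<^sub>o T) y = Some (G \<cdot> y)"
      unfolding op_inverse_def G by simp
    have "(scalar_op \<i> +\<^sub>o T) (G \<cdot> y) = Some y" using G by simp
    then have dom: "G \<cdot> y \<in> dom T" and y: "\<i> *\<^sub>C (G \<cdot> y) + the (T (G \<cdot> y)) = y"
      by (auto simp: op_add_def scalar_op_def split: if_splits)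
    have "(scalar_op \<i> -\<^sub>o T) (G \<cdot> y) = Some (\<i> *\<^sub>C (G \<cdot> y) - the (T (G \<cdot> y)))"
      using dom by (auto simp: op_diff_def scalar_op_def dom_def)
    also have "\<i> *\<^sub>C (G \<cdot> y) - the (T (G \<cdot> y)) = (\<i> + \<i>) *\<^sub>C (G \<cdot> y) - y"
      unfolding scaleC_add_left using y by (simp add: algebra_simps)
    finally show ?thesis by (simp add: inv app_diff_left app_csc)
  qed
  then show ?thesis
    unfolding cayley_def blinfun_of_op_def by (simp add: app.rep_eq blinfun_apply_inverse)
qed

context selfadjoint_op
begin

lemma cayley_eq: "cayley T = blin cay"
  unfolding cay_def
proof (rule cayley_eqI)
  fix x y
  have "x = rs (- \<i>) \<cdot> y \<longleftrightarrow> x \<in> D \<and> ap x - (- \<i>) *\<^sub>C x = y" by (rule rs_iff) simp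
  then show "(scalar_op \<i> +\<^sub>o T) x = Some y \<longleftrightarrow> x = rs (- \<i>) \<cdot> y"
    by (auto simp: op_add_def scalar_op_def dom_def complex_vector.scale_minus_left add.commute)
qed

end

section \<open>The path between two self-adjoint operators with a common domain\<close>

locale selfadjoint_pair =
  H: selfadjoint_op H + H0: selfadjoint_op H0 for H H0 :: "'a::complex_hilbert unbounded_op" +
  assumes dom_eq: "dom H = dom H0"
begin

text \<open>Paired with the difference d of the two vectors, the symmetric parts contribute real
  numbers, so the imaginary part is |d|^2.\<close>

lemma H_path_inj:
  assumes u: "u \<in> dom H0" and v: "v \<in> dom H0"
    and eq: "s *\<^sub>R H0.ap u + (1 - s) *\<^sub>R H.ap u + \<i> *\<^sub>C u = s *\<^sub>R H0.ap v + (1 - s) *\<^sub>R H.ap v + \<i> *\<^sub>C v"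
  shows "u = v"
proof -
  define d where "d = u - v"
  have d: "d \<in> dom H" "d \<in> dom H0" using u v by (simp_all add: d_def dom_eq H0.D_closed)
  have "s *\<^sub>R H0.ap d + (1 - s) *\<^sub>R H.ap d + \<i> *\<^sub>C d = 0"
    using eq u v
    by (simp add: d_def H.ap_diff H0.ap_diff dom_eq complex_vector.scale_right_diff_distrib scaleR_diff_right)
      (simp add: algebra_simps)
  then have "cinner d (s *\<^sub>R H0.ap d + (1 - s) *\<^sub>R H.ap d + \<i> *\<^sub>C d) = 0" by simp
  then have "Im (s *\<^sub>R cinner d (H0.ap d) + (1 - s) *\<^sub>R cinner d (H.ap d) + \<i> * of_real ((norm d)\<^sup>2)) = 0"
    by (simp only: cinner_add_right cinner_real_scale_right cinner_scaleC_right cinner_norm zero_complex.simps)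
  then have "(norm d)\<^sup>2 = 0" using H.real_form[OF d(1)] H0.real_form[OF d(2)] by (simp flip: of_real_power)
  then show ?thesis by (simp add: d_def)
qed

text \<open>H_s + i = s (H0 + i) + (1 - s) (H + i), so (W_s + i)^-1 = (H0 + i)^-1 (H_s + i) (H +
  i)^-1 = s (H + i)^-1 + (1 - s) (H0 + i)^-1. This is G, and the Cayley transform is affine in
  it.\<close>

lemma cayley_W_path:
  "cayley (W_path H H0 s) = blin (H0.cay + s *\<^sub>R (H.cay - H0.cay))"
proof -
  define G where "G = s *\<^sub>R H.rs (- \<i>) + (1 - s) *\<^sub>R H0.rs (- \<i>)"
  have i: "Im (- \<i>) \<noteq> 0" by simp
  have scR: "(r *\<^sub>R A) \<cdot> x = r *\<^sub>R (A \<cdot> x)" for r x and A :: "'a cop"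
    by (simp add: app_csc scaleR_scaleC flip: csc_of_real)
  have G: "G \<cdot> y = s *\<^sub>R (H.rs (- \<i>) \<cdot> y) + (1 - s) *\<^sub>R (H0.rs (- \<i>) \<cdot> y)" for y
    by (simp add: G_def app_add_left scR)
  have Hs: "(H_path H H0 s +\<^sub>o scalar_op \<i>) v = Some w \<longleftrightarrow>
      v \<in> dom H0 \<and> s *\<^sub>R H0.ap v + (1 - s) *\<^sub>R H.ap v + \<i> *\<^sub>C v = w" for v w
  proof (cases "v \<in> dom H0")
    case True
    then obtain h h0 where "H v = Some h" "H0 v = Some h0" using dom_eq by blast
    then show ?thesis
      by (auto simp: H_path_def op_add_def op_scale_def scalar_op_def dom_def scaleR_scaleC)
  next
    case False
    then show ?thesis by (auto simp: H_path_def op_add_def op_scale_def scalar_op_def dom_def)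
  qed
  have inv: "op_inverse (H_path H H0 s +\<^sub>o scalar_op \<i>) w = Some v \<longleftrightarrow>
      v \<in> dom H0 \<and> s *\<^sub>R H0.ap v + (1 - s) *\<^sub>R H.ap v + \<i> *\<^sub>C v = w" for v w
  proof -
    have "op_inverse (H_path H H0 s +\<^sub>o scalar_op \<i>) w = Some v \<longleftrightarrow> (H_path H H0 s +\<^sub>o scalar_op \<i>) v = Some w"
    proof (rule op_inverse_Some_iff)
      fix u v assume "(H_path H H0 s +\<^sub>o scalar_op \<i>) u = Some w" "(H_path H H0 s +\<^sub>o scalar_op \<i>) v = Some w"
      then show "u = v" unfolding Hs by (intro H_path_inj[of u v s]) auto
    qed
    then show ?thesis unfolding Hs .
  qed
  \<comment> \<open>The graph of i + W_s, with v the intermediate vector: (H_s + i) v = (H0 + i) x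
    and (H + i) v = y.\<close>
  have W: "(scalar_op \<i> +\<^sub>o W_path H H0 s) x = Some y \<longleftrightarrow> x \<in> dom H0 \<and>
     (\<exists>v\<in>dom H0. s *\<^sub>R H0.ap v + (1 - s) *\<^sub>R H.ap v + \<i> *\<^sub>C v = H0.ap x + \<i> *\<^sub>C x \<and> H.ap v + \<i> *\<^sub>C v = y)" for x y
  proof -
    let ?m = "(H +\<^sub>o scalar_op \<i>) \<circ>\<^sub>m op_inverse (H_path H H0 s +\<^sub>o scalar_op \<i>) \<circ>\<^sub>m (H0 +\<^sub>o scalar_op \<i>)"
    have m: "?m x = Some u \<longleftrightarrow> x \<in> dom H0 \<and>
      (\<exists>v\<in>dom H0. s *\<^sub>R H0.ap v + (1 - s) *\<^sub>R H.ap v + \<i> *\<^sub>C v = H0.ap x + \<i> *\<^sub>C x \<and> H.ap v + \<i> *\<^sub>C v = u)" for u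
    proof -
      have e1: "?m x = Some u \<longleftrightarrow> (\<exists>w v. (H0 +\<^sub>o scalar_op \<i>) x = Some w \<and>
         op_inverse (H_path H H0 s +\<^sub>o scalar_op \<i>) w = Some v \<and> (H +\<^sub>o scalar_op \<i>) v = Some u)"
        by (auto simp: map_comp_Some_iff)
      have e2: "(H0 +\<^sub>o scalar_op \<i>) x = Some w \<longleftrightarrow> x \<in> dom H0 \<and> H0.ap x + \<i> *\<^sub>C x = w" for w
        by (auto simp: op_add_def scalar_op_def dom_def)
      have e3: "(H +\<^sub>o scalar_op \<i>) v = Some u \<longleftrightarrow> v \<in> dom H0 \<and> H.ap v + \<i> *\<^sub>C v = u" for v
        using dom_eq by (auto simp: op_add_def scalar_op_def dom_def)
      show ?thesis unfolding e1 inv e2 e3 by blast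
    qed
    \<comment> \<open>The scalar i is subtracted in \<open>W_path\<close> and added again, and being
      everywhere defined it leaves the domain unchanged.\<close>
    have "(scalar_op \<i> +\<^sub>o W_path H H0 s) x = ?m x"
    proof (cases "?m x")
      case None
      then show ?thesis unfolding W_path_def op_add_def op_diff_def scalar_op_def by (auto simp: dom_def)
    next
      case (Some u)
      then show ?thesis unfolding W_path_def op_add_def op_diff_def scalar_op_def by (auto simp: dom_def)
    qed
    with m show ?thesis by simp
  qed
  have "(scalar_op \<i> +\<^sub>o W_path H H0 s) x = Some y \<longleftrightarrow> x = G \<cdot> y" for x y
  proof -
    let ?v = "H.rs (- \<i>) \<cdot> y" and ?u = "H0.rs (- \<i>) \<cdot> y"
    have v: "v \<in> dom H0 \<and> H.ap v + \<i> *\<^sub>C v = y \<longleftrightarrow> v = ?v" for v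
      using H.rs_iff[OF i, of v y] dom_eq by (simp add: complex_vector.scale_minus_left)
    have vD: "?v \<in> dom H0" and vy: "H.ap ?v + \<i> *\<^sub>C ?v = y" using v by blast+
    have v0D: "?u \<in> dom H0" and v0y: "H0.ap ?u + \<i> *\<^sub>C ?u = y"
      using H0.rs_iff[OF i, of ?u y] by (simp_all add: complex_vector.scale_minus_left)
    have GD: "G \<cdot> y \<in> dom H0"
      unfolding G scaleR_scaleC by (intro H0.D_closed vD v0D)
    have eq: "s *\<^sub>R H0.ap ?v + (1 - s) *\<^sub>R H.ap ?v + \<i> *\<^sub>C ?v = H0.ap (G \<cdot> y) + \<i> *\<^sub>C (G \<cdot> y)"
    proof -
      have "H0.ap (G \<cdot> y) + \<i> *\<^sub>C (G \<cdot> y)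
        = s *\<^sub>R (H0.ap ?v + \<i> *\<^sub>C ?v) + (1 - s) *\<^sub>R (H0.ap ?u + \<i> *\<^sub>C ?u)"
        unfolding G scaleR_scaleC
        by (simp add: H0.ap_add H0.ap_scale H0.D_closed vD v0D scaleC_add_right scaleC_scaleC mult.commute)
      also have "\<dots> = s *\<^sub>R (H0.ap ?v + \<i> *\<^sub>C ?v) + (1 - s) *\<^sub>R (H.ap ?v + \<i> *\<^sub>C ?v)"
        unfolding v0y vy ..
      also have "\<dots> = s *\<^sub>R H0.ap ?v + (1 - s) *\<^sub>R H.ap ?v + \<i> *\<^sub>C ?v"
        by (simp add: algebra_simps)
      finally show ?thesis ..
    qed
    have "(scalar_op \<i> +\<^sub>o W_path H H0 s) x = Some y \<longleftrightarrow> x \<in> dom H0 \<and>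
       s *\<^sub>R H0.ap ?v + (1 - s) *\<^sub>R H.ap ?v + \<i> *\<^sub>C ?v = H0.ap x + \<i> *\<^sub>C x"
      unfolding W using v by metis
    also have "\<dots> \<longleftrightarrow> x = G \<cdot> y"
    proof -
      have "x = G \<cdot> y" if "x \<in> dom H0" "H0.ap (G \<cdot> y) + \<i> *\<^sub>C (G \<cdot> y) = H0.ap x + \<i> *\<^sub>C x"
        using H0.shift_inj[OF i that(1) GD] that(2) by (simp add: complex_vector.scale_minus_left)
      with GD show ?thesis unfolding eq by metis
    qed
    finally show ?thesis .
  qed
  then have "cayley (W_path H H0 s) = blin ((2 * \<i>) \<odot> G - 1)" by (rule cayley_eqI)
  also have "(2 * \<i>) \<odot> G - 1 = H0.cay + s *\<^sub>R (H.cay - H0.cay)"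
    unfolding G_def H.cay_def H0.cay_def csc_of_real[symmetric]
    by (simp add: csc_add_right csc_diff_right csc_csc mult.commute csc_add_left algebra_simps)
       (simp add: csc_of_real csc_add_left[symmetric] algebra_simps)
  finally show ?thesis .
qed

text \<open>The second resolvent identity; it makes the difference of the Cayley transforms
  Hilbert-Schmidt.\<close>

lemma rs_perturbation:
  assumes K: "\<And>x. x \<in> dom H0 \<Longrightarrow> H.ap x - H0.ap x = K \<cdot> x"
  shows "H.rs (- \<i>) - H0.rs (- \<i>) = - (H.rs (- \<i>) * K * H0.rs (- \<i>))"
proof (rule cop_eqI)
  fix y
  let ?x = "H0.rs (- \<i>) \<cdot> y"
  have i: "Im (- \<i>) \<noteq> 0" by simp
  have x: "?x \<in> dom H0" "?x \<in> dom H" using H0.rs_dom[OF i] dom_eq by auto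
  have e: "H.ap ?x - (- \<i>) *\<^sub>C ?x = y + K \<cdot> ?x"
    using H0.ap_rs[OF i, of y] K[OF x(1)] by (simp add: algebra_simps)
  have "H.rs (- \<i>) \<cdot> (H.ap ?x - (- \<i>) *\<^sub>C ?x) = ?x" by (rule H.rs_shift[OF i x(2)])
  then have "H.rs (- \<i>) \<cdot> y + H.rs (- \<i>) \<cdot> (K \<cdot> ?x) = ?x"
    unfolding e app_add_right .
  then show "(H.rs (- \<i>) - H0.rs (- \<i>)) \<cdot> y = (- (H.rs (- \<i>) * K * H0.rs (- \<i>))) \<cdot> y"
    unfolding app_diff_left app_minus_left app_times
    by (metis add_diff_cancel_left' minus_diff_eq)
qed

end

section \<open>The Cayley parametrization of the circle by the real line\<close>

definition cw :: "real \<Rightarrow> complex" where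
  "cw x = (\<i> - complex_of_real x) / (\<i> + complex_of_real x)"

text \<open>The Cauchy distribution, which \<open>cw\<close> carries to normalized arc length on the
  circle.\<close>

definition cauchy_measure :: "real measure" where
  "cauchy_measure = density lborel (\<lambda>x. ennreal (1 / (pi * (1 + x\<^sup>2))))"

lemma i_plus_real_nz: "\<i> + complex_of_real x \<noteq> 0" "1 + (complex_of_real x)\<^sup>2 \<noteq> 0"
proof -
  show "\<i> + complex_of_real x \<noteq> 0" by (simp add: complex_eq_iff)
  have "0 < 1 + x\<^sup>2" by (simp add: add_pos_nonneg)
  then have "complex_of_real (1 + x\<^sup>2) \<noteq> 0" by (simp only: of_real_eq_0_iff)
  then show "1 + (complex_of_real x)\<^sup>2 \<noteq> 0" by simp
qed

lemma norm_cw [simp]: "cmod (cw x) = 1"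
proof -
  have "cmod (\<i> - complex_of_real x) = cmod (\<i> + complex_of_real x)"
    by (simp add: cmod_def)
  then show ?thesis using i_plus_real_nz(1)[of x] by (simp add: cw_def norm_divide)
qed

text \<open>On functions of w = \<open>cw x\<close> the operator (1 + x^2) d/dx acts as 2 i w
  d/dw.\<close>

lemma cw_power_has_vector_derivative:
  "((\<lambda>x. cw x ^ k) has_vector_derivative (2 * \<i> / (1 + (of_real x)\<^sup>2)) * (of_nat k * cw x ^ k)) (at x)"
proof -
  let ?z = "complex_of_real x"
  let ?f = "\<lambda>z. (\<i> - z) / (\<i> + z)"
  note nz = i_plus_real_nz[of x]
  have eq: "(\<i> + ?z) * (\<i> - ?z) = - (1 + ?z\<^sup>2)" by (simp add: algebra_simps power2_eq_square)
  then have nz2: "\<i> - ?z \<noteq> 0" using nz by auto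
  from eq have eq': "1 + ?z\<^sup>2 = - ((\<i> + ?z) * (\<i> - ?z))" by simp
  have "((- 1) * (\<i> + ?z) - (\<i> - ?z) * 1) / ((\<i> + ?z) * (\<i> + ?z)) = (2 * \<i> / (1 + ?z\<^sup>2)) * ?f ?z"
  proof -
    have "(2 * \<i> / (1 + ?z\<^sup>2)) * ?f ?z = - (2 * \<i> / ((\<i> + ?z) * (\<i> - ?z))) * ?f ?z"
      by (simp only: eq' divide_minus_right)
    also have "\<dots> = - (2 * \<i>) / ((\<i> + ?z) * (\<i> + ?z))" using nz nz2 by simp
    finally show ?thesis by simp
  qed
  moreover have "(?f has_field_derivative ((- 1) * (\<i> + ?z) - (\<i> - ?z) * 1) / ((\<i> + ?z) * (\<i> + ?z))) (at ?z)"
    by (rule DERIV_divide) (use nz in \<open>auto intro!: derivative_eq_intros\<close>)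
  ultimately have "(?f has_field_derivative (2 * \<i> / (1 + ?z\<^sup>2)) * ?f ?z) (at ?z)" by simp
  from DERIV_power[OF this, of k]
  have "((\<lambda>z. ?f z ^ k) has_field_derivative of_nat k * ((2 * \<i> / (1 + ?z\<^sup>2)) * ?f ?z * ?f ?z ^ (k - Suc 0))) (at ?z)" .
  moreover have "of_nat k * ((2 * \<i> / (1 + ?z\<^sup>2)) * ?f ?z * ?f ?z ^ (k - Suc 0)) = (2 * \<i> / (1 + ?z\<^sup>2)) * (of_nat k * ?f ?z ^ k)"
    by (cases k) simp_all
  ultimately have "((\<lambda>z. ?f z ^ k) has_field_derivative (2 * \<i> / (1 + ?z\<^sup>2)) * (of_nat k * ?f ?z ^ k)) (at ?z)"
    by (simp only:)
  from has_vector_derivative_real_field[OF this, of UNIV] show ?thesis unfolding cw_def .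
qed

lemma continuous_cw: "continuous_on S cw"
  unfolding cw_def by (intro continuous_intros) (use i_plus_real_nz in auto)

lemma cw_measurable [measurable]: "cw \<in> borel_measurable borel"
  by (rule borel_measurable_continuous_onI[OF continuous_cw])

lemma tendsto_cw: "filterlim (\<lambda>x. x) at_infinity F \<Longrightarrow> (cw \<longlongrightarrow> -1) F"
proof -
  assume F: "filterlim (\<lambda>x::real. x) at_infinity F"
  have "filterlim (\<lambda>x. complex_of_real x) at_infinity F"
    using F by (simp add: filterlim_at_infinity_conv_norm_at_top)
  then have "filterlim (\<lambda>x. \<i> + complex_of_real x) at_infinity F"
    by (rule tendsto_add_filterlim_at_infinity[OF tendsto_const])
  then have "((\<lambda>x. 2 * \<i> / (\<i> + complex_of_real x)) \<longlongrightarrow> 0) F"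
    by (rule tendsto_divide_0[OF tendsto_const])
  from tendsto_add[OF tendsto_const[of "-1"] this]
  have "((\<lambda>x. -1 + 2 * \<i> / (\<i> + complex_of_real x)) \<longlongrightarrow> -1) F" by simp
  moreover have "-1 + 2 * \<i> / (\<i> + complex_of_real x) = cw x" for x
    unfolding cw_def using i_plus_real_nz(1)[of x] by (simp add: field_simps)
  ultimately show ?thesis by simp
qed

lemma at_top_bot_infinity: "filterlim (\<lambda>x::real. x) at_infinity at_top" "filterlim (\<lambda>x::real. x) at_infinity at_bot"
  by (simp_all add: filterlim_at_top_imp_at_infinity filterlim_at_bot_imp_at_infinity filterlim_ident)

lemma cauchy_density_integral:
  "integrable lborel (\<lambda>x::real. 1 / (1 + x\<^sup>2))" "(LINT x|lborel. 1 / (1 + x\<^sup>2)) = pi"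
proof -
  have nz: "1 + x\<^sup>2 \<noteq> 0" for x :: real by (metis add_pos_nonneg less_irrefl zero_le_power2 zero_less_one)
  have c: "isCont (\<lambda>x::real. 1 / (1 + x\<^sup>2)) x" for x by (intro continuous_intros nz)
  have D: "DERIV arctan x :> 1 / (1 + x\<^sup>2)" for x
    using DERIV_arctan[of x] by (simp add: divide_inverse)
  have A: "((arctan \<circ> real_of_ereal) \<longlongrightarrow> - (pi/2)) (at_right (- \<infinity>))"
    "((arctan \<circ> real_of_ereal) \<longlongrightarrow> pi/2) (at_left \<infinity>)"
    by (simp_all add: ereal_tendsto_simps1 tendsto_arctan_at_top tendsto_arctan_at_bot)
  have nn: "AE x in lborel. - \<infinity> < ereal x \<longrightarrow> ereal x < \<infinity> \<longrightarrow> 0 \<le> 1 / (1 + x\<^sup>2)" by simp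
  note FTC = interval_integral_FTC_nonneg[where a = "-\<infinity>" and b = \<infinity>, OF _ D c nn A]
  show "integrable lborel (\<lambda>x::real. 1 / (1 + x\<^sup>2))"
    using FTC(1) by (simp add: set_integrable_def)
  show "(LINT x|lborel. 1 / (1 + x\<^sup>2)) = pi"
    using FTC(2) by (simp add: interval_lebesgue_integral_def set_lebesgue_integral_def)
qed

lemma
  fixes f :: "real \<Rightarrow> complex"
  assumes [measurable]: "f \<in> borel_measurable borel"
  shows integrable_cauchy_iff: "integrable cauchy_measure f \<longleftrightarrow> integrable lborel (\<lambda>x. f x / of_real (pi * (1 + x\<^sup>2)))"
    and integral_cauchy: "(\<integral>x. f x \<partial>cauchy_measure) = (\<integral>x. f x / of_real (pi * (1 + x\<^sup>2)) \<partial>lborel)"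
proof -
  have e: "(1 / (pi * (1 + x\<^sup>2))) *\<^sub>R f x = f x / of_real (pi * (1 + x\<^sup>2))" for x
    by (simp add: scaleR_conv_of_real divide_inverse mult.commute)
  show "integrable cauchy_measure f \<longleftrightarrow> integrable lborel (\<lambda>x. f x / of_real (pi * (1 + x\<^sup>2)))"
    unfolding cauchy_measure_def by (subst integrable_density) (auto simp only: e, auto simp: add_nonneg_nonneg)
  show "(\<integral>x. f x \<partial>cauchy_measure) = (\<integral>x. f x / of_real (pi * (1 + x\<^sup>2)) \<partial>lborel)"
    unfolding cauchy_measure_def by (subst integral_density) (auto simp only: e, auto simp: add_nonneg_nonneg)
qed

interpretation line: circle_space cauchy_measure cw
proof -
  have em: "emeasure cauchy_measure (space cauchy_measure) = 1"
  proof -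
    have "emeasure cauchy_measure (space cauchy_measure) = (\<integral>\<^sup>+x. ennreal (1 / (pi * (1 + x\<^sup>2))) \<partial>lborel)"
      by (simp add: cauchy_measure_def emeasure_density)
    also have "\<dots> = ennreal (LINT x|lborel. 1 / (pi * (1 + x\<^sup>2)))"
    proof (rule nn_integral_eq_integral)
      have "integrable lborel (\<lambda>x::real. (1 / pi) * (1 / (1 + x\<^sup>2)))"
        by (intro integrable_mult_right cauchy_density_integral)
      then show "integrable lborel (\<lambda>x. 1 / (pi * (1 + x\<^sup>2)))" by simp
    qed (simp add: add_nonneg_nonneg)
    also have "(LINT x|lborel. 1 / (pi * (1 + x\<^sup>2))) = (LINT x|lborel. (1 / pi) * (1 / (1 + x\<^sup>2)))"
      by simp
    also have "\<dots> = 1" by (subst integral_mult_right_zero) (simp add: cauchy_density_integral)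
    finally show ?thesis by simp
  qed
  interpret finite_measure cauchy_measure by (rule finite_measureI) (simp add: em)
  show "circle_space cauchy_measure cw"
  proof (unfold_locales)
    show "measure cauchy_measure (space cauchy_measure) = 1" by (simp add: measure_def em)
    show "cw \<in> borel_measurable cauchy_measure" by (simp add: cauchy_measure_def)
    show "cmod (cw x) = 1" for x by simp
    fix n :: nat assume n: "0 < n"
    \<comment> \<open>The derivative of \<open>cw x ^ n\<close> is a constant multiple of
      \<open>cw x ^ n\<close> times the Cauchy density. As \<open>cw\<close> tends to -1 at both
      ends of the line, its integral is zero.\<close>
    let ?g = "\<lambda>x. (2 * \<i> / (1 + (complex_of_real x)\<^sup>2)) * (of_nat n * cw x ^ n)"
    have "(LBINT x=-\<infinity>..\<infinity>. ?g x) = (-1) ^ n - (-1) ^ n"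
    proof (rule interval_integral_FTC_integrable)
      show "((\<lambda>x. cw x ^ n) has_vector_derivative ?g x) (at x)" for x
        by (rule cw_power_has_vector_derivative)
      have "continuous_on UNIV ?g" using i_plus_real_nz by (intro continuous_intros continuous_cw) auto
      then show "isCont ?g x" for x by (simp add: continuous_on_eq_continuous_at)
      have [measurable]: "?g \<in> borel_measurable borel"
        by (rule borel_measurable_continuous_onI[OF \<open>continuous_on UNIV ?g\<close>])
      have "integrable lborel ?g"
      proof (rule Bochner_Integration.integrable_bound[OF integrable_mult_right[OF cauchy_density_integral(1), of "2 * real n"]])
        have "cmod (1 + (complex_of_real x)\<^sup>2) = 1 + x\<^sup>2" for x
        proof -
          have "1 + (complex_of_real x)\<^sup>2 = complex_of_real (1 + x\<^sup>2)" by simp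
          also have "cmod \<dots> = 1 + x\<^sup>2" unfolding norm_of_real by (simp add: add_nonneg_nonneg)
          finally show ?thesis .
        qed
        then show "AE x in lborel. norm (?g x) \<le> norm (2 * real n * (1 / (1 + x\<^sup>2)))"
          by (simp add: norm_mult norm_divide norm_power add_nonneg_nonneg)
      qed simp
      then show "set_integrable lborel (einterval (- \<infinity>) \<infinity>) ?g" by (simp add: set_integrable_def)
      show "(((\<lambda>x. cw x ^ n) \<circ> real_of_ereal) \<longlongrightarrow> (- 1) ^ n) (at_right (- \<infinity>))"
        unfolding ereal_tendsto_simps1 by (intro tendsto_power tendsto_cw at_top_bot_infinity)
      show "(((\<lambda>x. cw x ^ n) \<circ> real_of_ereal) \<longlongrightarrow> (- 1) ^ n) (at_left \<infinity>)"
        unfolding ereal_tendsto_simps1 by (intro tendsto_power tendsto_cw at_top_bot_infinity)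
    qed simp
    then have g0: "(LINT x|lborel. ?g x) = 0"
      by (simp add: interval_lebesgue_integral_def set_lebesgue_integral_def)
    have "(\<integral>x. cw x ^ n \<partial>cauchy_measure) = (LINT x|lborel. cw x ^ n / of_real (pi * (1 + x\<^sup>2)))"
      by (rule integral_cauchy) simp
    also have "\<dots> = (LINT x|lborel. (1 / (2 * \<i> * of_nat n * of_real pi)) * ?g x)"
      using n by (intro Bochner_Integration.integral_cong) (simp_all add: i_plus_real_nz field_simps)
    also have "\<dots> = 0" unfolding integral_mult_right_zero g0 by simp
    finally show "(\<integral>x. cw x ^ n \<partial>cauchy_measure) = 0" .
  qed
qed

section \<open>Differentiation of power series on the circle\<close>

text \<open>Termwise differentiation: the derivative of the k-th term is at most 2 k |a k| uniformly
  in x, so the differentiated series converges uniformly.\<close>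

lemma circle_series_has_vector_derivative:
  assumes a: "summable (\<lambda>k. real k * cmod (a k))" and a0: "summable (\<lambda>k. cmod (a k))"
  shows "((\<lambda>x. \<Sum>k. a k * cw x ^ k) has_vector_derivative
     (2 * \<i> / (1 + (of_real x)\<^sup>2)) * (\<Sum>k. of_nat k * a k * cw x ^ k)) (at x)"
proof -
  define f' where "f' k x = a k * ((2 * \<i> / (1 + (of_real x)\<^sup>2)) * (of_nat k * cw x ^ k))" for k and x :: real
  define g' where "g' x = (2 * \<i> / (1 + (of_real x)\<^sup>2)) * (\<Sum>k. of_nat k * a k * cw x ^ k)" for x :: real
  have c2: "cmod (2 * \<i> / (1 + (complex_of_real x)\<^sup>2)) \<le> 2" for x
  proof -
    have "1 + (complex_of_real x)\<^sup>2 = complex_of_real (1 + x\<^sup>2)" by simp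
    then have "cmod (2 * \<i> / (1 + (complex_of_real x)\<^sup>2)) = 2 / (1 + x\<^sup>2)"
      by (simp only: norm_divide norm_of_real) (simp add: norm_mult add_nonneg_nonneg)
    then show ?thesis by (simp add: divide_le_eq add_pos_nonneg)
  qed
  have sk: "summable (\<lambda>k. of_nat k * a k * cw x ^ k)" for x
    by (rule summable_comparison_test[OF _ a]) (auto simp: norm_mult norm_power)
  have sums_f': "(\<lambda>k. f' k x) sums g' x" for x
    using sums_mult[OF summable_sums[OF sk[of x]], of "2 * \<i> / (1 + (of_real x)\<^sup>2)"]
    by (simp add: f'_def g'_def mult_ac)
  have nf': "cmod (f' k x) \<le> 2 * (real k * cmod (a k))" for k x
  proof -
    have "cmod (f' k x) = cmod (2 * \<i> / (1 + (complex_of_real x)\<^sup>2)) * (real k * cmod (a k))"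
      unfolding f'_def norm_mult norm_power norm_cw norm_of_nat power_one by (simp only: mult_1_right mult_ac)
    also have "\<dots> \<le> 2 * (real k * cmod (a k))" by (intro mult_right_mono c2) simp
    finally show ?thesis .
  qed
  define t where "t n = 2 * ((\<Sum>k. real k * cmod (a k)) - (\<Sum>k<n. real k * cmod (a k)))" for n
  have tail: "cmod ((\<Sum>i<n. f' i x) - g' x) \<le> t n" for n x
  proof -
    have "g' x - (\<Sum>i<n. f' i x) = (\<Sum>i. f' (i + n) x)"
      using suminf_minus_initial_segment[OF sums_summable[OF sums_f'[of x]], of n] sums_unique[OF sums_f'[of x]]
      by (simp add: lessThan_atLeast0)
    also have "cmod \<dots> \<le> (\<Sum>i. 2 * (real (i + n) * cmod (a (i + n))))"
      using summable_mult[OF summable_ignore_initial_segment[OF a, of n], of 2]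
      by (intro norm_suminf_le nf') simp
    also have "\<dots> = t n"
      unfolding t_def using suminf_minus_initial_segment[OF a, of n]
        suminf_mult[OF summable_ignore_initial_segment[OF a, of n], of 2]
      by (simp add: lessThan_atLeast0)
    finally show ?thesis by (simp add: norm_minus_commute)
  qed
  have t0: "t \<longlonglongrightarrow> 0"
  proof -
    have "t \<longlonglongrightarrow> 2 * ((\<Sum>k. real k * cmod (a k)) - (\<Sum>k. real k * cmod (a k)))"
      unfolding t_def by (intro tendsto_intros summable_LIMSEQ a)
    then show ?thesis by simp
  qed
  have "\<exists>g. \<forall>x\<in>UNIV. (\<lambda>n. a n * cw x ^ n) sums g x \<and> (g has_derivative (\<lambda>h. h *\<^sub>R g' x)) (at x within UNIV)"
  proof (rule has_derivative_series[where f' = "\<lambda>n x h. h *\<^sub>R f' n x" and x = 0])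
    show "convex (UNIV :: real set)" by simp
    show "((\<lambda>x. a n * cw x ^ n) has_derivative (\<lambda>h. h *\<^sub>R f' n x)) (at x within UNIV)" for n x
      using has_vector_derivative_mult_right[OF cw_power_has_vector_derivative, of "a n" n x]
      unfolding has_vector_derivative_def f'_def .
    fix e :: real assume "e > 0"
    then have "\<forall>\<^sub>F n in sequentially. t n < e" using t0 by (intro order_tendstoD) auto
    then show "\<forall>\<^sub>F n in sequentially. \<forall>x\<in>UNIV. \<forall>h. norm ((\<Sum>i<n. h *\<^sub>R f' i x) - h *\<^sub>R g' x) \<le> e * norm h"
    proof eventually_elim
      case (elim n)
      show ?case
      proof (intro ballI allI)
        fix x h :: real
        have "norm ((\<Sum>i<n. h *\<^sub>R f' i x) - h *\<^sub>R g' x) = \<bar>h\<bar> * cmod ((\<Sum>i<n. f' i x) - g' x)"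
          by (simp flip: scaleR_sum_right scaleR_diff_right)
        also have "\<dots> \<le> \<bar>h\<bar> * e" using tail[of x n] elim by (intro mult_left_mono) auto
        finally show "norm ((\<Sum>i<n. h *\<^sub>R f' i x) - h *\<^sub>R g' x) \<le> e * norm h" by (simp add: mult.commute)
      qed
    qed
  next
    have "summable (\<lambda>n. a n * cw 0 ^ n)"
      by (rule summable_comparison_test[OF _ a0]) (auto simp: norm_mult norm_power)
    then show "(\<lambda>n. a n * cw 0 ^ n) sums (\<Sum>n. a n * cw 0 ^ n)" by (rule summable_sums)
  qed simp
  then obtain g where g: "\<And>x. (\<lambda>n. a n * cw x ^ n) sums g x" "\<And>x. (g has_derivative (\<lambda>h. h *\<^sub>R g' x)) (at x)"
    by auto
  have "g = (\<lambda>x. \<Sum>k. a k * cw x ^ k)" using sums_unique[OF g(1)] by auto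
  with g(2)[of x] show ?thesis by (simp add: has_vector_derivative_def g'_def)
qed

text \<open>Each differentiation contributes 2 i k, and (2 i)^2 = -4. The outer derivative is not
  multiplied by 1 + x^2, so this factor stays in the denominator.\<close>

lemma circle_series_second_derivative:
  assumes a: "summable (\<lambda>k. (real k)\<^sup>2 * cmod (a k))" and \<psi>: "\<And>x. \<psi> x = (\<Sum>k. a k * cw x ^ k)"
  shows "((\<lambda>y. complex_of_real (1 + y\<^sup>2) * vector_derivative \<psi> (at y)) has_vector_derivative
    - 4 / of_real (1 + x\<^sup>2) * (\<Sum>k. of_nat (k\<^sup>2) * a k * cw x ^ k)) (at x)"
proof -
  have "\<psi> = (\<lambda>x. \<Sum>k. a k * cw x ^ k)" using \<psi> by auto
  then have "(\<psi> has_vector_derivative (2 * \<i> / (1 + (of_real y)\<^sup>2)) * (\<Sum>k. of_nat k * a k * cw y ^ k)) (at y)" for y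
    using circle_series_has_vector_derivative[OF weighted_summable[OF a]] by simp
  then have "vector_derivative \<psi> (at y) = (2 * \<i> / (1 + (of_real y)\<^sup>2)) * (\<Sum>k. of_nat k * a k * cw y ^ k)" for y
    by (rule vector_derivative_at)
  then have "complex_of_real (1 + y\<^sup>2) * vector_derivative \<psi> (at y) = 2 * \<i> * (\<Sum>k. of_nat k * a k * cw y ^ k)" for y
    using i_plus_real_nz(2)[of y] by simp
  then have e1: "(\<lambda>y. complex_of_real (1 + y\<^sup>2) * vector_derivative \<psi> (at y))
      = (\<lambda>y. 2 * \<i> * (\<Sum>k. of_nat k * a k * cw y ^ k))" by auto
  have e2: "((\<lambda>y. 2 * \<i> * (\<Sum>k. of_nat k * a k * cw y ^ k)) has_vector_derivative
      2 * \<i> * ((2 * \<i> / (1 + (of_real x)\<^sup>2)) * (\<Sum>k. of_nat k * (of_nat k * a k) * cw x ^ k))) (at x)"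
  proof (rule has_vector_derivative_mult_right, rule circle_series_has_vector_derivative)
    show "summable (\<lambda>k. real k * cmod (of_nat k * a k))"
      using a by (simp add: norm_mult power2_eq_square mult.assoc)
    show "summable (\<lambda>k. cmod (of_nat k * a k))"
      using weighted_summable(1)[OF a] by (simp add: norm_mult)
  qed
  have e3: "2 * \<i> * ((2 * \<i> / (1 + (of_real x)\<^sup>2)) * (\<Sum>k. of_nat k * (of_nat k * a k) * cw x ^ k))
      = - 4 / of_real (1 + x\<^sup>2) * (\<Sum>k. of_nat (k\<^sup>2) * a k * cw x ^ k)"
    by (simp add: power2_eq_square mult.assoc)
  show ?thesis using e2 unfolding e1 e3 .
qed

section \<open>The coefficients of a resolvent\<close>

lemma summable_square_geometric:
  fixes r :: real
  assumes "0 \<le> r" "r < 1"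
  shows "summable (\<lambda>k. (real k)\<^sup>2 * r ^ k)"
proof -
  \<comment> \<open>With q the fourth root of r, k^2 r^k = (k q^k)^2 (q^2)^k, where the first factor
    is bounded and the second is geometric.\<close>
  define q where "q = sqrt (sqrt r)"
  have q: "0 \<le> q" "q < 1" and qr: "(q\<^sup>2)\<^sup>2 = r" using assms by (simp_all add: q_def)
  have "(\<lambda>k. real k * q ^ k) \<longlonglongrightarrow> 0" using q by (intro powser_times_n_limit_0) auto
  then have "Bseq (\<lambda>k. real k * q ^ k)" by (rule convergent_imp_Bseq[OF convergentI])
  then obtain K where K: "\<And>k. norm (real k * q ^ k) \<le> K" unfolding Bseq_def by blast
  have "summable (\<lambda>k. K\<^sup>2 * (q\<^sup>2) ^ k)"
    using q abs_square_less_1[of q] by (intro summable_mult summable_geometric) simp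
  then show ?thesis
  proof (rule summable_comparison_test[rotated], intro exI allI impI)
    fix k
    have "(real k)\<^sup>2 * r ^ k = (real k * q ^ k)\<^sup>2 * (q\<^sup>2) ^ k"
      unfolding qr[symmetric] by (simp add: power_mult_distrib flip: power_mult power_add)
    also have "\<dots> \<le> K\<^sup>2 * (q\<^sup>2) ^ k"
      using K[of k] q by (intro mult_right_mono power_mono) auto
    finally show "norm ((real k)\<^sup>2 * r ^ k) \<le> K\<^sup>2 * (q\<^sup>2) ^ k" using assms by simp
  qed
qed

text \<open>The reciprocal of the Cayley transform of z; it lies in the open unit disc when z is in
  the lower half plane.\<close>

definition rho :: "complex \<Rightarrow> complex" where
  "rho z = (\<i> + z) / (\<i> - z)"

text \<open>The expansion of \<open>1 / (\<lambda> - z) = (1 + w) / ((\<i> - z) (1 - rho z * w))\<close>, where \<open>w = cw \<lambda>\<close>.\<close>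

definition res_coeff :: "complex \<Rightarrow> nat \<Rightarrow> complex" where
  "res_coeff z k = (rho z ^ k + (if k = 0 then 0 else rho z ^ (k - 1))) / (\<i> - z)"

lemma norm_rho:
  assumes z: "Im z < 0"
  shows "cmod (rho z) < 1"
proof -
  have "\<i> - z \<noteq> 0" using z by (auto simp: complex_eq_iff)
  moreover have "cmod (\<i> + z) < cmod (\<i> - z)"
    unfolding cmod_def using z by (intro real_sqrt_less_mono) (simp add: power2_eq_square algebra_simps)
  ultimately show ?thesis by (simp add: rho_def norm_divide)
qed

lemma summable_res_coeff:
  assumes z: "Im z < 0"
  shows "summable (\<lambda>k. (real k)\<^sup>2 * cmod (res_coeff z k))"
proof -
  \<comment> \<open>\<open>rho z\<close> vanishes at z = -i; the maximum keeps r positive, since the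
    shifted power is bounded by r^k / r.\<close>
  define r where "r = max (cmod (rho z)) (1/2)"
  have r: "0 < r" "r < 1" "cmod (rho z) \<le> r" using norm_rho[OF z] by (auto simp: r_def)
  define C where "C = (1 + 1 / r) / cmod (\<i> - z)"
  have le: "cmod (res_coeff z k) \<le> C * r ^ k" for k
  proof -
    have p: "cmod (rho z ^ j) \<le> r ^ j" for j
      unfolding norm_power using r by (intro power_mono) auto
    have "cmod (rho z ^ k + (if k = 0 then 0 else rho z ^ (k - 1))) \<le> r ^ k + (1 / r) * r ^ k"
    proof (cases k)
      case 0
      then show ?thesis using r by simp
    next
      case (Suc j)
      have "cmod (rho z ^ k + rho z ^ j) \<le> r ^ k + r ^ j"
        by (rule order_trans[OF norm_triangle_ineq add_mono[OF p p]])
      then show ?thesis using r Suc by simp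
    qed
    then show ?thesis
      by (simp add: res_coeff_def norm_divide C_def divide_right_mono algebra_simps flip: add_divide_distrib)
  qed
  have "summable (\<lambda>k. C * ((real k)\<^sup>2 * r ^ k))"
    using r by (intro summable_mult summable_square_geometric) auto
  then show ?thesis
  proof (rule summable_comparison_test[rotated], intro exI allI impI)
    fix k
    show "norm ((real k)\<^sup>2 * cmod (res_coeff z k)) \<le> C * ((real k)\<^sup>2 * r ^ k)"
      using mult_left_mono[OF le[of k], of "(real k)\<^sup>2"] by (simp add: mult.left_commute)
  qed
qed

lemma res_coeff_sums:
  assumes z: "Im z < 0"
  shows "(\<Sum>k. res_coeff z k * cw x ^ k) = 1 / (of_real x - z)"
proof -
  let ?w = "cw x" and ?\<rho> = "rho z"
  have nrw: "norm (?\<rho> * ?w) < 1" using norm_rho[OF z] by (simp add: norm_mult)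
  have iz: "\<i> - z \<noteq> 0" and xz: "of_real x - z \<noteq> 0" using z by (auto simp: complex_eq_iff)
  have g: "(\<lambda>k. (?\<rho> * ?w) ^ k) sums (1 / (1 - ?\<rho> * ?w))" by (rule geometric_sums[OF nrw])
  have "(\<lambda>k. ?w * (?\<rho> * ?w) ^ k) sums (?w * (1 / (1 - ?\<rho> * ?w)))" by (rule sums_mult[OF g])
  then have "(\<lambda>k. (if Suc k = 0 then 0 else ?\<rho> ^ (Suc k - 1) * ?w ^ Suc k)) sums (?w / (1 - ?\<rho> * ?w))"
    by (simp add: power_mult_distrib mult_ac)
  from sums_Suc[OF this]
  have s: "(\<lambda>k. (if k = 0 then 0 else ?\<rho> ^ (k - 1) * ?w ^ k)) sums (?w / (1 - ?\<rho> * ?w))" by simp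
  have "(\<lambda>k. ((?\<rho> * ?w) ^ k + (if k = 0 then 0 else ?\<rho> ^ (k - 1) * ?w ^ k)) / (\<i> - z))
      sums ((1 / (1 - ?\<rho> * ?w) + ?w / (1 - ?\<rho> * ?w)) / (\<i> - z))"
    by (intro sums_divide sums_add g s)
  moreover have "((?\<rho> * ?w) ^ k + (if k = 0 then 0 else ?\<rho> ^ (k - 1) * ?w ^ k)) / (\<i> - z) = res_coeff z k * ?w ^ k" for k
    by (simp add: res_coeff_def power_mult_distrib distrib_right)
  moreover have "(1 / (1 - ?\<rho> * ?w) + ?w / (1 - ?\<rho> * ?w)) / (\<i> - z) = 1 / (of_real x - z)"
  proof -
    let ?x = "complex_of_real x"
    have ix: "\<i> + ?x \<noteq> 0" by (rule i_plus_real_nz)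
    have d: "(\<i> - z) * (1 - ?\<rho> * ?w) = 2 * \<i> * (?x - z) / (\<i> + ?x)"
    proof -
      have "(\<i> - z) * (1 - ?\<rho> * ?w) = (\<i> - z) - ((\<i> - z) * ?\<rho>) * ?w" by (simp add: right_diff_distrib mult.assoc)
      also have "(\<i> - z) * ?\<rho> = \<i> + z" using iz by (simp add: rho_def)
      also have "(\<i> - z) - (\<i> + z) * ?w = ((\<i> - z) * (\<i> + ?x) - (\<i> + z) * (\<i> - ?x)) / (\<i> + ?x)"
        unfolding cw_def diff_divide_distrib[of "(\<i> - z) * (\<i> + ?x)"] using ix by simp
      also have "(\<i> - z) * (\<i> + ?x) - (\<i> + z) * (\<i> - ?x) = 2 * \<i> * (?x - z)"
        by (simp add: algebra_simps)
      finally show ?thesis .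
    qed
    have n: "1 + ?w = 2 * \<i> / (\<i> + ?x)" using ix by (simp add: cw_def field_simps)
    have "(1 / (1 - ?\<rho> * ?w) + ?w / (1 - ?\<rho> * ?w)) / (\<i> - z) = (1 + ?w) / ((\<i> - z) * (1 - ?\<rho> * ?w))"
      by (simp add: add_divide_distrib[symmetric] mult.commute)
    also have "\<dots> = 1 / (?x - z)" unfolding d n using ix xz by simp
    finally show ?thesis .
  qed
  ultimately show ?thesis by (simp add: sums_iff)
qed

text \<open>One derivative computed twice, from the series and from the closed form 1 / (x - z) of
  its sum; derivatives are unique.\<close>

lemma res_coeff_second_derivative:
  assumes z: "Im z < 0"
  shows "- 4 / of_real (1 + x\<^sup>2) * (\<Sum>k. of_nat (k\<^sup>2) * res_coeff z k * cw x ^ k)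
    = 2 * (1 + complex_of_real x * z) / (complex_of_real x - z) ^ 3"
proof -
  let ?\<psi> = "\<lambda>x. 1 / (complex_of_real x - z)"
  have nz: "complex_of_real y - z \<noteq> 0" for y using z by (auto simp: complex_eq_iff)
  have 1: "((\<lambda>y. complex_of_real (1 + y\<^sup>2) * vector_derivative ?\<psi> (at y)) has_vector_derivative
    - 4 / of_real (1 + x\<^sup>2) * (\<Sum>k. of_nat (k\<^sup>2) * res_coeff z k * cw x ^ k)) (at x)"
    by (rule circle_series_second_derivative[OF summable_res_coeff[OF z]]) (simp add: res_coeff_sums[OF z])
  have "(?\<psi> has_vector_derivative - 1 / (of_real y - z)\<^sup>2) (at y)" for y
  proof -
    have "((\<lambda>u. 1 / (u - z)) has_field_derivative - 1 / (of_real y - z)\<^sup>2) (at (of_real y))"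
      using nz[of y] by (auto intro!: derivative_eq_intros simp: power2_eq_square)
    from has_vector_derivative_real_field[OF this, of UNIV] show ?thesis .
  qed
  then have "vector_derivative ?\<psi> (at y) = - 1 / (of_real y - z)\<^sup>2" for y by (rule vector_derivative_at)
  then have eq: "(\<lambda>y. complex_of_real (1 + y\<^sup>2) * vector_derivative ?\<psi> (at y))
     = (\<lambda>y. (1 + (complex_of_real y)\<^sup>2) * (- 1 / (complex_of_real y - z)\<^sup>2))" by auto
  have 2: "((\<lambda>y. complex_of_real (1 + y\<^sup>2) * vector_derivative ?\<psi> (at y)) has_vector_derivative
    2 * (1 + complex_of_real x * z) / (complex_of_real x - z) ^ 3) (at x)"
  proof -
    let ?x = "complex_of_real x"
    have gen: "2 * X * (- 1 / D\<^sup>2) + (1 + X\<^sup>2) * (2 / D ^ 3) = 2 * (1 + X * (X - D)) / D ^ 3" if "D \<noteq> 0" for X D :: complex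
      using that by (simp add: field_simps power2_eq_square power3_eq_cube)
    have d2: "((\<lambda>u. - 1 / (u - z)\<^sup>2) has_field_derivative 2 / (?x - z) ^ 3) (at ?x)"
    proof -
      have "((\<lambda>u. - 1 / (u - z)\<^sup>2) has_field_derivative
          (0 * (?x - z)\<^sup>2 - (- 1) * (2 * (?x - z))) / ((?x - z)\<^sup>2 * (?x - z)\<^sup>2)) (at ?x)"
        by (rule DERIV_divide) (use nz[of x] in \<open>auto intro!: derivative_eq_intros\<close>)
      moreover have e: "(0 * D\<^sup>2 - (- 1) * (2 * D)) / (D\<^sup>2 * D\<^sup>2) = 2 / D ^ 3" if "D \<noteq> 0" for D :: complex
        using that by (simp add: power2_eq_square power3_eq_cube)
      ultimately show ?thesis unfolding e[OF nz[of x]] by blast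
    qed
    have "((\<lambda>u. (1 + u\<^sup>2) * (- 1 / (u - z)\<^sup>2)) has_field_derivative
        2 * ?x * (- 1 / (?x - z)\<^sup>2) + (1 + ?x\<^sup>2) * (2 / (?x - z) ^ 3)) (at ?x)"
      by (rule derivative_eq_intros d2 refl)+ simp
    then have "((\<lambda>u. (1 + u\<^sup>2) * (- 1 / (u - z)\<^sup>2)) has_field_derivative 2 * (1 + ?x * z) / (?x - z) ^ 3) (at ?x)"
      unfolding gen[OF nz[of x]] by simp
    from has_vector_derivative_real_field[OF this, of UNIV] show ?thesis unfolding eq .
  qed
  show ?thesis by (rule vector_derivative_unique_at[OF 1 2])
qed

section \<open>The trace formula\<close>

lemma csc_power: "(c \<odot> A) ^ k = c ^ k \<odot> A ^ k"
  by (induction k) (simp_all add: csc_mult_left csc_mult_right csc_csc power_commutes)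

lemma csc_minus_left: "(- c) \<odot> A = - (c \<odot> A)"
  by (rule cop_eqI) (simp add: app_csc app_minus_left complex_vector.scale_minus_left)

lemma blin_power: "blinfun_power (blin A) k = blin (A ^ k)"
  unfolding blinfun_power_def by (induction k) (simp_all add: one_cop.rep_eq times_cop.rep_eq)

lemma circle_calculus_blin:
  assumes "summable (\<lambda>k. fourier_coeff \<phi> (int k) \<odot> A ^ k)"
  shows "circle_calculus \<phi> (blin A) = blin (\<Sum>k. fourier_coeff \<phi> (int k) \<odot> A ^ k)"
  unfolding circle_calculus_def blin_power csc.rep_eq[symmetric]
  by (rule bounded_linear.suminf[OF bounded_linear_blin assms, symmetric])

section \<open>Resolvents as power series in the Cayley transform\<close>

context selfadjoint_op
begin

definition neumann :: "complex \<Rightarrow> 'a cop" where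
  "neumann z = (\<Sum>k. (rho z \<odot> cay) ^ k)"

lemma norm_rho_cay: "Im z < 0 \<Longrightarrow> norm (rho z \<odot> cay) < 1"
  using mult_left_mono[OF norm_unitary[OF unitary_cay], of "cmod (rho z)"] norm_rho[of z]
  by (simp add: norm_csc)

text \<open>Both sides are 2 i (T - z) (T + i)^-1.\<close>

lemma shift_cay:
  assumes z: "Im z < 0"
  shows "(\<i> - z) \<odot> (1 - rho z \<odot> cay) = (2 * \<i>) \<odot> (1 - (\<i> + z) \<odot> rs (- \<i>))"
proof -
  have "\<i> - z \<noteq> 0" using z by (auto simp: complex_eq_iff)
  then have r: "(\<i> - z) * rho z = \<i> + z" by (simp add: rho_def)
  have "(\<i> - z) \<odot> (1 - rho z \<odot> cay) = (\<i> - z) \<odot> 1 - (\<i> + z) \<odot> cay"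
    by (simp add: csc_diff_right csc_csc r)
  also have "\<dots> = ((\<i> - z) \<odot> 1 + (\<i> + z) \<odot> 1) - ((\<i> + z) * (2 * \<i>)) \<odot> rs (- \<i>)"
    by (simp add: cay_def csc_diff_right csc_csc)
  also have "(\<i> - z) \<odot> 1 + (\<i> + z) \<odot> 1 = (2 * \<i>) \<odot> (1 :: 'a cop)"
    unfolding csc_add_left[symmetric] by simp
  finally show ?thesis by (simp add: csc_diff_right csc_csc mult.commute)
qed

text \<open>The two geometric parts of \<open>res_coeff\<close> sum to (1 + U) N / (i - z), with U
  the Cayley transform and N the inverse of 1 - \<open>rho z\<close> U. Since 1 + U = 2 i (T +
  i)^-1, the resolvent identity and \<open>shift_cay\<close> identify this with the resolvent at
  z.\<close>

lemma resolvent_series: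
  assumes z: "Im z < 0"
  shows "(\<Sum>k. res_coeff z k \<odot> cay ^ k) = rs z"
proof -
  let ?N = "neumann z" and ?D = "rho z \<odot> cay"
  have iz: "\<i> - z \<noteq> 0" using z by (auto simp: complex_eq_iff)
  note D = norm_rho_cay[OF z]
  have s1: "(\<lambda>k. ?D ^ k) sums ?N" unfolding neumann_def by (rule summable_sums[OF summable_neumann[OF D]])
  from bounded_linear.sums[OF bounded_linear_mult_right s1, of cay]
  have "(\<lambda>k. if Suc k = 0 then 0 else rho z ^ (Suc k - 1) \<odot> cay ^ Suc k) sums (cay * ?N)"
    by (simp add: csc_power csc_mult_right)
  from sums_Suc[OF this] have s2: "(\<lambda>k. if k = 0 then 0 else rho z ^ (k - 1) \<odot> cay ^ k) sums (cay * ?N)" by simp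
  have "(\<lambda>k. (1 / (\<i> - z)) \<odot> (?D ^ k + (if k = 0 then 0 else rho z ^ (k - 1) \<odot> cay ^ k)))
      sums ((1 / (\<i> - z)) \<odot> (?N + cay * ?N))"
    by (intro bounded_linear.sums[OF bounded_linear_csc] sums_add s1 s2)
  moreover have "(1 / (\<i> - z)) \<odot> (?D ^ k + (if k = 0 then 0 else rho z ^ (k - 1) \<odot> cay ^ k)) = res_coeff z k \<odot> cay ^ k" for k
    by (simp add: res_coeff_def csc_power csc_add_right csc_csc add_divide_distrib csc_add_left)
  ultimately have sum: "(\<Sum>k. res_coeff z k \<odot> cay ^ k) = (1 / (\<i> - z)) \<odot> (?N + cay * ?N)"
    by (simp add: sums_iff)
  have z0: "Im z \<noteq> 0" and i0: "Im (- \<i>) \<noteq> 0" using z by auto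
  have "(\<i> - z) \<odot> (rs z * (1 - ?D)) = (2 * \<i>) \<odot> (rs z * (1 - (\<i> + z) \<odot> rs (- \<i>)))"
    unfolding csc_mult_right[symmetric] shift_cay[OF z] ..
  also have "rs z * (1 - (\<i> + z) \<odot> rs (- \<i>)) = rs z - (z - (- \<i>)) \<odot> (rs z * rs (- \<i>))"
    by (simp add: right_diff_distrib csc_mult_right add.commute)
  also have "\<dots> = rs (- \<i>)" unfolding resolvent_identity[OF z0 i0, symmetric] by simp
  finally have "(\<i> - z) \<odot> (rs z * (1 - ?D)) = 1 + cay" by (simp add: cay_def)
  then have "(\<i> - z) \<odot> (rs z * ((1 - ?D) * ?N)) = (1 + cay) * ?N"
    by (simp add: csc_mult_left[symmetric] mult.assoc[symmetric])
  then have "(\<i> - z) \<odot> rs z = ?N + cay * ?N"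
    unfolding neumann_def neumann_right[OF D] by (simp add: distrib_right)
  then have "(1 / (\<i> - z)) \<odot> (\<i> - z) \<odot> rs z = (1 / (\<i> - z)) \<odot> (?N + cay * ?N)" by simp
  then show ?thesis unfolding sum csc_csc using iz by simp
qed

text \<open>The left side is (T + i) (T - z)^-1, the inverse of (T - z) (T + i)^-1; by
  \<open>shift_cay\<close> the latter is a multiple of 1 - \<open>rho z\<close> U.\<close>

lemma neumann_resolvent:
  assumes z: "Im z < 0"
  shows "1 + (\<i> + z) \<odot> rs z = (2 * \<i> / (\<i> - z)) \<odot> neumann z"
proof -
  let ?B = "1 + (\<i> + z) \<odot> rs z" and ?R = "rs (- \<i>)"
  have z0: "Im z \<noteq> 0" and i0: "Im (- \<i>) \<noteq> 0" using z by auto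
  have iz: "\<i> - z \<noteq> 0" using z by (auto simp: complex_eq_iff)
  have ri: "(- \<i> - z) \<odot> (?R * rs z) = ?R - rs z" by (rule resolvent_identity[OF i0 z0, symmetric])
  have gen: "(1 - c \<odot> R) * (1 + c \<odot> G) = 1 + c \<odot> (G - R + (- c) \<odot> (R * G))" for c and R G :: "'a cop"
    by (simp add: algebra_simps csc_mult_left csc_mult_right csc_csc csc_add_right csc_diff_right csc_minus_left)
  have "(1 - (\<i> + z) \<odot> ?R) * ?B = 1 + (\<i> + z) \<odot> (rs z - ?R + (- \<i> - z) \<odot> (?R * rs z))"
    unfolding gen by simp
  also have "\<dots> = 1" unfolding ri by simp
  finally have inv: "(1 - (\<i> + z) \<odot> ?R) * ?B = 1" .
  have "(\<i> - z) \<odot> ((1 - rho z \<odot> cay) * ?B) = (2 * \<i>) \<odot> ((1 - (\<i> + z) \<odot> ?R) * ?B)"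
    unfolding csc_mult_left[symmetric] shift_cay[OF z] ..
  then have "(\<i> - z) \<odot> ((1 - rho z \<odot> cay) * ?B) = (2 * \<i>) \<odot> 1" unfolding inv .
  then have "neumann z * ((\<i> - z) \<odot> ((1 - rho z \<odot> cay) * ?B)) = neumann z * ((2 * \<i>) \<odot> 1)" by simp
  then have "(\<i> - z) \<odot> ((neumann z * (1 - rho z \<odot> cay)) * ?B) = (2 * \<i>) \<odot> neumann z"
    by (simp add: csc_mult_right mult.assoc)
  then have "(\<i> - z) \<odot> ?B = (2 * \<i>) \<odot> neumann z"
    unfolding neumann_def neumann_left[OF norm_rho_cay[OF z]] by simp
  then have "(1 / (\<i> - z)) \<odot> (\<i> - z) \<odot> ?B = (1 / (\<i> - z)) \<odot> (2 * \<i>) \<odot> neumann z" by simp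
  then show ?thesis unfolding csc_csc using iz by simp
qed

text \<open>The derivatives of the powers, weighted geometrically, form the Cauchy product N V N.
  The two parts of \<open>res_coeff\<close> contribute the factors \<open>rho z\<close> and 1, and
  \<open>rho z\<close> + 1 = 2 i / (i - z).\<close>

lemma power_deriv_series:
  assumes z: "Im z < 0"
  shows "(\<Sum>k. res_coeff z k \<odot> power_deriv cay V k) = (2 * \<i> / (\<i> - z)\<^sup>2) \<odot> (neumann z * V * neumann z)"
proof -
  let ?N = "neumann z" and ?D = "rho z \<odot> cay"
  have iz: "\<i> - z \<noteq> 0" using z by (auto simp: complex_eq_iff)
  note D = norm_rho_cay[OF z]
  have nD: "summable (\<lambda>k. norm (?D ^ k))"
    by (rule summable_comparison_test[OF _ summable_geometric[of "norm ?D"]])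
      (use D in \<open>auto intro: norm_power_cop\<close>)
  have nVD: "summable (\<lambda>k. norm (V * ?D ^ k))"
    by (rule summable_comparison_test[OF _ summable_mult[OF nD, of "norm V"]]) (auto intro: norm_mult_ineq)
  have "(\<lambda>k. \<Sum>i\<le>k. ?D ^ i * (V * ?D ^ (k - i))) sums ((\<Sum>k. ?D ^ k) * (\<Sum>k. V * ?D ^ k))"
    by (rule Cauchy_product_sums[OF nD nVD])
  moreover have "(\<Sum>k. V * ?D ^ k) = V * ?N"
    unfolding neumann_def
    by (rule bounded_linear.suminf[OF bounded_linear_mult_right summable_neumann[OF D], symmetric])
  moreover have "(\<Sum>i\<le>k. ?D ^ i * (V * ?D ^ (k - i))) = rho z ^ k \<odot> power_deriv cay V (Suc k)" for k
    unfolding power_deriv_def lessThan_Suc_atMost csc_sum_right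
  proof (intro sum.cong refl)
    fix i assume "i \<in> {..k}"
    then have "rho z ^ (k - i) * rho z ^ i = rho z ^ k" by (simp flip: power_add)
    then show "?D ^ i * (V * ?D ^ (k - i)) = rho z ^ k \<odot> (cay ^ i * V * cay ^ (Suc k - Suc i))"
      by (simp add: csc_power csc_mult_left csc_mult_right csc_csc mult.assoc)
  qed
  ultimately have S: "(\<lambda>k. rho z ^ k \<odot> power_deriv cay V (Suc k)) sums (?N * V * ?N)"
    by (simp add: neumann_def mult.assoc)
  have p0: "power_deriv cay V 0 = 0" by (simp add: power_deriv_def)
  from S have "(\<lambda>k. if Suc k = 0 then 0 else rho z ^ (Suc k - 1) \<odot> power_deriv cay V (Suc k)) sums (?N * V * ?N)" by simp
  from sums_Suc[OF this] have s2: "(\<lambda>k. if k = 0 then 0 else rho z ^ (k - 1) \<odot> power_deriv cay V k) sums (?N * V * ?N)"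
    by simp
  from bounded_linear.sums[OF bounded_linear_csc S, of "rho z"]
  have "(\<lambda>k. rho z ^ Suc k \<odot> power_deriv cay V (Suc k)) sums (rho z \<odot> (?N * V * ?N))"
    by (simp add: csc_csc)
  from sums_Suc[OF this] have s1: "(\<lambda>k. rho z ^ k \<odot> power_deriv cay V k) sums (rho z \<odot> (?N * V * ?N))"
    by (simp add: p0)
  have "(\<lambda>k. (1 / (\<i> - z)) \<odot> (rho z ^ k \<odot> power_deriv cay V k
        + (if k = 0 then 0 else rho z ^ (k - 1) \<odot> power_deriv cay V k)))
      sums ((1 / (\<i> - z)) \<odot> (rho z \<odot> (?N * V * ?N) + ?N * V * ?N))"
    by (intro bounded_linear.sums[OF bounded_linear_csc] sums_add s1 s2)
  moreover have "(1 / (\<i> - z)) \<odot> (rho z ^ k \<odot> power_deriv cay V k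
        + (if k = 0 then 0 else rho z ^ (k - 1) \<odot> power_deriv cay V k)) = res_coeff z k \<odot> power_deriv cay V k" for k
    by (simp add: res_coeff_def csc_add_right csc_csc add_divide_distrib csc_add_left)
  moreover have "(1 / (\<i> - z)) \<odot> (rho z \<odot> (?N * V * ?N) + ?N * V * ?N) = (2 * \<i> / (\<i> - z)\<^sup>2) \<odot> (?N * V * ?N)"
  proof -
    have "rho z + 1 = 2 * \<i> / (\<i> - z)" using iz by (simp add: rho_def field_simps)
    then have "(1 / (\<i> - z)) * (rho z + 1) = 2 * \<i> / (\<i> - z)\<^sup>2" by (simp add: power2_eq_square)
    moreover have "(1 / (\<i> - z)) \<odot> (rho z \<odot> X + X) = ((1 / (\<i> - z)) * (rho z + 1)) \<odot> X" for X :: "'a cop"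
      by (simp add: csc_add_right csc_csc csc_add_left[symmetric] distrib_left del: times_divide_eq_left)
    ultimately show ?thesis by simp
  qed
  ultimately show ?thesis by (simp add: sums_iff)
qed

lemma op_quotient_eq:
  assumes z: "Im z \<noteq> 0"
  shows "blinfun_of_op ((scalar_op \<i> +\<^sub>o T) \<circ>\<^sub>m op_inverse (T -\<^sub>o scalar_op z)) = blin (1 + (\<i> + z) \<odot> rs z)"
proof -
  have "((scalar_op \<i> +\<^sub>o T) \<circ>\<^sub>m op_inverse (T -\<^sub>o scalar_op z)) y = Some ((1 + (\<i> + z) \<odot> rs z) \<cdot> y)" for y
  proof -
    have "(scalar_op \<i> +\<^sub>o T) (rs z \<cdot> y) = Some (\<i> *\<^sub>C (rs z \<cdot> y) + ap (rs z \<cdot> y))"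
      using rs_dom[OF z, of y] by (simp add: op_add_def scalar_op_def dom_def)
    also have "\<i> *\<^sub>C (rs z \<cdot> y) + ap (rs z \<cdot> y) = (1 + (\<i> + z) \<odot> rs z) \<cdot> y"
      by (simp add: ap_rs[OF z] app_add_left app_csc scaleC_add_left)
    finally show ?thesis by (simp add: op_inverse_shift[OF z])
  qed
  then show ?thesis
    unfolding blinfun_of_op_def by (simp add: app.rep_eq blinfun_apply_inverse)
qed

end

section \<open>A pair of self-adjoint operators with Hilbert-Schmidt difference\<close>

locale hs_selfadjoint_pair = selfadjoint_pair H H0 + onb E
  for H H0 :: "'a::complex_hilbert unbounded_op" and E :: "'a set" +
  fixes K :: "'a cop"
  assumes HS_K: "hs E K"
    and perturbation: "\<And>x. x \<in> dom H0 \<Longrightarrow> H.ap x - H0.ap x = K \<cdot> x"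
begin

sublocale unitary_pair_moments E H0.cay H.cay cauchy_measure cw
  by (unfold_locales) (auto intro: H.unitary_cay H0.unitary_cay line.total line.integral_w_power)

abbreviation "V \<equiv> H.cay - H0.cay"

lemma V_eq: "V = (2 * \<i>) \<odot> (H.rs (- \<i>) - H0.rs (- \<i>))"
  by (simp add: H.cay_def H0.cay_def csc_diff_right)

lemma HS_V: "HS V"
  unfolding V_eq rs_perturbation[OF perturbation, simplified]
  by (intro hs_csc hs_uminus HS_mult_right hs_mult_left HS_K)

definition remainder :: "(nat \<Rightarrow> complex) \<Rightarrow> 'a cop" where
  "remainder a = (\<Sum>k. a k \<odot> power_remainder H0.cay H.cay k)"

lemma remainder_eq:
  assumes a: "summable (\<lambda>k. (real k)\<^sup>2 * cmod (a k))"
  shows "remainder a = (\<Sum>k. a k \<odot> H.cay ^ k) - (\<Sum>k. a k \<odot> H0.cay ^ k) - (\<Sum>k. a k \<odot> power_deriv H0.cay V k)"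
proof -
  note n = norm_unitary[OF H.unitary_cay] norm_unitary[OF H0.unitary_cay]
  note s = power_path_derivative(2,3)[OF n(2,1) a]
  show ?thesis
    unfolding remainder_def power_remainder_def csc_diff_right
    by (simp only: suminf_diff[OF s(2)[OF n(1)] s(2)[OF n(2)]]
        suminf_diff[OF summable_diff[OF s(2)[OF n(1)] s(2)[OF n(2)]] s(1)])
qed

lemma spectral_shift_function:
  "\<exists>\<xi> :: real \<Rightarrow> complex. \<xi> \<in> borel_measurable borel
    \<and> integrable lborel (\<lambda>x. \<xi> x / complex_of_real (1 + x\<^sup>2))
    \<and> (\<forall>a. summable (\<lambda>k. (real k)\<^sup>2 * cmod (a k)) \<longrightarrow> trace_class (blin (remainder a)) \<and>
       tr (remainder a) = (LINT x|lborel. (- 4 / of_real (1 + x\<^sup>2) * (\<Sum>k. of_nat (k\<^sup>2) * a k * cw x ^ k)) * \<xi> x))"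
proof -
  obtain \<eta> where \<eta>: "integrable cauchy_measure \<eta>"
    and mom: "\<And>n. of_nat (n\<^sup>2) * (\<integral>x. cw x ^ n * \<eta> x \<partial>cauchy_measure) = tr (power_remainder H0.cay H.cay n)"
    using spectral_shift_exists[OF HS_V] by blast
  have \<eta>m [measurable]: "\<eta> \<in> borel_measurable borel"
    using borel_measurable_integrable[OF \<eta>] by (simp add: cauchy_measure_def)
  \<comment> \<open>The factor turns the Cauchy density 1 / (pi (1 + x^2)) into the - 4 / (1 + x^2)
    of \<open>circle_series_second_derivative\<close>.\<close>
  define \<xi> where "\<xi> x = - \<eta> x / of_real (4 * pi)" for x
  show ?thesis
  proof (rule exI[of _ \<xi>], intro conjI allI impI)
    show "\<xi> \<in> borel_measurable borel" unfolding \<xi>_def by measurable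
    have "integrable lborel (\<lambda>x. \<eta> x / of_real (pi * (1 + x\<^sup>2)))"
      using \<eta> unfolding integrable_cauchy_iff[OF \<eta>m] .
    moreover have "- 1 / 4 * (e / (p * d)) = - e / (4 * p) / d" for e p d :: complex
      by simp
    ultimately show "integrable lborel (\<lambda>x. \<xi> x / complex_of_real (1 + x\<^sup>2))"
      using integrable_mult_right[of "- 1 / 4 :: complex" lborel "\<lambda>x. \<eta> x / of_real (pi * (1 + x\<^sup>2))"]
      by (simp only: \<xi>_def of_real_mult of_real_numeral)
    fix a :: "nat \<Rightarrow> complex" assume a: "summable (\<lambda>k. (real k)\<^sup>2 * cmod (a k))"
    let ?s = "\<lambda>x. \<Sum>k. of_nat (k\<^sup>2) * a k * cw x ^ k"
    note tf = trace_formula_series[OF HS_V \<eta> mom a]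
    have "?s \<in> borel_measurable borel"
    proof (rule borel_measurable_LIMSEQ_metric)
      show "(\<lambda>x. \<Sum>k<n. of_nat (k\<^sup>2) * a k * cw x ^ k) \<in> borel_measurable borel" for n by measurable
      show "(\<lambda>n. \<Sum>k<n. of_nat (k\<^sup>2) * a k * cw x ^ k) \<longlonglongrightarrow> ?s x" for x
        by (rule summable_LIMSEQ, rule summable_comparison_test[OF _ a]) (auto simp: norm_mult norm_power)
    qed
    then have [measurable]: "(\<lambda>x. ?s x * \<eta> x) \<in> borel_measurable borel" by (intro borel_measurable_times \<eta>m)
    have "tr (remainder a) = (LINT x|lborel. ?s x * \<eta> x / of_real (pi * (1 + x\<^sup>2)))"
      unfolding remainder_def tf(2) by (rule integral_cauchy) measurable
    also have "\<dots> = (LINT x|lborel. (- 4 / of_real (1 + x\<^sup>2) * ?s x) * \<xi> x)"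
      by (intro Bochner_Integration.integral_cong) (simp_all add: \<xi>_def mult_ac)
    finally show "tr (remainder a) = (LINT x|lborel. (- 4 / of_real (1 + x\<^sup>2) * ?s x) * \<xi> x)" .
    show "trace_class (blin (remainder a))"
      using trace_classI[OF tf(1)] by (simp add: remainder_def)
  qed
qed

lemma real_calculus_remainder:
  assumes \<psi>: "\<psi> \<in> F_real"
  obtains a where "summable (\<lambda>k. (real k)\<^sup>2 * cmod (a k))" and "\<psi> = (\<lambda>x. \<Sum>k. a k * cw x ^ k)"
    and "(\<lambda>s. real_calculus \<psi> (W_path H H0 s)) differentiable (at 0 within {0..1})"
    and "real_calculus \<psi> H - real_calculus \<psi> H0
      - vector_derivative (\<lambda>s. real_calculus \<psi> (W_path H H0 s)) (at 0 within {0..1}) = blin (remainder a)"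
proof -
  \<comment> \<open>The same choice as in \<open>real_calculus\<close>, so the coefficients a belong
    to H, H0 and the whole path at once.\<close>
  define \<phi> where "\<phi> = (SOME \<phi>. corresponds \<psi> \<phi>)"
  have cor: "corresponds \<psi> \<phi>"
    unfolding \<phi>_def using \<psi> by (intro someI_ex[of "corresponds \<psi>"]) (auto simp: F_real_def)
  define a where "a k = fourier_coeff \<phi> (int k)" for k
  have a: "summable (\<lambda>k. (real k)\<^sup>2 * cmod (a k))"
    using cor by (simp add: corresponds_def F2_plus_def a_def)
  have ser: "\<psi> x = (\<Sum>k. a k * cw x ^ k)" for x
  proof -
    have "cw x \<in> sphere 0 1" by simp
    then have "(\<lambda>k. a k * cw x ^ k) sums \<phi> (cw x)"
      using cor unfolding corresponds_def F2_plus_def a_def by blast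
    moreover have "\<psi> x = \<phi> (cw x)" using cor by (simp add: corresponds_def cw_def)
    ultimately show ?thesis by (simp add: sums_iff)
  qed
  note n = norm_unitary[OF H.unitary_cay] norm_unitary[OF H0.unitary_cay]
  note d = power_path_derivative[OF n(2,1) a]
  have calc: "real_calculus \<psi> T = blin (\<Sum>k. a k \<odot> C ^ k)" if "cayley T = blin C" "norm C \<le> 1" for T and C :: "'a cop"
    unfolding real_calculus_def \<phi>_def[symmetric] that(1)
    using circle_calculus_blin[of \<phi> C] d(3)[OF that(2)] by (simp add: a_def)
  let ?U = "\<lambda>s. H0.cay + s *\<^sub>R V" and ?L = "\<Sum>k. a k \<odot> power_deriv H0.cay V k"
  have Us: "norm (?U s) \<le> 1" if "s \<in> {0..1}" for s using norm_convex_path[OF n(2,1)] that by auto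
  have "((\<lambda>s. blin (\<Sum>k. a k \<odot> ?U s ^ k)) has_vector_derivative blin ?L) (at 0 within {0..1})"
    by (rule bounded_linear.has_vector_derivative[OF bounded_linear_blin d(1)])
  then have der: "((\<lambda>s. real_calculus \<psi> (W_path H H0 s)) has_vector_derivative blin ?L) (at 0 within {0..1})"
    by (rule has_vector_derivative_transform[rotated 2])
      (use calc[OF cayley_W_path Us] in auto)
  show thesis
  proof (rule that[OF a ext, OF ser])
    show "(\<lambda>s. real_calculus \<psi> (W_path H H0 s)) differentiable (at 0 within {0..1})"
      using der by (rule differentiableI_vector)
    have "vector_derivative (\<lambda>s. real_calculus \<psi> (W_path H H0 s)) (at 0 within {0..1}) = blin ?L"
      by (rule vector_derivative_within[OF _ der]) (simp add: at_within_Icc_at_right trivial_limit_at_right_real)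
    then show "real_calculus \<psi> H - real_calculus \<psi> H0
      - vector_derivative (\<lambda>s. real_calculus \<psi> (W_path H H0 s)) (at 0 within {0..1}) = blin (remainder a)"
      using calc[OF H.cayley_eq n(1)] calc[OF H0.cayley_eq n(2)]
      by (simp add: remainder_eq[OF a] minus_cop.rep_eq)
  qed
qed

lemma resolvent_remainder:
  assumes z: "Im z < 0"
  defines "B \<equiv> blinfun_of_op ((scalar_op \<i> +\<^sub>o H0) \<circ>\<^sub>m op_inverse (H0 -\<^sub>o scalar_op z))"
  shows "resolvent H z - resolvent H0 z - (B o\<^sub>L (resolvent H (- \<i>) - resolvent H0 (- \<i>)) o\<^sub>L B)
    = blin (remainder (res_coeff z))"
proof -
  have z0: "Im z \<noteq> 0" and i0: "Im (- \<i>) \<noteq> 0" using z by auto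
  have iz: "\<i> - z \<noteq> 0" using z by (auto simp: complex_eq_iff)
  let ?N = "H0.neumann z" and ?M = "H.rs (- \<i>) - H0.rs (- \<i>)"
  have B: "B = blin ((2 * \<i> / (\<i> - z)) \<odot> ?N)"
    unfolding B_def H0.op_quotient_eq[OF z0] H0.neumann_resolvent[OF z] ..
  have "remainder (res_coeff z) = H.rs z - H0.rs z - (2 * \<i> / (\<i> - z)\<^sup>2) \<odot> (?N * V * ?N)"
    unfolding remainder_eq[OF summable_res_coeff[OF z]] H.resolvent_series[OF z] H0.resolvent_series[OF z]
      H0.power_deriv_series[OF z] ..
  \<comment> \<open>V is 2 i times the difference of the resolvents at -i, and this second factor 2
    i completes the square of 2 i / (i - z).\<close>
  also have "(2 * \<i> / (\<i> - z)\<^sup>2) \<odot> (?N * V * ?N) = ((2 * \<i> / (\<i> - z)) \<odot> ?N) * ?M * ((2 * \<i> / (\<i> - z)) \<odot> ?N)"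
    unfolding V_eq by (simp add: csc_mult_left csc_mult_right csc_csc power2_eq_square)
  finally have "blin (remainder (res_coeff z)) = blin (H.rs z) - blin (H0.rs z)
     - (B o\<^sub>L (blin (H.rs (- \<i>)) - blin (H0.rs (- \<i>))) o\<^sub>L B)"
    by (simp add: B minus_cop.rep_eq times_cop.rep_eq)
  then show ?thesis
    by (simp only: H.resolvent_eq[OF z0] H0.resolvent_eq[OF z0] H.resolvent_eq[OF i0] H0.resolvent_eq[OF i0])
qed

end

theorem theorem7p1:
  fixes H H0 :: "'a::complex_hilbert unbounded_op"
  assumes "separable TYPE('a)" and "infinite_dimensional TYPE('a)"
    and "selfadjoint H" and "selfadjoint H0"
    and "dom H = dom H0"
    and "\<exists>K. hilbert_schmidt K \<and> (H -\<^sub>o H0) \<subseteq>\<^sub>m op_of_blinfun K"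
  shows "\<exists>\<xi> :: real \<Rightarrow> complex.
    \<xi> \<in> borel_measurable borel \<and>
    integrable lborel (\<lambda>x. \<xi> x / complex_of_real (1 + x\<^sup>2)) \<and>
    (\<forall>\<psi>\<in>F_real.
       let F = (\<lambda>s. real_calculus \<psi> (W_path H H0 s));
           R = real_calculus \<psi> H - real_calculus \<psi> H0 - vector_derivative F (at 0 within {0..1})
       in F differentiable (at 0 within {0..1}) \<and> trace_class R \<and>
          op_trace R = (LINT x|lborel.
            vector_derivative
              (\<lambda>y. complex_of_real (1 + y\<^sup>2) * vector_derivative \<psi> (at y)) (at x) * \<xi> x)) \<and>
    (\<forall>z. Im z < 0 \<longrightarrow>
       (let M = resolvent H (- \<i>) - resolvent H0 (- \<i>);
            B = blinfun_of_op ((scalar_op \<i> +\<^sub>o H0) \<circ>\<^sub>m op_inverse (H0 -\<^sub>o scalar_op z));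
            R = resolvent H z - resolvent H0 z - (B o\<^sub>L M o\<^sub>L B)
        in trace_class R \<and>
           op_trace R = (LINT x|lborel.
             2 * (1 + complex_of_real x * z) / (complex_of_real x - z) ^ 3 * \<xi> x)))"
proof -
  obtain K' where K': "hilbert_schmidt K'" "(H -\<^sub>o H0) \<subseteq>\<^sub>m op_of_blinfun K'"
    using assms(6) by blast
  obtain E' where E': "orthonormal_basis E'" "(\<lambda>e. (norm (blinfun_apply K' e))\<^sup>2) summable_on E'"
    and "complex_linear K'"
    using K'(1) by (auto simp: hilbert_schmidt_def)
  define K where "K = Cop K'"
  have K: "blin K = K'" using \<open>complex_linear K'\<close> by (simp add: K_def Cop_inverse)
  \<comment> \<open>The basis that \<open>op_trace\<close> selects; basis independence carries the
    Hilbert-Schmidt condition over from E'.\<close>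
  define E :: "'a set" where "E = (SOME E. orthonormal_basis E)"
  have E: "orthonormal_basis E" unfolding E_def using E'(1) by (rule someI)
  interpret hs_selfadjoint_pair H H0 E K
  proof
    have "hs E' K" using E'(2) by (simp add: hs_def app.rep_eq K)
    then show "hs E K" by (rule hs_basis_independent[OF E'(1) E])
    fix x assume x: "x \<in> dom H0"
    then have "(H -\<^sub>o H0) x = Some (the (H x) - the (H0 x))"
      using assms(5) by (simp add: op_diff_def)
    then have "op_of_blinfun K' x = Some (the (H x) - the (H0 x))"
      using K'(2) unfolding map_le_def by (metis domI)
    then show "the (H x) - the (H0 x) = K \<cdot> x" by (simp add: op_of_blinfun_def app.rep_eq K)
  qed (use assms E in auto)
  have trace: "op_trace (blin A) = tr A" for A :: "'a cop"
  proof -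
    have "op_trace (blin A) = (\<Sum>\<^sub>\<infinity>e\<in>E. cinner e (blinfun_apply (blin A) e))"
      unfolding op_trace_def E_def ..
    then show ?thesis by (simp add: tr_def app.rep_eq)
  qed
  obtain \<xi> :: "real \<Rightarrow> complex" where \<xi>: "\<xi> \<in> borel_measurable borel"
      "integrable lborel (\<lambda>x. \<xi> x / complex_of_real (1 + x\<^sup>2))"
    and formula: "\<And>a. summable (\<lambda>k. (real k)\<^sup>2 * cmod (a k)) \<Longrightarrow> trace_class (blin (remainder a)) \<and>
       tr (remainder a) = (LINT x|lborel. (- 4 / of_real (1 + x\<^sup>2) * (\<Sum>k. of_nat (k\<^sup>2) * a k * cw x ^ k)) * \<xi> x)"
    using spectral_shift_function by blast
  show ?thesis
    unfolding Let_def
  proof (intro exI[of _ \<xi>] conjI ballI allI impI \<xi>)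
    fix \<psi> assume "\<psi> \<in> F_real"
    then obtain a where a: "summable (\<lambda>k. (real k)\<^sup>2 * cmod (a k))" and ser: "\<psi> = (\<lambda>x. \<Sum>k. a k * cw x ^ k)"
      and diff: "(\<lambda>s. real_calculus \<psi> (W_path H H0 s)) differentiable (at 0 within {0..1})"
      and R: "real_calculus \<psi> H - real_calculus \<psi> H0
        - vector_derivative (\<lambda>s. real_calculus \<psi> (W_path H H0 s)) (at 0 within {0..1}) = blin (remainder a)"
      by (rule real_calculus_remainder)
    show "(\<lambda>s. real_calculus \<psi> (W_path H H0 s)) differentiable (at 0 within {0..1})" by (rule diff)
    show "trace_class (real_calculus \<psi> H - real_calculus \<psi> H0
        - vector_derivative (\<lambda>s. real_calculus \<psi> (W_path H H0 s)) (at 0 within {0..1}))"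
      unfolding R using formula[OF a] by blast
    show "op_trace (real_calculus \<psi> H - real_calculus \<psi> H0
        - vector_derivative (\<lambda>s. real_calculus \<psi> (W_path H H0 s)) (at 0 within {0..1}))
      = (LINT x|lborel. vector_derivative
          (\<lambda>y. complex_of_real (1 + y\<^sup>2) * vector_derivative \<psi> (at y)) (at x) * \<xi> x)"
      unfolding R trace vector_derivative_at[OF circle_series_second_derivative[OF a fun_cong[OF ser]]]
      using formula[OF a] by blast
  next
    fix z assume z: "Im z < 0"
    note f = formula[OF summable_res_coeff[OF z]]
    show "trace_class (resolvent H z - resolvent H0 z -
        (blinfun_of_op ((scalar_op \<i> +\<^sub>o H0) \<circ>\<^sub>m op_inverse (H0 -\<^sub>o scalar_op z)) o\<^sub>L
         (resolvent H (- \<i>) - resolvent H0 (- \<i>)) o\<^sub>L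
         blinfun_of_op ((scalar_op \<i> +\<^sub>o H0) \<circ>\<^sub>m op_inverse (H0 -\<^sub>o scalar_op z))))"
      unfolding resolvent_remainder[OF z] using f by blast
    show "op_trace (resolvent H z - resolvent H0 z -
        (blinfun_of_op ((scalar_op \<i> +\<^sub>o H0) \<circ>\<^sub>m op_inverse (H0 -\<^sub>o scalar_op z)) o\<^sub>L
         (resolvent H (- \<i>) - resolvent H0 (- \<i>)) o\<^sub>L
         blinfun_of_op ((scalar_op \<i> +\<^sub>o H0) \<circ>\<^sub>m op_inverse (H0 -\<^sub>o scalar_op z))))
      = (LINT x|lborel. 2 * (1 + complex_of_real x * z) / (complex_of_real x - z) ^ 3 * \<xi> x)"
      unfolding resolvent_remainder[OF z] trace res_coeff_second_derivative[OF z, symmetric] using f by blast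
  qed
qed

end
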